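(* Let $T>0$, $\mu_x,\mu_y\in\mathbb{R}$, $0\le\rho_x,\rho_y<1$, $-1\le\rho_{xy}\le 1$ satisfy $$2\rho_x^2(1+2|\rho_{xy}|)\le 1,\qquad 2\rho_y^2(1+2|\rho_{xy}|)\le 1,\qquad 2\rho_x\rho_y(3\rho_{xy}^2+2|\rho_{xy}|+1)\le 1 .$$ Let $h_0>0$, let $x_0,y_0\in\mathbb{R}$ be such that $x_0/h_0$ and $y_0/h_0$ are integers, and fix $\lambda>0$. For integers $l_1,l_2\ge 1$ put $h_x=h_0 2^{-l_1}$, $h_y=h_0 2^{-l_2}$, and let $k>0$ be such that $N=T/k$ is a positive integer and $k/\min\{h_x^2,h_y^2\}\le\lambda$. Let $$\Delta P^N_{(l_1,l_2)}=P^N_{(l_1,l_2)}-P^N_{(l_1,l_2-1)}-P^N_{(l_1-1,l_2)}+P^N_{(l_1-1,l_2-1)},$$ where the four terms are the numerical approximations defined in the context, all computed with the same time step $k$ and the same Brownian increments. Then $$\Big|\mathbb{E}\big[\Delta P^N_{(l_1,l_2)}\big]\Big|=O(h_x^2h_y^2),\qquad \mathbb{E}\Big[\big|\Delta P^N_{(l_1,l_2)}\big|^2\Big]=O(h_x^4h_y^4),$$ i.e. there is a constant $C$, independent of $l_1,l_2,k$, such that the left-hand sides are bounded by $C h_x^2h_y^2$ and $C h_x^4h_y^4$ respectively, for all integers $l_1,l_2\ge 1$ and all $k>0$ such that $T/k$ is a positive integer and $k\le\lambda\min\{h_x^2,h_y^2\}$, where $h_x=h_02^{-l_1}$, $h_y=h_02^{-l_2}$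 and $N=T/k$.
   Context: Random inputs. $W=(W^x,W^y)$ is a two-dimensional Brownian motion whose components are standard Brownian motions with correlation $\rho_{xy}$. For a time step $k=T/N$ the normalised increments are $Z_{n,x}=k^{-1/2}(W^x_{(n+1)k}-W^x_{nk})$ and $\widetilde Z_{n,y}=k^{-1/2}(W^y_{(n+1)k}-W^y_{nk})$, $n=0,\dots,N-1$; so $\widetilde Z_{n,y}=\rho_{xy}Z_{n,x}+\sqrt{1-\rho_{xy}^2}\,Z_{n,y}$ with $Z_{n,x},Z_{n,y}$ independent standard normals. Scheme (semi-implicit Milstein finite differences for the SPDE $\mathrm{d}v=\big[-\mu_xv_x-\mu_yv_y+\tfrac12(v_{xx}+2\sqrt{\rho_x\rho_y}\rho_{xy}v_{xy}+v_{yy})\big]\mathrm{d}t-\sqrt{\rho_x}v_x\,\mathrm{d}W^x_t-\sqrt{\rho_y}v_y\,\mathrm{d}W^y_t$ with $v(0)=\delta_{x_0}\otimes\delta_{y_0}$). Given mesh sizes $h_x,h_y>0$ with $i_0=x_0/h_x$, $j_0=y_0/h_y$ integers, $V^n=(V^n_{i,j})_{i,j\in\mathbb{Z}}$, $n=0,\dots,N$, is the sequence of elements of $\ell^2(\mathbb{Z}^2)$ given by $V^0_{i,j}=h_x^{-1}h_y^{-1}$ if $(i,j)=(i_0,j_0)$, $V^0_{i,j}=0$ otherwise, and $$\Big(I+\tfrac{\mu_xk}{2h_x}D_x+\tfrac{\mu_yk}{2h_y}D_y-\tfrac{k}{2h_x^2}D_{xx}-\tfrac{k}{2h_y^2}D_{yy}\Big)V^{n+1}=\Big(I-\tfrac{\sqrt{\rho_xk}Z_{n,x}}{2h_x}D_x-\tfrac{\sqrt{\rho_yk}\widetilde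 Z_{n,y}}{2h_y}D_y+\tfrac{\rho_xk(Z_{n,x}^2-1)}{8h_x^2}D_x^2+\tfrac{\rho_yk(\widetilde Z_{n,y}^2-1)}{8h_y^2}D_y^2+\tfrac{\sqrt{\rho_x\rho_y}kZ_{n,x}\widetilde Z_{n,y}}{4h_xh_y}D_{xy}\Big)V^n,$$ where $(D_xV)_{i,j}=V_{i+1,j}-V_{i-1,j}$, $(D_yV)_{i,j}=V_{i,j+1}-V_{i,j-1}$, $(D_{xx}V)_{i,j}=V_{i+1,j}-2V_{i,j}+V_{i-1,j}$, $(D_{yy}V)_{i,j}=V_{i,j+1}-2V_{i,j}+V_{i,j-1}$, $(D_{xy}V)_{i,j}=V_{i+1,j+1}-V_{i-1,j+1}-V_{i+1,j-1}+V_{i-1,j-1}$, and $D_x^2=D_x\circ D_x$, $D_y^2=D_y\circ D_y$. Functional. For $(l_1,l_2)\in\mathbb{N}_0^2$, with $V^N$ computed with mesh sizes $h_x=h_02^{-l_1}$, $h_y=h_02^{-l_2}$ and time step $k=T/N$, $$P^N_{(l_1,l_2)}=h_xh_y\Big(\sum_{i=1}^\infty\sum_{j=1}^\infty V^N_{i,j}+\tfrac12\sum_{j=1}^\infty V^N_{0,j}+\tfrac12\sum_{i=1}^\infty V^N_{i,0}+\tfrac14V^N_{0,0}\Big).$$ *)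

theory Defs
  imports "HOL-Probability.Probability"
begin

section \<open>Correlated two-dimensional Brownian motion\<close>

text \<open>The centred bivariate normal law with unit variances and correlation \<open>\<rho>\<close>, as the linear image
  of two independent standard normals; this also covers the degenerate cases \<open>\<rho> = 1\<close>, \<open>\<rho> = -1\<close>.\<close>

definition std_binormal :: "real \<Rightarrow> (real \<times> real) measure" where
  "std_binormal \<rho> =
     distr (density lborel std_normal_density \<Otimes>\<^sub>M density lborel std_normal_density) borel
       (\<lambda>(u, v). (u, \<rho> * u + sqrt (1 - \<rho>\<^sup>2) * v))"

definition correlated_BM :: "'a measure \<Rightarrow> real \<Rightarrow> (real \<Rightarrow> 'a \<Rightarrow> real \<times> real) \<Rightarrow> bool" where
  "correlated_BM M \<rho> W \<longleftrightarrow>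
     prob_space M \<and>
     (\<forall>t\<ge>0. W t \<in> borel_measurable M) \<and>
     (AE \<omega> in M. W 0 \<omega> = 0) \<and>
     (AE \<omega> in M. continuous_on {0..} (\<lambda>t. W t \<omega>)) \<and>
     (\<forall>s t. 0 \<le> s \<and> s < t \<longrightarrow>
        distr M borel (\<lambda>\<omega>. (1 / sqrt (t - s)) *\<^sub>R (W t \<omega> - W s \<omega>)) = std_binormal \<rho>) \<and>
     (\<forall>(\<tau> :: nat \<Rightarrow> real) m. 0 \<le> \<tau> 0 \<and> mono \<tau> \<longrightarrow>
        prob_space.indep_vars M (\<lambda>_. borel) (\<lambda>i \<omega>. W (\<tau> (Suc i)) \<omega> - W (\<tau> i) \<omega>) {..<m})"

definition Zx :: "(real \<Rightarrow> 'a \<Rightarrow> real \<times> real) \<Rightarrow> real \<Rightarrow> nat \<Rightarrow> 'a \<Rightarrow> real" where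
  "Zx W k n \<omega> = (fst (W (real (n + 1) * k) \<omega>) - fst (W (real n * k) \<omega>)) / sqrt k"

definition Zy :: "(real \<Rightarrow> 'a \<Rightarrow> real \<times> real) \<Rightarrow> real \<Rightarrow> nat \<Rightarrow> 'a \<Rightarrow> real" where
  "Zy W k n \<omega> = (snd (W (real (n + 1) * k) \<omega>) - snd (W (real n * k) \<omega>)) / sqrt k"


section \<open>The semi-implicit Milstein scheme\<close>

type_synonym grid = "int \<Rightarrow> int \<Rightarrow> real"

definition Dx :: "grid \<Rightarrow> grid" where
  "Dx V = (\<lambda>i j. V (i + 1) j - V (i - 1) j)"

definition Dy :: "grid \<Rightarrow> grid" where
  "Dy V = (\<lambda>i j. V i (j + 1) - V i (j - 1))"

definition Dxx :: "grid \<Rightarrow> grid" where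
  "Dxx V = (\<lambda>i j. V (i + 1) j - 2 * V i j + V (i - 1) j)"

definition Dyy :: "grid \<Rightarrow> grid" where
  "Dyy V = (\<lambda>i j. V i (j + 1) - 2 * V i j + V i (j - 1))"

definition Dxy :: "grid \<Rightarrow> grid" where
  "Dxy V = (\<lambda>i j. V (i + 1) (j + 1) - V (i - 1) (j + 1) - V (i + 1) (j - 1) + V (i - 1) (j - 1))"

definition l2_grid :: "grid set" where
  "l2_grid = {V. (\<lambda>(i, j). (V i j)\<^sup>2) summable_on UNIV}"

definition implicit_op :: "real \<Rightarrow> real \<Rightarrow> real \<Rightarrow> real \<Rightarrow> real \<Rightarrow> grid \<Rightarrow> grid" where
  "implicit_op \<mu>x \<mu>y k hx hy V = (\<lambda>i j.
      V i j
      + \<mu>x * k / (2 * hx) * Dx V i j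
      + \<mu>y * k / (2 * hy) * Dy V i j
      - k / (2 * hx\<^sup>2) * Dxx V i j
      - k / (2 * hy\<^sup>2) * Dyy V i j)"

definition explicit_op ::
  "real \<Rightarrow> real \<Rightarrow> real \<Rightarrow> real \<Rightarrow> real \<Rightarrow> real \<Rightarrow> real \<Rightarrow> grid \<Rightarrow> grid" where
  "explicit_op \<rho>x \<rho>y k hx hy zx zy V = (\<lambda>i j.
      V i j
      - sqrt (\<rho>x * k) * zx / (2 * hx) * Dx V i j
      - sqrt (\<rho>y * k) * zy / (2 * hy) * Dy V i j
      + \<rho>x * k * (zx\<^sup>2 - 1) / (8 * hx\<^sup>2) * Dx (Dx V) i j
      + \<rho>y * k * (zy\<^sup>2 - 1) / (8 * hy\<^sup>2) * Dy (Dy V) i j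
      + sqrt (\<rho>x * \<rho>y) * k * zx * zy / (4 * hx * hy) * Dxy V i j)"

text \<open>The Fourier symbol of the implicit operator has real part at least 1, so the linear system has
  exactly one square-summable solution; this is the element described by \<^term>\<open>The\<close> below.
  Without the square-summability requirement it would not be unique.\<close>

primrec milstein ::
  "real \<Rightarrow> real \<Rightarrow> real \<Rightarrow> real \<Rightarrow> real \<Rightarrow> real \<Rightarrow> real \<Rightarrow> real \<Rightarrow> real \<Rightarrow>
   (nat \<Rightarrow> real) \<Rightarrow> (nat \<Rightarrow> real) \<Rightarrow> nat \<Rightarrow> grid" where
  "milstein \<mu>x \<mu>y \<rho>x \<rho>y x0 y0 k hx hy zx zy 0 =
     (\<lambda>i j. if real_of_int i = x0 / hx \<and> real_of_int j = y0 / hy then 1 / (hx * hy) else 0)"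
| "milstein \<mu>x \<mu>y \<rho>x \<rho>y x0 y0 k hx hy zx zy (Suc n) =
     (THE U. U \<in> l2_grid \<and>
        implicit_op \<mu>x \<mu>y k hx hy U =
        explicit_op \<rho>x \<rho>y k hx hy (zx n) (zy n) (milstein \<mu>x \<mu>y \<rho>x \<rho>y x0 y0 k hx hy zx zy n))"


section \<open>The quadrant functional and its mixed difference\<close>

definition quadrant_functional :: "real \<Rightarrow> real \<Rightarrow> grid \<Rightarrow> real" where
  "quadrant_functional hx hy V = hx * hy *
     ((\<Sum>\<^sub>\<infinity>i\<in>{1..}. \<Sum>\<^sub>\<infinity>j\<in>{1..}. V i j)
      + 1 / 2 * (\<Sum>\<^sub>\<infinity>j\<in>{1..}. V 0 j)
      + 1 / 2 * (\<Sum>\<^sub>\<infinity>i\<in>{1..}. V i 0)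
      + 1 / 4 * V 0 0)"

definition mesh :: "real \<Rightarrow> nat \<Rightarrow> real" where
  "mesh h0 l = h0 / 2 ^ l"

definition P ::
  "real \<Rightarrow> real \<Rightarrow> real \<Rightarrow> real \<Rightarrow> real \<Rightarrow> real \<Rightarrow> real \<Rightarrow> (real \<Rightarrow> 'a \<Rightarrow> real \<times> real) \<Rightarrow>
   real \<Rightarrow> nat \<Rightarrow> nat \<Rightarrow> nat \<Rightarrow> 'a \<Rightarrow> real" where
  "P \<mu>x \<mu>y \<rho>x \<rho>y x0 y0 h0 W k N l1 l2 \<omega> =
     quadrant_functional (mesh h0 l1) (mesh h0 l2)
       (milstein \<mu>x \<mu>y \<rho>x \<rho>y x0 y0 k (mesh h0 l1) (mesh h0 l2)
          (\<lambda>n. Zx W k n \<omega>) (\<lambda>n. Zy W k n \<omega>) N)"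

text \<open>Only meaningful for \<open>l1, l2 \<ge> 1\<close>, because of truncated subtraction.\<close>

definition DeltaP ::
  "real \<Rightarrow> real \<Rightarrow> real \<Rightarrow> real \<Rightarrow> real \<Rightarrow> real \<Rightarrow> real \<Rightarrow> (real \<Rightarrow> 'a \<Rightarrow> real \<times> real) \<Rightarrow>
   real \<Rightarrow> nat \<Rightarrow> nat \<Rightarrow> nat \<Rightarrow> 'a \<Rightarrow> real" where
  "DeltaP \<mu>x \<mu>y \<rho>x \<rho>y x0 y0 h0 W k N l1 l2 \<omega> =
     P \<mu>x \<mu>y \<rho>x \<rho>y x0 y0 h0 W k N l1 l2 \<omega>
     - P \<mu>x \<mu>y \<rho>x \<rho>y x0 y0 h0 W k N l1 (l2 - 1) \<omega>
     - P \<mu>x \<mu>y \<rho>x \<rho>y x0 y0 h0 W k N (l1 - 1) l2 \<omega>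
     + P \<mu>x \<mu>y \<rho>x \<rho>y x0 y0 h0 W k N (l1 - 1) (l2 - 1) \<omega>"

end

theory Submission
  imports Defs "HOL-Complex_Analysis.Cauchy_Integral_Theorem"
begin

text \<open>By Fourier inversion the solution of the scheme is an integral of plane waves against the product of the
  amplification factors of the \<open>N\<close> steps. The integrand is periodic and holomorphic near the real frequencies, so
  the contour may be moved to frequencies with a small positive imaginary part; there the quadrant sum is a convergent
  product of geometric series and the functional is an integral of the same kind with two bounded kernels.

  The stability conditions give \<open>E|p|\<^sup>2 \<le> 1 - c k |(\<xi>, \<eta>)|\<^sup>2 + O(k)\<close> for an amplification factor \<open>p\<close>
  (here \<open>k / h\<^sup>2\<close> bounded is used), hence Gaussian decay of the second moments of the modes at time \<open>T\<close>. The four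
  modes of a mixed difference, rewritten as one value, two simple differences and one mixed difference, each scaled by
  its expected order in \<open>h\<^sub>x\<^sup>2\<close> and \<open>h\<^sub>y\<^sup>2\<close>, evolve by a lower triangular random matrix with the factors \<open>p\<close> on the
  diagonal, and a Gronwall argument keeps the scaled vector bounded. Integrating over the frequencies gives the
  second moment estimate, which implies the one for the expectation.\<close>

section \<open>Difference quotients of sine and cosine at complex frequencies\<close>

text \<open>The tilt is forced by the functional: \<open>kern\<close> has a pole at frequency 0, so
  the quadrant sum cannot be taken over real frequencies, while the stability conditions speak about
  real frequencies only. A fixed height \<open>tilt\<close>, independent of k and of the meshes,
  costs O(k (1 + |xi| + |eta|)) per step, which the dissipation absorbs. Two obstacles shape the
  Gronwall argument. The coupling between the modes of different meshes is of order sqrt k per step,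
  not k, and its constant grows like a power G of the frequency. The first is met by orthogonality:
  in a basis of centred (Hermite) polynomials the cross terms of a second moment pair only parts of
  equal degree, so sqrt k always meets sqrt k. The second is met by measuring simple differences in
  units of h^2 G^2 instead of h^2: the scaled couplings then carry a factor 1/G, which cancels the G
  of the coefficients, and the one-step factor exceeds that of a single mode by O(k) uniformly in
  the frequency. The polynomial weight is paid only once, at the end, out of the Gaussian
  decay.\<close>

definition dsin :: "real \<Rightarrow> complex \<Rightarrow> complex" where
  "dsin h z = sin (z * of_real h) / of_real h"

text \<open>On a wave exp (i z x) the operators D / (2 h) and - D_xx / (2 h^2) act as multiplication
  by i \<open>dsin h z\<close> and by \<open>dcos h z\<close>; the limits for h to 0 are z and z^2 /
  2.\<close>

definition dcos :: "real \<Rightarrow> complex \<Rightarrow> complex" where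
  "dcos h z = (1 - cos (z * of_real h)) / (of_real h)\<^sup>2"

text \<open>With r = exp (i z h) this is h (1/2 + r + r^2 + ...), the trapezoidal rule for the
  integral of exp (i z x) over the half line. The half weights on the axes in the functional produce
  it, and they are what makes its dependence on h second order.\<close>

definition kern :: "real \<Rightarrow> complex \<Rightarrow> complex" where
  "kern h z = of_real (h / 2) * (1 + exp (\<i> * z * of_real h)) / (1 - exp (\<i> * z * of_real h))"

lemma sinh_le_mult_cosh: "\<bar>sinh y\<bar> \<le> \<bar>y\<bar> * cosh (y::real)"
proof -
  have "sinh y \<le> y * cosh y" if "y \<ge> 0" for y :: real
  proof -
    have "0 * cosh 0 - sinh 0 \<le> y * cosh y - sinh y"
      by (rule DERIV_nonneg_imp_nondecreasing[OF that])
         (auto intro!: derivative_eq_intros exI simp: field_simps)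
    then show ?thesis by simp
  qed
  from this[of "\<bar>y\<bar>"] show ?thesis by simp
qed

lemma cosh_minus_1_le: "cosh y - 1 \<le> y\<^sup>2 / 2 * cosh (y::real)"
proof -
  have "(sinh (y/2))\<^sup>2 \<le> (y/2)\<^sup>2 * (cosh (y/2))\<^sup>2"
    using power_mono[OF sinh_le_mult_cosh[of "y/2"], of 2] unfolding power_mult_distrib power2_abs by simp
  moreover have "cosh y = 2 * (sinh (y/2))\<^sup>2 + 1" "cosh y = 2 * (cosh (y/2))\<^sup>2 - 1"
    using cosh_double[of "y/2"] cosh_square_eq[of "y/2"] by auto
  moreover have "(cosh (y/2))\<^sup>2 \<le> cosh y" using calculation cosh_real_ge_1[of y] by linarith
  ultimately have "cosh y - 1 \<le> 2 * ((y/2)\<^sup>2 * cosh y)"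
    by (smt (verit) mult_left_mono zero_le_power2)
  then show ?thesis by (simp add: power2_eq_square)
qed

lemma cosh_minus_1_le_sinh: "cosh y - 1 \<le> \<bar>sinh (y::real)\<bar>"
proof -
  have "cosh \<bar>y\<bar> - sinh \<bar>y\<bar> \<le> 1" unfolding cosh_minus_sinh by simp
  then show ?thesis unfolding cosh_real_abs sinh_real_abs by simp 
qed

lemma cosh_real_mono: "\<bar>x\<bar> \<le> \<bar>y\<bar> \<Longrightarrow> cosh x \<le> cosh (y::real)"
proof -
  assume "\<bar>x\<bar> \<le> \<bar>y\<bar>"
  then have "cosh \<bar>x\<bar> \<le> cosh \<bar>y\<bar>"
    using cosh_real_strict_mono[of "\<bar>x\<bar>" "\<bar>y\<bar>"] by (cases "\<bar>x\<bar> = \<bar>y\<bar>") auto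
  then show ?thesis by simp
qed

lemma Re_sin_cosh: "Re (sin z) = sin (Re z) * cosh (Im z)"
  and Im_sin_sinh: "Im (sin z) = cos (Re z) * sinh (Im z)"
  and Re_cos_cosh: "Re (cos z) = cos (Re z) * cosh (Im z)"
  by (simp_all add: Re_sin Im_sin Re_cos cosh_field_def sinh_field_def)

text \<open>The half-angle formula lets every estimate for \<open>dsin\<close> at mesh h/2 carry
  over to \<open>dcos\<close> at mesh h.\<close>

lemma dcos_eq: "h \<noteq> 0 \<Longrightarrow> dcos h z = (dsin (h / 2) z)\<^sup>2 / 2"
  using cos_double_sin[of "z * of_real h / 2"]
  by (simp add: dcos_def dsin_def field_simps power2_eq_square)

text \<open>Duplication formulas turn the effect of doubling the mesh into an exact product with the
  factor h^2; no Taylor remainder is needed, here or for \<open>dcos\<close>.\<close>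

lemma dsin_coarsen: "h \<noteq> 0 \<Longrightarrow> dsin h z - dsin (2 * h) z = (of_real h)\<^sup>2 * dsin h z * dcos h z"
  using sin_double[of "z * of_real h"]
  by (simp add: dcos_def dsin_def field_simps power2_eq_square)

lemma dcos_coarsen:
  assumes "h \<noteq> 0" shows "dcos h z - dcos (2 * h) z = (of_real h)\<^sup>2 * (dcos h z)\<^sup>2 / 2"
proof -
  define c where "c = cos (z * of_real h)"
  have "cos (z * of_real (2 * h)) = 2 * c\<^sup>2 - 1"
    using cos_double_cos[of "z * of_real h"] by (simp add: c_def mult_ac)
  then show ?thesis
    unfolding dcos_def c_def[symmetric] using assms by (simp only:) (simp add: field_simps power2_eq_square)
qed

lemma norm_dsin_le:
  assumes h: "h > 0" and K: "cosh (Im z * h) \<le> K"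
  shows "norm (dsin h z) \<le> K * (\<bar>Re z\<bar> + \<bar>Im z\<bar>)"
proof -
  have "norm (sin (z * of_real h)) \<le> \<bar>Re (sin (z * of_real h))\<bar> + \<bar>Im (sin (z * of_real h))\<bar>"
    by (rule cmod_le)
  also have "\<dots> \<le> \<bar>Re z * h\<bar> * K + 1 * (\<bar>Im z * h\<bar> * K)"
    unfolding Re_sin_cosh Im_sin_sinh abs_mult
    using sinh_le_mult_cosh[of "Im z * h"] K
    by (intro add_mono mult_mono) (auto intro!: abs_sin_x_le_abs_x order_trans[OF sinh_le_mult_cosh] mult_left_mono simp flip: abs_mult)
  finally show ?thesis
    using h by (simp add: dsin_def norm_divide field_simps abs_mult)
qed

lemma norm_dcos_le:
  assumes h: "h > 0" and K: "cosh (Im z * h) \<le> K"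
  shows "norm (dcos h z) \<le> K\<^sup>2 * (\<bar>Re z\<bar> + \<bar>Im z\<bar>)\<^sup>2"
proof -
  have "cosh (Im z * (h/2)) \<le> cosh (Im z * h)" using h by (intro cosh_real_mono) (simp add: abs_mult mult_left_mono)
  then have "norm (dsin (h/2) z) \<le> K * (\<bar>Re z\<bar> + \<bar>Im z\<bar>)"
    using K h by (intro norm_dsin_le) auto
  from power_mono[OF this, of 2] show ?thesis
    using h by (simp add: dcos_eq norm_divide norm_power power_mult_distrib)
      (smt (verit) zero_le_power2 mult_nonneg_nonneg)
qed

text \<open>Leaving the real axis changes the first order symbol by an amount that does not grow
  with Re z. For \<open>dcos\<close> the factorisation a^2 - b^2 costs one power of Re z, which is
  still one less than the size of \<open>dcos\<close> itself.\<close>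

lemma norm_dsin_tilt:
  assumes h: "h > 0" and K: "cosh (Im z * h) \<le> K"
  shows "norm (dsin h z - dsin h (of_real (Re z))) \<le> 2 * K * \<bar>Im z\<bar>"
proof -
  define w where "w = sin (z * of_real h) - sin (of_real (Re z) * of_real h)"
  have sy: "\<bar>sinh (Im z * h)\<bar> \<le> \<bar>Im z * h\<bar> * K"
    using sinh_le_mult_cosh[of "Im z * h"] K by (meson abs_ge_zero mult_left_mono order_trans)
  have "norm w \<le> \<bar>Re w\<bar> + \<bar>Im w\<bar>" by (rule cmod_le)
  also have "Re w = sin (Re z * h) * (cosh (Im z * h) - 1)"
    by (simp add: w_def Re_sin_cosh algebra_simps)
  also have "Im w = cos (Re z * h) * sinh (Im z * h)"
    by (simp add: w_def Im_sin_sinh)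
  also have "\<bar>sin (Re z * h) * (cosh (Im z * h) - 1)\<bar> + \<bar>cos (Re z * h) * sinh (Im z * h)\<bar>
     \<le> 1 * (\<bar>Im z * h\<bar> * K) + 1 * (\<bar>Im z * h\<bar> * K)"
    unfolding abs_mult using sy cosh_minus_1_le_sinh[of "Im z * h"] cosh_real_ge_1[of "Im z * h"]
    by (intro add_mono mult_mono) (auto simp: abs_mult)
  finally show ?thesis
    using h by (simp add: dsin_def w_def norm_divide field_simps abs_mult flip: diff_divide_distrib)
qed

lemma norm_dcos_tilt:
  assumes h: "h > 0" and K: "cosh (Im z * h) \<le> K"
  shows "norm (dcos h z - dcos h (of_real (Re z))) \<le> 2 * K\<^sup>2 * \<bar>Im z\<bar> * (\<bar>Re z\<bar> + \<bar>Im z\<bar>)"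
proof -
  have "cosh (Im z * (h/2)) \<le> cosh (Im z * h)" using h by (intro cosh_real_mono) (simp add: abs_mult mult_left_mono)
  then have c: "cosh (Im z * (h/2)) \<le> K" using K by simp
  have K1: "K \<ge> 1" using K cosh_real_ge_1[of "Im z * h"] by linarith
  define a b where "a = dsin (h/2) z" and "b = dsin (h/2) (of_real (Re z))"
  have a: "norm a \<le> K * (\<bar>Re z\<bar> + \<bar>Im z\<bar>)" unfolding a_def using h c by (intro norm_dsin_le) auto
  have "norm b \<le> K * (\<bar>Re (of_real (Re z) :: complex)\<bar> + \<bar>Im (of_real (Re z) :: complex)\<bar>)" unfolding b_def
    using h K1 by (intro norm_dsin_le) auto
  then have b: "norm b \<le> K * (\<bar>Re z\<bar> + \<bar>Im z\<bar>)" using K1 by (simp add: distrib_left add_increasing2)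
  have "dcos h z - dcos h (of_real (Re z)) = (a - b) * (a + b) / 2"
    using h by (simp add: dcos_eq a_def b_def power2_eq_square field_simps)
  also have "norm \<dots> \<le> (2 * K * \<bar>Im z\<bar>) * (K * (\<bar>Re z\<bar> + \<bar>Im z\<bar>) + K * (\<bar>Re z\<bar> + \<bar>Im z\<bar>)) / 2"
    unfolding norm_divide norm_mult
    using norm_dsin_tilt[of "h/2" z K, folded a_def b_def] h c K1 a b norm_triangle_ineq[of a b]
    by (intro frac_le mult_mono) auto
  finally show ?thesis by (simp add: power2_eq_square algebra_simps)
qed

lemma Im_dsin_le:
  assumes h: "h > 0" and K: "cosh (Im z * h) \<le> K"
  shows "\<bar>Im (dsin h z)\<bar> \<le> K * \<bar>Im z\<bar>"
proof -
  have "\<bar>Im (sin (z * of_real h))\<bar> \<le> 1 * (\<bar>Im z * h\<bar> * K)"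
    unfolding Im_sin_sinh abs_mult using sinh_le_mult_cosh[of "Im z * h"] K
    by (intro mult_mono) (auto simp: abs_mult intro!: order_trans[OF sinh_le_mult_cosh] mult_left_mono)
  then show ?thesis using h by (simp add: dsin_def field_simps abs_mult)
qed

text \<open>Off the real axis the diffusion symbol may become negative, but only by O((Im z)^2),
  uniformly in Re z and h. This is what keeps the denominator of the scheme away from 0 on a
  strip.\<close>

lemma Re_dcos_ge:
  assumes h: "h > 0" and K: "cosh (Im z * h) \<le> K"
  shows "- (K * (Im z)\<^sup>2) \<le> Re (dcos h z)"
proof -
  have "cos (Re z * h) * cosh (Im z * h) \<le> 1 * cosh (Im z * h)" by (intro mult_right_mono) auto
  moreover have "cosh (Im z * h) - 1 \<le> (Im z * h)\<^sup>2 / 2 * K"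
    using cosh_minus_1_le[of "Im z * h"] K by (smt (verit) mult_left_mono zero_le_power2 divide_nonneg_nonneg)
  moreover have "0 \<le> (Im z * h)\<^sup>2 * K" using K cosh_real_ge_1[of "Im z * h"] by simp
  ultimately have "- ((Im z * h)\<^sup>2 * K) \<le> 1 - cos (Re z * h) * cosh (Im z * h)"
    by linarith
  then have "- (K * (Im z)\<^sup>2) * h\<^sup>2 \<le> 1 - cos (Re z * h) * cosh (Im z * h)"
    by (simp add: power_mult_distrib mult_ac)
  then have "- (K * (Im z)\<^sup>2) \<le> (1 - cos (Re z * h) * cosh (Im z * h)) / h\<^sup>2"
    using h by (simp add: pos_le_divide_eq)
  also have "\<dots> = Re (dcos h z)" by (simp add: dcos_def Re_cos_cosh flip: of_real_power)
  finally show ?thesis .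
qed

lemma dsin_of_real: "dsin h (of_real x) = of_real (sin (x * h) / h)"
  by (simp add: dsin_def flip: of_real_mult sin_of_real)

lemma dcos_of_real: "dcos h (of_real x) = of_real ((1 - cos (x * h)) / h\<^sup>2)"
  by (simp add: dcos_def flip: of_real_mult cos_of_real)

text \<open>Taylor gives x^2/2 - x^4/24, and x^2 <= 10 on [-pi, pi] leaves (1/2 - 10/24) x^2 =
  x^2/12.\<close>

lemma one_minus_cos_ge:
  assumes "\<bar>x\<bar> \<le> pi" shows "x\<^sup>2 / 12 \<le> 1 - cos (x::real)"
proof -
  have s: "y - y^3/6 \<le> sin y" if "y \<ge> 0" for y :: real
  proof -
    have 1: "1 - y\<^sup>2/2 \<le> cos y" if "y \<ge> 0" for y :: real
    proof -
      have "0\<^sup>2/2 + cos 0 \<le> y\<^sup>2/2 + cos y"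
        by (rule DERIV_nonneg_imp_nondecreasing[OF that])
           (auto intro!: derivative_eq_intros exI simp: sin_x_le_x)
      then show ?thesis by simp
    qed
    have "(\<lambda>y. sin y - y + y^3/6) 0 \<le> (\<lambda>y. sin y - y + y^3/6) y"
    proof (rule DERIV_nonneg_imp_nondecreasing[where f = "\<lambda>y. sin y - y + y^3/6", OF that])
      fix x :: real assume x: "0 \<le> x"
      have "((\<lambda>y. sin y - y + y^3/6) has_real_derivative (cos x - 1 + x\<^sup>2/2)) (at x)"
        by (auto intro!: derivative_eq_intros)
      moreover have "0 \<le> cos x - 1 + x\<^sup>2/2" using 1[OF x] by simp
      ultimately show "\<exists>z. ((\<lambda>y. sin y - y + y^3/6) has_real_derivative z) (at x) \<and> 0 \<le> z"
        by blast
    qed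
    then show ?thesis by simp
  qed
  have "(\<lambda>y. y\<^sup>2/2 - y^4/24 + cos y - 1) \<bar>x\<bar> \<le> (\<lambda>y. y\<^sup>2/2 - y^4/24 + cos y - 1) (0::real)"
  proof (rule DERIV_nonpos_imp_nonincreasing[where f = "\<lambda>y. y\<^sup>2/2 - y^4/24 + cos y - 1"])
    fix y :: real assume y: "0 \<le> y"
    have "((\<lambda>y. y\<^sup>2/2 - y^4/24 + cos y - 1) has_real_derivative (y - y^3/6 - sin y)) (at y)"
      by (auto intro!: derivative_eq_intros)
    moreover have "y - y^3/6 - sin y \<le> 0" using s[OF y] by simp
    ultimately show "\<exists>z. ((\<lambda>y. y\<^sup>2/2 - y^4/24 + cos y - 1) has_real_derivative z) (at y) \<and> z \<le> 0"
      by blast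
  qed auto
  then have 2: "1 - cos x \<ge> x\<^sup>2/2 - x^4/24" by simp
  have "x\<^sup>2 \<le> 3.15\<^sup>2"
    using assms pi_less_4 pi_approx by (intro abs_le_square_iff[THEN iffD1]) simp
  then have "x\<^sup>2 \<le> 10" by (simp add: power2_eq_square)
  then have "x\<^sup>2 * x\<^sup>2 \<le> 10 * x\<^sup>2" by (intro mult_right_mono) auto
  with 2 show ?thesis by (simp add: power4_eq_xxxx power2_eq_square)
qed

text \<open>Uniform in h because |1 - r| >= 1 - exp (- h Im z) is itself of order h and cancels the
  factor h/2. The bound degenerates as Im z tends to 0, which reflects the pole at the
  origin.\<close>

lemma norm_kern_le:
  assumes h: "0 < h" "h \<le> h0" and a: "Im z > 0"
  shows "norm (kern h z) \<le> (1 + Im z * h0) / Im z"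
proof -
  define w where "w = exp (\<i> * z * of_real h)"
  define y where "y = Im z * h"
  have y: "y > 0" "y \<le> Im z * h0" using h a by (auto simp: y_def)
  have nw: "norm w = exp (- y)" by (simp add: w_def y_def)
  have "1 + y \<le> exp y" by simp
  then have e: "exp (- y) \<le> 1 / (1 + y)" using y by (simp add: exp_minus field_simps)
  have "norm (1 + w) \<le> 2" using norm_triangle_ineq[of 1 w] nw y by (smt (verit) exp_le_one_iff norm_one)
  moreover have "y / (1 + y) \<le> norm (1 - w)"
  proof -
    have "y / (1 + y) = 1 - 1 / (1 + y)" using y by (simp add: field_simps)
    then show ?thesis using norm_triangle_ineq2[of 1 w] nw e by simp
  qed
  ultimately have "norm (kern h z) \<le> h / 2 * 2 / (y / (1 + y))"
    unfolding kern_def w_def[symmetric] norm_divide norm_mult using y h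
    by (intro frac_le mult_mono) auto
  also have "\<dots> = (1 + y) / Im z" using y h a by (simp add: y_def)
  also have "\<dots> \<le> (1 + Im z * h0) / Im z" using a y by (simp add: divide_right_mono)
  finally show ?thesis .
qed

text \<open>The difference of the two kernels collapses to - (h/2) (1 - w) / (1 + w), a tangent,
  with 1 - w = O(h). The new denominator 1 + w vanishes at z = pi/h, a pole of the coarse kernel,
  and the restriction on Re z keeps away from it.\<close>

lemma norm_kern_diff:
  assumes h: "0 < h" and a: "Im z > 0" and r: "\<bar>Re z\<bar> * (2 * h) \<le> pi" and K: "cosh (Im z * h) \<le> K"
  shows "norm (kern h z - kern (2 * h) z) \<le> h\<^sup>2 * (K * (\<bar>Re z\<bar> + \<bar>Im z\<bar>))"
proof -
  define u where "u = exp (\<i> * z * of_real (h / 2))"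
  define w where "w = exp (\<i> * z * of_real h)"
  have wu: "w = u\<^sup>2" by (simp add: w_def u_def flip: exp_double)
  have w2: "exp (\<i> * z * of_real (2 * h)) = w\<^sup>2" by (simp add: w_def mult_ac flip: exp_double)
  have nw: "norm w < 1" "norm u \<le> 1" using h a by (simp_all add: w_def u_def)
  have w1: "w \<noteq> 1" using nw by auto
  \<comment> \<open>A frequency resolved by mesh 2 h has phase at most pi/2 on mesh h, so w lies in
    the right half plane and |1 + w| >= 1.\<close>
  have "\<bar>Re z * h\<bar> \<le> pi / 2" using r h by (simp add: abs_mult)
  then have "cos (Re z * h) \<ge> 0" by (intro cos_ge_zero) (auto simp: abs_le_iff)
  then have "Re w \<ge> 0" by (simp add: w_def Re_exp mult_ac)
  then have p1: "norm (1 + w) \<ge> 1" using complex_Re_le_cmod[of "1 + w"] by simp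
  then have wm: "1 + w \<noteq> 0" by auto
  have "kern h z - kern (2 * h) z = - (of_real (h / 2) * (1 - w) / (1 + w))"
  proof -
    have d: "1 - w\<^sup>2 = (1 - w) * (1 + w)" by (simp add: power2_eq_square algebra_simps)
    have twm: "2 + w * 2 \<noteq> 0" using wm by (metis distrib_left mult.commute mult_eq_0_iff mult_2_right zero_neq_numeral add.commute mult.right_neutral)
    show ?thesis unfolding kern_def w2 w_def[symmetric] d
      using w1 wm twm by (simp add: divide_simps distrib_left[symmetric]) (simp add: algebra_simps power2_eq_square)
  qed
  moreover have "norm (1 - w) \<le> h * (K * (\<bar>Re z\<bar> + \<bar>Im z\<bar>))"
  proof -
    have un: "u * inverse u = 1" by (simp add: u_def)
    have "sin (z * of_real (h/2)) = (u - inverse u) / (2 * \<i>)"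
      by (simp add: sin_exp_eq u_def exp_minus mult_ac)
    then have "- (2 * \<i> * u * sin (z * of_real (h/2))) = - u * (u - inverse u)" by (simp add: mult.left_commute[of u \<i>])
    then have "1 - w = - (2 * \<i> * u * sin (z * of_real (h/2)))"
      using un by (simp add: wu right_diff_distrib power2_eq_square)
    also have "\<dots> = - (\<i> * u * of_real h * dsin (h/2) z)" using h by (simp add: dsin_def)
    also have "norm \<dots> \<le> 1 * 1 * h * (K * (\<bar>Re z\<bar> + \<bar>Im z\<bar>))"
    proof -
      have "cosh (Im z * (h/2)) \<le> cosh (Im z * h)" using h by (intro cosh_real_mono) (simp add: abs_mult mult_left_mono)
      then have "norm (dsin (h/2) z) \<le> K * (\<bar>Re z\<bar> + \<bar>Im z\<bar>)" using K h by (intro norm_dsin_le) auto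
      then show ?thesis unfolding norm_minus_cancel norm_mult using nw h by (intro mult_mono) auto
    qed
    finally show ?thesis by simp
  qed
  ultimately have "norm (kern h z - kern (2 * h) z) \<le> h / 2 * (h * (K * (\<bar>Re z\<bar> + \<bar>Im z\<bar>))) / 1"
    using p1 h K cosh_real_ge_1[of "Im z * h"]
    by (simp only: norm_minus_cancel norm_divide norm_mult) (intro frac_le mult_mono mult_nonneg_nonneg, auto)
  also have "\<dots> \<le> h\<^sup>2 * (K * (\<bar>Re z\<bar> + \<bar>Im z\<bar>))"
    using K cosh_real_ge_1[of "Im z * h"] h
    by (simp add: power2_eq_square)
  finally show ?thesis .
qed

section \<open>Second moments of Gaussian polynomials of degree two\<close>

text \<open>The basis 1, x, y, x^2 - 1, y^2 - 1, x y - \<rho> is centred for correlated standard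
  normals: \<open>c 0\<close> is the mean, and the parts of degree 0, 1 and 2 are mutually
  orthogonal. Only indices below 6 are read.\<close>

definition chaos :: "real \<Rightarrow> (nat \<Rightarrow> complex) \<Rightarrow> real \<times> real \<Rightarrow> complex" where
  "chaos \<rho> c z = c 0 + c 1 * of_real (fst z) + c 2 * of_real (snd z)
     + c 3 * of_real ((fst z)\<^sup>2 - 1) + c 4 * of_real ((snd z)\<^sup>2 - 1) + c 5 * of_real (fst z * snd z - \<rho>)"

text \<open>The squared L2 norm of \<open>chaos\<close>, computed after y = \<rho> u + s v with u, v
  independent and s^2 = 1 - \<rho>^2: the summands are the squared coefficients of 1, u, v, u^2 - 1,
  u v, v^2 - 1, weighted by the norms 1, 1, 1, 2, 1, 2.\<close>

definition mom2 :: "real \<Rightarrow> (nat \<Rightarrow> complex) \<Rightarrow> real" where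
  "mom2 \<rho> c = (norm (c 0))\<^sup>2 + ((norm (c 1 + of_real \<rho> * c 2))\<^sup>2 + (norm (of_real (sqrt (1 - \<rho>\<^sup>2)) * c 2))\<^sup>2)
     + (2 * (norm (c 3 + of_real (\<rho>\<^sup>2) * c 4 + of_real \<rho> * c 5))\<^sup>2
        + (norm (of_real (sqrt (1 - \<rho>\<^sup>2)) * (2 * of_real \<rho> * c 4 + c 5)))\<^sup>2
        + 2 * (norm (of_real (1 - \<rho>\<^sup>2) * c 4))\<^sup>2)"

abbreviation std_normal :: "real measure" where
  "std_normal \<equiv> density lborel std_normal_density"

lemma std_normal_square:
  fixes a b d :: real
  shows "has_bochner_integral std_normal (\<lambda>v. (a + b * v + d * (v\<^sup>2 - 1))\<^sup>2) (a\<^sup>2 + b\<^sup>2 + 2 * d\<^sup>2)"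
proof -
  have m0: "has_bochner_integral lborel (\<lambda>x. std_normal_density x * x^0) 1"
    using std_normal_moment_even[of 0] by simp
  have m1: "has_bochner_integral lborel (\<lambda>x. std_normal_density x * x^1) 0"
    using std_normal_moment_odd[of 0] by simp
  have m2: "has_bochner_integral lborel (\<lambda>x. std_normal_density x * x^2) 1"
    using std_normal_moment_even[of 1] by simp
  have m3: "has_bochner_integral lborel (\<lambda>x. std_normal_density x * x^3) 0"
    using std_normal_moment_odd[of 1] by simp
  have m4: "has_bochner_integral lborel (\<lambda>x. std_normal_density x * x^4) 3"
    using std_normal_moment_even[of 2] by (simp add: fact_numeral)
  have "has_bochner_integral lborel (\<lambda>x. (a - d)\<^sup>2 * (std_normal_density x * x^0)
      + 2 * (a - d) * b * (std_normal_density x * x^1)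
      + (b\<^sup>2 + 2 * (a - d) * d) * (std_normal_density x * x^2)
      + 2 * b * d * (std_normal_density x * x^3) + d\<^sup>2 * (std_normal_density x * x^4))
      ((a - d)\<^sup>2 * 1 + 2 * (a - d) * b * 0 + (b\<^sup>2 + 2 * (a - d) * d) * 1 + 2 * b * d * 0 + d\<^sup>2 * 3)"
    by (intro has_bochner_integral_add has_bochner_integral_mult_right m0 m1 m2 m3 m4)
  also have "(\<lambda>x. (a - d)\<^sup>2 * (std_normal_density x * x^0)
      + 2 * (a - d) * b * (std_normal_density x * x^1)
      + (b\<^sup>2 + 2 * (a - d) * d) * (std_normal_density x * x^2)
      + 2 * b * d * (std_normal_density x * x^3) + d\<^sup>2 * (std_normal_density x * x^4))
     = (\<lambda>x. std_normal_density x *\<^sub>R (a + b * x + d * (x\<^sup>2 - 1))\<^sup>2)"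
    by (simp add: algebra_simps power2_eq_square power3_eq_cube power4_eq_xxxx fun_eq_iff)
  finally show ?thesis
    by (subst has_bochner_integral_density) (auto simp: algebra_simps power2_eq_square)
qed

lemma nn_integral_std_normal_square:
  fixes a b d :: complex
  shows "(\<integral>\<^sup>+v. ennreal ((norm (a + b * of_real v + d * of_real (v\<^sup>2 - 1)))\<^sup>2) \<partial>std_normal)
    = ennreal ((norm a)\<^sup>2 + (norm b)\<^sup>2 + 2 * (norm d)\<^sup>2)"
proof -
  have "has_bochner_integral std_normal
     (\<lambda>v. (Re a + Re b * v + Re d * (v\<^sup>2 - 1))\<^sup>2 + (Im a + Im b * v + Im d * (v\<^sup>2 - 1))\<^sup>2)
     (((Re a)\<^sup>2 + (Re b)\<^sup>2 + 2 * (Re d)\<^sup>2) + ((Im a)\<^sup>2 + (Im b)\<^sup>2 + 2 * (Im d)\<^sup>2))"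
    by (intro has_bochner_integral_add std_normal_square)
  then have "has_bochner_integral std_normal
     (\<lambda>v. (norm (a + b * of_real v + d * of_real (v\<^sup>2 - 1)))\<^sup>2)
     ((norm a)\<^sup>2 + (norm b)\<^sup>2 + 2 * (norm d)\<^sup>2)"
    by (simp add: cmod_power2 algebra_simps)
  then show ?thesis
    by (subst nn_integral_eq_integral) (auto simp: has_bochner_integral_iff)
qed

text \<open>In independent coordinates the polynomial is A(u) + B(u) v + D (v^2 - 1). Integrating v
  leaves |A|^2 + |B|^2 + 2 |D|^2, where A and B are again of the one-dimensional form, so the same
  formula integrates u.\<close>

lemma nn_integral_chaos:
  assumes "\<bar>\<rho>\<bar> \<le> 1"
  shows "(\<integral>\<^sup>+z. ennreal ((norm (chaos \<rho> c z))\<^sup>2) \<partial>std_binormal \<rho>) = ennreal (mom2 \<rho> c)"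
proof -
  define s where "s = sqrt (1 - \<rho>\<^sup>2)"
  have s2: "s\<^sup>2 = 1 - \<rho>\<^sup>2" using assms by (simp add: s_def abs_square_le_1)
  define A where "A u = c 0 + (c 1 + of_real \<rho> * c 2) * of_real u
      + (c 3 + of_real (\<rho>\<^sup>2) * c 4 + of_real \<rho> * c 5) * of_real (u\<^sup>2 - 1)" for u
  define B where "B u = of_real s * c 2 + of_real s * (2 * of_real \<rho> * c 4 + c 5) * of_real u + 0 * of_real (u\<^sup>2 - 1)" for u
  define D where "D = of_real (s\<^sup>2) * c 4"
  interpret std_normal: prob_space std_normal by (rule prob_space_normal_density) simp
  have sets: "sets std_normal = sets borel" by simp
  have [measurable]: "(\<lambda>x. (norm (chaos \<rho> c x))\<^sup>2) \<in> borel_measurable borel"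
    unfolding chaos_def
    by (intro borel_measurable_continuous_onI continuous_intros)
  have [measurable]: "(\<lambda>(u, v). (u, \<rho> * u + sqrt (1 - \<rho>\<^sup>2) * v)) \<in> std_normal \<Otimes>\<^sub>M std_normal \<rightarrow>\<^sub>M borel"
    unfolding borel_prod[symmetric] by measurable
  have ch: "chaos \<rho> c (u, \<rho> * u + s * v) = A u + B u * of_real v + D * of_real (v\<^sup>2 - 1)" for u v
  proof -
    have "(\<rho> * u + s * v)\<^sup>2 - 1 = \<rho>\<^sup>2 * (u\<^sup>2 - 1) + 2 * \<rho> * s * u * v + s\<^sup>2 * (v\<^sup>2 - 1)"
      using s2 by (simp add: algebra_simps power2_eq_square)
    moreover have "u * (\<rho> * u + s * v) - \<rho> = \<rho> * (u\<^sup>2 - 1) + s * u * v"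
      by (simp add: algebra_simps power2_eq_square)
    ultimately show ?thesis
      unfolding chaos_def A_def B_def D_def fst_conv snd_conv
      by (simp only: of_real_add of_real_mult) (simp add: algebra_simps)
  qed
  have "(\<integral>\<^sup>+z. ennreal ((norm (chaos \<rho> c z))\<^sup>2) \<partial>std_binormal \<rho>)
      = (\<integral>\<^sup>+z. ennreal ((norm (A (fst z) + B (fst z) * of_real (snd z) + D * of_real ((snd z)\<^sup>2 - 1)))\<^sup>2) \<partial>(std_normal \<Otimes>\<^sub>M std_normal))"
    unfolding std_binormal_def
    by (subst nn_integral_distr) (auto simp: case_prod_beta' ch[unfolded s_def] )
  also have "\<dots> = (\<integral>\<^sup>+u. \<integral>\<^sup>+v. ennreal ((norm (A u + B u * of_real v + D * of_real (v\<^sup>2 - 1)))\<^sup>2) \<partial>std_normal \<partial>std_normal)"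
    unfolding A_def B_def by (subst std_normal.nn_integral_fst[symmetric]) simp_all
  also have "\<dots> = (\<integral>\<^sup>+u. ennreal ((norm (A u))\<^sup>2) + ennreal ((norm (B u))\<^sup>2) + ennreal (2 * (norm D)\<^sup>2) \<partial>std_normal)"
    unfolding nn_integral_std_normal_square by (simp add: ennreal_plus)
  also have "\<dots> = (\<integral>\<^sup>+u. ennreal ((norm (A u))\<^sup>2) \<partial>std_normal) + (\<integral>\<^sup>+u. ennreal ((norm (B u))\<^sup>2) \<partial>std_normal) + ennreal (2 * (norm D)\<^sup>2)"
    unfolding A_def B_def by (subst nn_integral_add, simp_all)+ (simp add: std_normal.emeasure_space_1[simplified])
  also have "\<dots> = ennreal (mom2 \<rho> c)"
    unfolding A_def B_def nn_integral_std_normal_square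
    by (subst ennreal_plus[symmetric], simp, simp)+ (simp add: mom2_def D_def s2 flip: s_def)
  finally show ?thesis .
qed

text \<open>Coefficients are grouped by degree because in one time step those of degree one are of
  order sqrt k and those of degree two of order k.\<close>

definition level1 :: "(nat \<Rightarrow> complex) \<Rightarrow> real" where
  "level1 c = norm (c 1) + norm (c 2)"

definition level2 :: "(nat \<Rightarrow> complex) \<Rightarrow> real" where
  "level2 c = norm (c 3) + norm (c 4) + norm (c 5)"

lemma level_nonneg [simp]: "0 \<le> level1 c" "0 \<le> level2 c"
  by (simp_all add: level1_def level2_def)

lemma norm_add_square_le:
  fixes a b :: complex
  assumes "norm a \<le> u" "norm b \<le> v"
  shows "(norm (a + b))\<^sup>2 \<le> (norm a)\<^sup>2 + 2 * u * v + v\<^sup>2"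
proof -
  have "(norm (a + b))\<^sup>2 \<le> (norm a + norm b)\<^sup>2" by (intro power_mono norm_triangle_ineq) auto
  also have "\<dots> = (norm a)\<^sup>2 + 2 * (norm a * norm b) + (norm b)\<^sup>2" by (simp add: power2_eq_square algebra_simps)
  also have "\<dots> \<le> (norm a)\<^sup>2 + 2 * (u * v) + v\<^sup>2"
    using assms by (intro add_mono mult_left_mono mult_mono power_mono) (auto intro: order_trans[OF norm_ge_zero])
  finally show ?thesis by simp
qed

text \<open>By orthogonality there are no cross terms between different degrees. In particular the
  mean, which is of order 1, never multiplies a degree-one perturbation of order sqrt k. The
  constants 16 and 8 collect the weights 2, 1, 2 of the three quadratic forms, bounded by
  \<open>level2\<close>, 2 \<open>level2\<close> and \<open>level2\<close>.\<close>

lemma mom2_add_le: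
  assumes r: "\<bar>\<rho>\<bar> \<le> 1"
  shows "mom2 \<rho> (\<lambda>i. c i + d i) \<le> mom2 \<rho> c
    + (2 * norm (c 0) * norm (d 0) + (norm (d 0))\<^sup>2)
    + (4 * level1 c * level1 d + 2 * (level1 d)\<^sup>2)
    + (16 * level2 c * level2 d + 8 * (level2 d)\<^sup>2)"
proof -
  define s where "s = sqrt (1 - \<rho>\<^sup>2)"
  have r2: "\<rho>\<^sup>2 \<le> 1" using r by (simp add: abs_square_le_1)
  have s: "0 \<le> s" "s \<le> 1" using r2 by (auto simp: s_def)
  have F: "norm (e 1 + of_real \<rho> * e 2) \<le> level1 e" "norm (of_real s * e 2) \<le> level1 e"
    "norm (e 3 + of_real (\<rho>\<^sup>2) * e 4 + of_real \<rho> * e 5) \<le> level2 e"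
    "norm (of_real s * (2 * of_real \<rho> * e 4 + e 5)) \<le> 2 * level2 e"
    "norm (of_real (1 - \<rho>\<^sup>2) * e 4) \<le> level2 e" for e :: "nat \<Rightarrow> complex"
  proof -
    have b: "norm (of_real x * y) \<le> norm y" if "\<bar>x\<bar> \<le> 1" for x and y :: complex
      using that by (simp add: norm_mult mult_left_le_one_le)
    have r2': "\<bar>\<rho>\<^sup>2\<bar> \<le> 1" "\<bar>1 - \<rho>\<^sup>2\<bar> \<le> 1" "\<bar>s\<bar> \<le> 1" using r2 s by auto
    show "norm (e 1 + of_real \<rho> * e 2) \<le> level1 e"
      using norm_triangle_ineq[of "e 1" "of_real \<rho> * e 2"] b[OF r, of "e 2"] by (simp add: level1_def)
    show "norm (of_real s * e 2) \<le> level1 e"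
      using b[OF r2'(3), of "e 2"] by (simp add: level1_def add_increasing)
    show "norm (e 3 + of_real (\<rho>\<^sup>2) * e 4 + of_real \<rho> * e 5) \<le> level2 e"
      unfolding level2_def
      by (intro norm_triangle_le add_mono b r r2' order_refl)
    have "norm (of_real s * (2 * of_real \<rho> * e 4 + e 5)) \<le> norm (2 * of_real \<rho> * e 4 + e 5)"
      by (rule b[OF r2'(3)])
    also have "\<dots> \<le> norm (2 * of_real \<rho> * e 4) + norm (e 5)" by (rule norm_triangle_ineq)
    also have "\<dots> \<le> 2 * norm (e 4) + norm (e 5)"
      using b[OF r, of "e 4"] by (simp add: norm_mult)
    also have "\<dots> \<le> 2 * level2 e" unfolding level2_def using norm_ge_zero[of "e 3"] norm_ge_zero[of "e 5"]
      by (simp del: norm_ge_zero)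
    finally show "norm (of_real s * (2 * of_real \<rho> * e 4 + e 5)) \<le> 2 * level2 e" .
    show "norm (of_real (1 - \<rho>\<^sup>2) * e 4) \<le> level2 e"
      using b[OF r2'(2), of "e 4"] by (simp only: level2_def) (smt (verit) norm_ge_zero)
  qed
  have 0: "(norm (c 0 + d 0))\<^sup>2 \<le> (norm (c 0))\<^sup>2 + 2 * norm (c 0) * norm (d 0) + (norm (d 0))\<^sup>2"
    by (rule norm_add_square_le) auto
  note N = norm_add_square_le[OF F(1)[of c] F(1)[of d]] norm_add_square_le[OF F(2)[of c] F(2)[of d]]
    norm_add_square_le[OF F(3)[of c] F(3)[of d]] norm_add_square_le[OF F(4)[of c] F(4)[of d]]
    norm_add_square_le[OF F(5)[of c] F(5)[of d]]
  have "mom2 \<rho> (\<lambda>i. c i + d i) = (norm (c 0 + d 0))\<^sup>2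
     + ((norm (c 1 + of_real \<rho> * c 2 + (d 1 + of_real \<rho> * d 2)))\<^sup>2 + (norm (of_real s * c 2 + of_real s * d 2))\<^sup>2)
     + (2 * (norm (c 3 + of_real (\<rho>\<^sup>2) * c 4 + of_real \<rho> * c 5 + (d 3 + of_real (\<rho>\<^sup>2) * d 4 + of_real \<rho> * d 5)))\<^sup>2
        + (norm (of_real s * (2 * of_real \<rho> * c 4 + c 5) + of_real s * (2 * of_real \<rho> * d 4 + d 5)))\<^sup>2
        + 2 * (norm (of_real (1 - \<rho>\<^sup>2) * c 4 + of_real (1 - \<rho>\<^sup>2) * d 4))\<^sup>2)"
    unfolding mom2_def s_def[symmetric] by (simp only: distrib_left) (simp only: ac_simps)
  also have "\<dots> \<le> (norm (c 0))\<^sup>2 + 2 * norm (c 0) * norm (d 0) + (norm (d 0))\<^sup>2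
     + (((norm (c 1 + of_real \<rho> * c 2))\<^sup>2 + 2 * level1 c * level1 d + (level1 d)\<^sup>2)
        + ((norm (of_real s * c 2))\<^sup>2 + 2 * level1 c * level1 d + (level1 d)\<^sup>2))
     + (2 * ((norm (c 3 + of_real (\<rho>\<^sup>2) * c 4 + of_real \<rho> * c 5))\<^sup>2 + 2 * level2 c * level2 d + (level2 d)\<^sup>2)
        + ((norm (of_real s * (2 * of_real \<rho> * c 4 + c 5)))\<^sup>2 + 2 * (2 * level2 c) * (2 * level2 d) + (2 * level2 d)\<^sup>2)
        + 2 * ((norm (of_real (1 - \<rho>\<^sup>2) * c 4))\<^sup>2 + 2 * level2 c * level2 d + (level2 d)\<^sup>2))"
    by (intro add_mono 0 N mult_left_mono) auto
  also have "\<dots> = mom2 \<rho> c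
    + (2 * norm (c 0) * norm (d 0) + (norm (d 0))\<^sup>2)
    + (4 * level1 c * level1 d + 2 * (level1 d)\<^sup>2)
    + (16 * level2 c * level2 d + 8 * (level2 d)\<^sup>2)"
    unfolding mom2_def s_def[symmetric] by (simp add: algebra_simps power2_eq_square)
  finally show ?thesis .
qed

lemma mom2_scale: "mom2 \<rho> (\<lambda>i. y * c i) = (norm y)\<^sup>2 * mom2 \<rho> c"
proof -
  have *: "y * c 1 + of_real \<rho> * (y * c 2) = y * (c 1 + of_real \<rho> * c 2)"
    "of_real (sqrt (1 - \<rho>\<^sup>2)) * (y * c 2) = y * (of_real (sqrt (1 - \<rho>\<^sup>2)) * c 2)"
    "y * c 3 + of_real (\<rho>\<^sup>2) * (y * c 4) + of_real \<rho> * (y * c 5) = y * (c 3 + of_real (\<rho>\<^sup>2) * c 4 + of_real \<rho> * c 5)"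
    "of_real (sqrt (1 - \<rho>\<^sup>2)) * (2 * of_real \<rho> * (y * c 4) + y * c 5) = y * (of_real (sqrt (1 - \<rho>\<^sup>2)) * (2 * of_real \<rho> * c 4 + c 5))"
    "of_real (1 - \<rho>\<^sup>2) * (y * c 4) = y * (of_real (1 - \<rho>\<^sup>2) * c 4)"
    by (simp_all add: algebra_simps)
  show ?thesis unfolding mom2_def * norm_mult[of y] power_mult_distrib by (simp add: algebra_simps)
qed

lemma mom2_nonneg: "0 \<le> mom2 \<rho> c"
  by (simp add: mom2_def)

text \<open>The Milstein numerator 1 - i a x - i b y - a^2/2 (x^2 - 1) - b^2/2 (y^2 - 1) - a b x y
  in the centred basis; writing x y as (x y - \<rho>) + \<rho> moves - \<rho> a b into the mean. The
  arguments a and b are sqrt (\<rho>x k) and sqrt (\<rho>y k) times the symbols of the first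
  differences.\<close>

definition ncoef :: "real \<Rightarrow> complex \<Rightarrow> complex \<Rightarrow> nat \<Rightarrow> complex" where
  "ncoef \<rho> a b i = [1 - of_real \<rho> * a * b, - \<i> * a, - \<i> * b, - (a\<^sup>2 / 2), - (b\<^sup>2 / 2), - (a * b)] ! i"

lemma chaos_ncoef:
  "chaos \<rho> (ncoef \<rho> a b) (x, y) = 1 - \<i> * a * of_real x - \<i> * b * of_real y
     - a\<^sup>2 / 2 * (of_real (x\<^sup>2 - 1)) - b\<^sup>2 / 2 * (of_real (y\<^sup>2 - 1)) - a * b * of_real (x * y)"
  by (simp add: chaos_def ncoef_def algebra_simps)

lemma mom2_ncoef_real:
  fixes a b \<rho> :: real
  assumes "\<bar>\<rho>\<bar> \<le> 1"
  shows "mom2 \<rho> (ncoef \<rho> (of_real a) (of_real b)) =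
    1 + (a\<^sup>2 + b\<^sup>2) + (a\<^sup>2 + b\<^sup>2)\<^sup>2 / 2 + 2 * (a\<^sup>2 + b\<^sup>2) * (\<rho> * a * b) + 3 * \<rho>\<^sup>2 * a\<^sup>2 * b\<^sup>2"
proof -
  define s where "s = sqrt (1 - \<rho>\<^sup>2)"
  have s2: "s * s = 1 - \<rho>\<^sup>2" using assms by (simp add: s_def abs_square_le_1)
  have c: "ncoef \<rho> (of_real a) (of_real b) 0 = of_real (1 - \<rho> * a * b)"
    "ncoef \<rho> (of_real a) (of_real b) 1 + of_real \<rho> * ncoef \<rho> (of_real a) (of_real b) 2 = - \<i> * of_real (a + \<rho> * b)"
    "of_real s * ncoef \<rho> (of_real a) (of_real b) 2 = - \<i> * of_real (s * b)"
    "ncoef \<rho> (of_real a) (of_real b) 3 + of_real (\<rho>\<^sup>2) * ncoef \<rho> (of_real a) (of_real b) 4 + of_real \<rho> * ncoef \<rho> (of_real a) (of_real b) 5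
      = of_real (- (a\<^sup>2 / 2 + \<rho>\<^sup>2 * b\<^sup>2 / 2 + \<rho> * a * b))"
    "of_real s * (2 * of_real \<rho> * ncoef \<rho> (of_real a) (of_real b) 4 + ncoef \<rho> (of_real a) (of_real b) 5)
      = of_real (- (s * (\<rho> * b\<^sup>2 + a * b)))"
    "of_real (1 - \<rho>\<^sup>2) * ncoef \<rho> (of_real a) (of_real b) 4 = of_real (- ((1 - \<rho>\<^sup>2) * (b\<^sup>2 / 2)))"
    by (simp_all add: ncoef_def algebra_simps)
  have n: "(norm (of_real x :: complex))\<^sup>2 = x\<^sup>2" "(norm (- \<i> * of_real x))\<^sup>2 = x\<^sup>2" for x
    by (simp_all add: norm_mult)
  have "mom2 \<rho> (ncoef \<rho> (of_real a) (of_real b)) = (1 - \<rho> * a * b)\<^sup>2 + ((a + \<rho> * b)\<^sup>2 + (s * s) * b\<^sup>2)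
     + (2 * (a\<^sup>2 / 2 + \<rho>\<^sup>2 * b\<^sup>2 / 2 + \<rho> * a * b)\<^sup>2 + (s * s) * (\<rho> * b\<^sup>2 + a * b)\<^sup>2 + 2 * ((1 - \<rho>\<^sup>2) * (b\<^sup>2 / 2))\<^sup>2)"
    unfolding mom2_def s_def[symmetric] c n by (simp only: power2_minus) (simp add: power_mult_distrib power2_eq_square)
  also have "\<dots> = 1 + (a\<^sup>2 + b\<^sup>2) + (a\<^sup>2 + b\<^sup>2)\<^sup>2 / 2 + 2 * (a\<^sup>2 + b\<^sup>2) * (\<rho> * a * b) + 3 * \<rho>\<^sup>2 * a\<^sup>2 * b\<^sup>2"
    unfolding s2 by (simp add: field_simps power2_eq_square)
  finally show ?thesis .
qed

text \<open>This is the only place where the three smallness conditions on the correlations enter.\<close>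

lemma mom2_ncoef_real_le:
  fixes a b \<rho> :: real
  assumes "\<bar>\<rho>\<bar> \<le> 1" "0 \<le> \<rho>x" "0 \<le> \<rho>y"
    and 1: "2 * \<rho>x\<^sup>2 * (1 + 2 * \<bar>\<rho>\<bar>) \<le> 1"
    and 2: "2 * \<rho>y\<^sup>2 * (1 + 2 * \<bar>\<rho>\<bar>) \<le> 1"
    and 3: "2 * \<rho>x * \<rho>y * (3 * \<rho>\<^sup>2 + 2 * \<bar>\<rho>\<bar> + 1) \<le> 1"
    and A: "0 \<le> A" "a\<^sup>2 \<le> 2 * \<rho>x * A" and B: "0 \<le> B" "b\<^sup>2 \<le> 2 * \<rho>y * B"
  shows "mom2 \<rho> (ncoef \<rho> (of_real a) (of_real b)) \<le> 1 + 2 * (\<rho>x * A + \<rho>y * B) + (A + B)\<^sup>2"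
proof -
  \<comment> \<open>The mixed term of odd degree in a and in b is split so that only a^4, b^4 and
    a^2 b^2 remain, one for each stability condition.\<close>
  have ab: "\<bar>a * b\<bar> * a\<^sup>2 \<le> (a\<^sup>2 * a\<^sup>2 + a\<^sup>2 * b\<^sup>2) / 2" "\<bar>a * b\<bar> * b\<^sup>2 \<le> (b\<^sup>2 * b\<^sup>2 + a\<^sup>2 * b\<^sup>2) / 2"
  proof -
    have "0 \<le> (\<bar>a\<bar> - \<bar>b\<bar>)\<^sup>2" by simp
    then have "\<bar>a * b\<bar> \<le> (a\<^sup>2 + b\<^sup>2) / 2" by (simp add: power2_eq_square algebra_simps abs_mult)
    from mult_right_mono[OF this, of "a\<^sup>2"] mult_right_mono[OF this, of "b\<^sup>2"]
    show "\<bar>a * b\<bar> * a\<^sup>2 \<le> (a\<^sup>2 * a\<^sup>2 + a\<^sup>2 * b\<^sup>2) / 2" "\<bar>a * b\<bar> * b\<^sup>2 \<le> (b\<^sup>2 * b\<^sup>2 + a\<^sup>2 * b\<^sup>2) / 2"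
      by (auto simp: algebra_simps)
  qed
  have "2 * (a\<^sup>2 + b\<^sup>2) * (\<rho> * a * b) \<le> 2 * (a\<^sup>2 + b\<^sup>2) * (\<bar>\<rho>\<bar> * \<bar>a * b\<bar>)"
    by (intro mult_left_mono) (auto simp: abs_mult[symmetric] mult.assoc intro: abs_ge_self)
  also have "\<dots> = 2 * \<bar>\<rho>\<bar> * (\<bar>a * b\<bar> * a\<^sup>2 + \<bar>a * b\<bar> * b\<^sup>2)" by (simp add: algebra_simps)
  also have "\<dots> \<le> 2 * \<bar>\<rho>\<bar> * ((a\<^sup>2 * a\<^sup>2 + a\<^sup>2 * b\<^sup>2) / 2 + (b\<^sup>2 * b\<^sup>2 + a\<^sup>2 * b\<^sup>2) / 2)"
    by (intro mult_left_mono add_mono ab) auto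
  also have "\<dots> = \<bar>\<rho>\<bar> * (a\<^sup>2 * a\<^sup>2 + 2 * (a\<^sup>2 * b\<^sup>2) + b\<^sup>2 * b\<^sup>2)"
    by (simp add: field_simps)
  finally have "2 * (a\<^sup>2 + b\<^sup>2) * (\<rho> * a * b) \<le> \<bar>\<rho>\<bar> * (a\<^sup>2 * a\<^sup>2 + 2 * (a\<^sup>2 * b\<^sup>2) + b\<^sup>2 * b\<^sup>2)" .
  then have "mom2 \<rho> (ncoef \<rho> (of_real a) (of_real b)) \<le> 1 + (a\<^sup>2 + b\<^sup>2)
     + (a\<^sup>2 * a\<^sup>2) * ((1 + 2 * \<bar>\<rho>\<bar>) / 2) + (b\<^sup>2 * b\<^sup>2) * ((1 + 2 * \<bar>\<rho>\<bar>) / 2)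
     + (a\<^sup>2 * b\<^sup>2) * (3 * \<rho>\<^sup>2 + 2 * \<bar>\<rho>\<bar> + 1)" (is "_ \<le> ?R")
  proof -
    assume *: "2 * (a\<^sup>2 + b\<^sup>2) * (\<rho> * a * b) \<le> \<bar>\<rho>\<bar> * (a\<^sup>2 * a\<^sup>2 + 2 * (a\<^sup>2 * b\<^sup>2) + b\<^sup>2 * b\<^sup>2)"
    have "mom2 \<rho> (ncoef \<rho> (of_real a) (of_real b)) \<le> 1 + (a\<^sup>2 + b\<^sup>2) + (a\<^sup>2 + b\<^sup>2)\<^sup>2 / 2
      + \<bar>\<rho>\<bar> * (a\<^sup>2 * a\<^sup>2 + 2 * (a\<^sup>2 * b\<^sup>2) + b\<^sup>2 * b\<^sup>2) + 3 * \<rho>\<^sup>2 * a\<^sup>2 * b\<^sup>2"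
      unfolding mom2_ncoef_real[OF assms(1)] using * by simp
    also have "\<dots> = ?R" by (simp add: field_simps power2_eq_square)
    finally show ?thesis .
  qed
  also have "\<dots> \<le> 1 + (2 * \<rho>x * A + 2 * \<rho>y * B)
     + ((2 * \<rho>x * A) * (2 * \<rho>x * A)) * ((1 + 2 * \<bar>\<rho>\<bar>) / 2) + ((2 * \<rho>y * B) * (2 * \<rho>y * B)) * ((1 + 2 * \<bar>\<rho>\<bar>) / 2)
     + ((2 * \<rho>x * A) * (2 * \<rho>y * B)) * (3 * \<rho>\<^sup>2 + 2 * \<bar>\<rho>\<bar> + 1)"
    using assms by (intro add_mono mult_right_mono mult_mono) auto
  also have "\<dots> = 1 + 2 * (\<rho>x * A + \<rho>y * B) + (A * A) * (2 * \<rho>x\<^sup>2 * (1 + 2 * \<bar>\<rho>\<bar>))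
     + (B * B) * (2 * \<rho>y\<^sup>2 * (1 + 2 * \<bar>\<rho>\<bar>)) + 2 * (A * B) * (2 * \<rho>x * \<rho>y * (3 * \<rho>\<^sup>2 + 2 * \<bar>\<rho>\<bar> + 1))"
    by (simp add: field_simps power2_eq_square)
  \<comment> \<open>The three conditions are exactly what bounds the quartic part by (A + B)^2, the
    quadratic part of (1 + A + B)^2, which is the size of the squared denominator.\<close>
  also have "\<dots> \<le> 1 + 2 * (\<rho>x * A + \<rho>y * B) + (A * A) * 1 + (B * B) * 1 + 2 * (A * B) * 1"
    using A B by (intro add_mono mult_left_mono 1 2 3 order_refl) auto
  finally show ?thesis by (simp add: power2_eq_square algebra_simps)
qed

text \<open>Used with s = sqrt k and t = 1 + |xi| + |eta|. The tilt moves a and b by O(s), while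
  they are themselves O(s t), so every change of a product is O(s^2 t) = O(k t); the bound on s t
  absorbs the remaining powers.\<close>

lemma mom2_ncoef_tilt:
  assumes r: "\<bar>\<rho>\<bar> \<le> 1" and K: "1 \<le> K" and t: "1 \<le> t" and s: "0 \<le> s" and st: "s\<^sup>2 * t\<^sup>2 \<le> B"
    and a: "norm a \<le> s * K * t" "norm a' \<le> s * K * t" "norm (a - a') \<le> 2 * K * s"
    and b: "norm b \<le> s * K * t" "norm b' \<le> s * K * t" "norm (b - b') \<le> 2 * K * s"
  shows "mom2 \<rho> (ncoef \<rho> a b) \<le> mom2 \<rho> (ncoef \<rho> a' b')
      + (8 * K\<^sup>2 * (1 + K\<^sup>2 * B) + 64 * K\<^sup>2 + 784 * K^4 * B) * (s\<^sup>2 * t)"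
proof -
  define c where "c = ncoef \<rho> a' b'"
  define d where "d i = ncoef \<rho> a b i - c i" for i
  have prod: "norm (x * y - x' * y') \<le> 4 * K\<^sup>2 * (s\<^sup>2 * t)"
    if "norm y \<le> s * K * t" "norm x' \<le> s * K * t" "norm (x - x') \<le> 2 * K * s" "norm (y - y') \<le> 2 * K * s" for x y x' y' :: complex
  proof -
    have "x * y - x' * y' = (x - x') * y + x' * (y - y')" by (simp add: algebra_simps)
    also have "norm \<dots> \<le> 2 * K * s * (s * K * t) + s * K * t * (2 * K * s)"
      using that K t s by (intro norm_triangle_le add_mono) (auto simp: norm_mult intro!: mult_mono)
    finally show ?thesis by (simp add: power2_eq_square algebra_simps)
  qed
  have pb: "norm (x * y) \<le> K\<^sup>2 * B" if "norm x \<le> s * K * t" "norm y \<le> s * K * t" for x y :: complex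
  proof -
    have "norm (x * y) \<le> (s * K * t) * (s * K * t)" using that K t s by (auto simp: norm_mult intro!: mult_mono)
    also have "\<dots> = K\<^sup>2 * (s\<^sup>2 * t\<^sup>2)" by (simp add: power2_eq_square algebra_simps)
    also have "\<dots> \<le> K\<^sup>2 * B" using st by (intro mult_left_mono) auto
    finally show ?thesis .
  qed
  define S where "S = s\<^sup>2 * t"
  have S: "0 \<le> S" "s\<^sup>2 \<le> S" "s * (s * t) = S" using s t by (auto simp: S_def power2_eq_square mult_le_cancel_left1)
  \<comment> \<open>A square of the perturbation is reduced to its first power by one use of s^2 t^2
    <= B; all terms thereby become multiples of S.\<close>
  have "S * S = s\<^sup>2 * t\<^sup>2 * s\<^sup>2" by (simp add: S_def power2_eq_square mult_ac)
  also have "\<dots> \<le> B * S" using st S(2) by (intro mult_mono) (auto intro: order_trans[rotated])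
  finally have SS: "S * S \<le> B * S" .
  have B: "0 \<le> B" using st s t by (meson order_trans mult_nonneg_nonneg zero_le_power2)
  have n0: "norm (c 0) \<le> 1 + K\<^sup>2 * B"
  proof -
    have "norm (of_real \<rho> * (a' * b')) \<le> 1 * (K\<^sup>2 * B)"
      unfolding norm_mult[of "of_real \<rho>"] using r pb[OF a(2) b(2)] by (intro mult_mono) auto
    then show ?thesis using norm_triangle_ineq4[of 1 "of_real \<rho> * (a' * b')"]
      by (simp add: c_def ncoef_def mult.assoc)
  qed
  have n1: "level1 c \<le> 2 * K * (s * t)" using a b by (simp add: level1_def c_def ncoef_def norm_mult algebra_simps)
  have n2: "level2 c \<le> 2 * K\<^sup>2 * B"
    using pb[OF a(2) a(2)] pb[OF a(2) b(2)] pb[OF b(2) b(2)]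
    by (simp add: level2_def c_def ncoef_def power2_eq_square norm_divide)
  have d0: "norm (d 0) \<le> 4 * K\<^sup>2 * S"
  proof -
    have "d 0 = of_real (- \<rho>) * (a * b - a' * b')" by (simp add: d_def c_def ncoef_def algebra_simps)
    also have "norm \<dots> \<le> 1 * (4 * K\<^sup>2 * S)"
      unfolding norm_mult S_def using r prod[OF b(1) a(2,3) b(3)] by (intro mult_mono) auto
    finally show ?thesis by simp
  qed
  have d1: "level1 d \<le> 4 * K * s"
  proof -
    have "d 1 = - \<i> * (a - a')" "d 2 = - \<i> * (b - b')" by (simp_all add: d_def c_def ncoef_def algebra_simps)
    then show ?thesis using a b by (simp add: level1_def norm_mult)
  qed
  have d2: "level2 d \<le> 8 * K\<^sup>2 * S"
  proof -
    have "d 3 = - ((a * a - a' * a') / 2)" "d 4 = - ((b * b - b' * b') / 2)" "d 5 = - (a * b - a' * b')"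
      by (simp_all add: d_def c_def ncoef_def power2_eq_square diff_divide_distrib)
    then show ?thesis
      using prod[OF a(1) a(2,3) a(3)] prod[OF b(1) a(2,3) b(3)] prod[OF b(1) b(2,3) b(3)]
      by (simp only: level2_def norm_minus_cancel norm_divide S_def) simp
  qed
  have "mom2 \<rho> (ncoef \<rho> a b) = mom2 \<rho> (\<lambda>i. c i + d i)" by (simp add: d_def)
  also have "\<dots> \<le> mom2 \<rho> c
    + (2 * norm (c 0) * norm (d 0) + (norm (d 0))\<^sup>2)
    + (4 * level1 c * level1 d + 2 * (level1 d)\<^sup>2)
    + (16 * level2 c * level2 d + 8 * (level2 d)\<^sup>2)"
    by (rule mom2_add_le[OF r])
  also have "\<dots> \<le> mom2 \<rho> c
    + (2 * (1 + K\<^sup>2 * B) * (4 * K\<^sup>2 * S) + (4 * K\<^sup>2 * S)\<^sup>2)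
    + (4 * (2 * K * (s * t)) * (4 * K * s) + 2 * (4 * K * s)\<^sup>2)
    + (16 * (2 * K\<^sup>2 * B) * (8 * K\<^sup>2 * S) + 8 * (8 * K\<^sup>2 * S)\<^sup>2)"
    using n0 n1 n2 d0 d1 d2 K s t B S
    by (intro add_mono mult_mono power_mono mult_left_mono order_refl) auto
  also have "\<dots> = mom2 \<rho> c + 8 * K\<^sup>2 * (1 + K\<^sup>2 * B) * S + 528 * K^4 * (S * S) + 32 * K\<^sup>2 * S
     + 32 * K\<^sup>2 * s\<^sup>2 + 256 * K^4 * (B * S)"
    unfolding S(3)[symmetric] by (simp add: power2_eq_square power4_eq_xxxx algebra_simps)
  also have "\<dots> \<le> mom2 \<rho> c + 8 * K\<^sup>2 * (1 + K\<^sup>2 * B) * S + 528 * K^4 * (B * S) + 32 * K\<^sup>2 * S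
     + 32 * K\<^sup>2 * S + 256 * K^4 * (B * S)"
    using S SS by (intro add_mono mult_left_mono order_refl) auto
  finally show ?thesis unfolding c_def S_def[symmetric] by (simp add: algebra_simps)
qed

section \<open>The amplification factor\<close>

locale milstein_spde =
  fixes T \<mu>x \<mu>y \<rho>x \<rho>y \<rho> h0 Lam :: real
  assumes T: "T > 0"
    and rx: "0 \<le> \<rho>x" "\<rho>x < 1" and ry: "0 \<le> \<rho>y" "\<rho>y < 1"
    and rho: "\<bar>\<rho>\<bar> \<le> 1"
    and stab: "2 * \<rho>x\<^sup>2 * (1 + 2 * \<bar>\<rho>\<bar>) \<le> 1" "2 * \<rho>y\<^sup>2 * (1 + 2 * \<bar>\<rho>\<bar>) \<le> 1"
      "2 * \<rho>x * \<rho>y * (3 * \<rho>\<^sup>2 + 2 * \<bar>\<rho>\<bar> + 1) \<le> 1"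
    and h0: "h0 > 0" and Lam: "Lam > 0"
begin

definition K :: real where "K = cosh h0"

text \<open>Chosen so that the possibly negative real part of the symbol, times any k <= T, stays
  above -1/2. The minimum with 1 lets squares of imaginary parts be bounded by the first
  power.\<close>

definition tilt :: real where
  "tilt = min 1 (1 / (2 * T * K * (\<bar>\<mu>x\<bar> + \<bar>\<mu>y\<bar> + 2)))"

definition symD :: "real \<Rightarrow> real \<Rightarrow> complex \<Rightarrow> complex \<Rightarrow> complex" where
  "symD hx hy z w = \<i> * of_real \<mu>x * dsin hx z + \<i> * of_real \<mu>y * dsin hy w + dcos hx z + dcos hy w"

definition den :: "real \<Rightarrow> real \<Rightarrow> real \<Rightarrow> complex \<Rightarrow> complex \<Rightarrow> complex" where
  "den k hx hy z w = 1 + of_real k * symD hx hy z w"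

definition num :: "real \<Rightarrow> real \<Rightarrow> real \<Rightarrow> complex \<Rightarrow> complex \<Rightarrow> nat \<Rightarrow> complex" where
  "num k hx hy z w = ncoef \<rho> (of_real (sqrt (\<rho>x * k)) * dsin hx z) (of_real (sqrt (\<rho>y * k)) * dsin hy w)"

definition pcoef :: "real \<Rightarrow> real \<Rightarrow> real \<Rightarrow> complex \<Rightarrow> complex \<Rightarrow> nat \<Rightarrow> complex" where
  "pcoef k hx hy z w i = inverse (den k hx hy z w) * num k hx hy z w i"

lemma K1: "K \<ge> 1" unfolding K_def by (rule cosh_real_ge_1)

lemma tilt_pos: "tilt > 0" and tilt_le1: "tilt \<le> 1"
proof -
  have "0 < 2 * T * K * (\<bar>\<mu>x\<bar> + \<bar>\<mu>y\<bar> + 2)" using T K1 by (intro mult_pos_pos) auto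
  then show "tilt > 0" "tilt \<le> 1" by (auto simp: tilt_def)
qed

lemma cosh_le_K:
  assumes "0 < h" "h \<le> h0" "\<bar>a\<bar> \<le> 1" shows "cosh (a * h) \<le> K"
proof -
  have "\<bar>a * h\<bar> \<le> 1 * h0" unfolding abs_mult using assms by (intro mult_mono) auto
  then show ?thesis unfolding K_def using h0 by (intro cosh_real_mono) auto
qed

text \<open>On the strip the drift terms contribute at most |mu| K tilt each, and the diffusion
  terms lose at most K (Im)^2 <= K tilt each; the definition of \<open>tilt\<close> makes the sum
  harmless even for the largest admissible k.\<close>

lemma Re_den_ge:
  assumes h: "0 < hx" "hx \<le> h0" "0 < hy" "hy \<le> h0" and k: "0 \<le> k" "k \<le> T"
    and z: "\<bar>Im z\<bar> \<le> tilt" and w: "\<bar>Im w\<bar> \<le> tilt"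
  shows "1/2 \<le> Re (den k hx hy z w)"
proof -
  have c: "cosh (Im z * hx) \<le> K" "cosh (Im w * hy) \<le> K"
    using h z w tilt_le1 by (auto intro!: cosh_le_K)
  have sq: "(Im v)\<^sup>2 \<le> tilt" if "\<bar>Im v\<bar> \<le> tilt" for v
  proof -
    have "\<bar>Im v\<bar> * \<bar>Im v\<bar> \<le> tilt * 1" using that tilt_le1 tilt_pos by (intro mult_mono) auto
    then show ?thesis by (simp add: power2_eq_square)
  qed
  have mu: "\<mu> * Im (dsin h v) \<le> \<bar>\<mu>\<bar> * (K * tilt)" if "0 < h" "cosh (Im v * h) \<le> K" "\<bar>Im v\<bar> \<le> tilt" for \<mu> h v
  proof -
    have "\<mu> * Im (dsin h v) \<le> \<bar>\<mu>\<bar> * \<bar>Im (dsin h v)\<bar>" by (metis abs_ge_self abs_mult)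
    also have "\<dots> \<le> \<bar>\<mu>\<bar> * (K * tilt)"
      using Im_dsin_le[OF that(1,2)] that(3) K1 by (intro mult_left_mono) (auto intro: order_trans mult_left_mono)
    finally show ?thesis .
  qed
  have dc: "- (K * tilt) \<le> Re (dcos h v)" if "0 < h" "cosh (Im v * h) \<le> K" "\<bar>Im v\<bar> \<le> tilt" for h v
    using Re_dcos_ge[OF that(1,2)] mult_left_mono[OF sq[OF that(3)], of K] K1 by linarith
  have "- (K * tilt * (\<bar>\<mu>x\<bar> + \<bar>\<mu>y\<bar> + 2)) \<le> Re (symD hx hy z w)"
    using mu[OF h(1) c(1) z, of \<mu>x] mu[OF h(3) c(2) w, of \<mu>y] dc[OF h(1) c(1) z] dc[OF h(3) c(2) w]
    by (simp add: symD_def algebra_simps)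
  then have "k * - (K * tilt * (\<bar>\<mu>x\<bar> + \<bar>\<mu>y\<bar> + 2)) \<le> k * Re (symD hx hy z w)"
    using k by (intro mult_left_mono)
  moreover have "k * (K * tilt * (\<bar>\<mu>x\<bar> + \<bar>\<mu>y\<bar> + 2)) \<le> T * (K * tilt * (\<bar>\<mu>x\<bar> + \<bar>\<mu>y\<bar> + 2))"
    using k K1 tilt_pos by (intro mult_right_mono mult_nonneg_nonneg) auto
  moreover have "T * (K * tilt * (\<bar>\<mu>x\<bar> + \<bar>\<mu>y\<bar> + 2)) \<le> 1/2"
  proof -
    define X where "X = 2 * T * K * (\<bar>\<mu>x\<bar> + \<bar>\<mu>y\<bar> + 2)"
    have X: "0 < X" unfolding X_def using T K1 by (intro mult_pos_pos) auto
    have "X * tilt \<le> X * (1 / X)" unfolding tilt_def X_def[symmetric] using X by (intro mult_left_mono) auto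
    then have "X * tilt \<le> 1" using X by simp
    then show ?thesis by (simp add: X_def algebra_simps)
  qed
  ultimately show ?thesis by (simp add: den_def)
qed

lemma den_nonzero:
  assumes "0 < hx" "hx \<le> h0" "0 < hy" "hy \<le> h0" "0 \<le> k" "k \<le> T" "\<bar>Im z\<bar> \<le> tilt" "\<bar>Im w\<bar> \<le> tilt"
  shows "den k hx hy z w \<noteq> 0" "norm (inverse (den k hx hy z w)) \<le> 2"
proof -
  have "1/2 \<le> norm (den k hx hy z w)" using Re_den_ge[OF assms] complex_Re_le_cmod order_trans by blast
  then show "den k hx hy z w \<noteq> 0" "norm (inverse (den k hx hy z w)) \<le> 2"
    by (auto simp: norm_inverse inverse_eq_divide norm_divide divide_le_eq)
qed

definition admissible :: "real \<Rightarrow> real \<Rightarrow> real \<Rightarrow> complex \<Rightarrow> complex \<Rightarrow> bool" where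
  "admissible k hx hy z w \<longleftrightarrow> 0 < hx \<and> hx \<le> h0 \<and> 0 < hy \<and> hy \<le> h0 \<and> 0 < k \<and> k \<le> T
     \<and> k \<le> Lam * hx\<^sup>2 \<and> k \<le> Lam * hy\<^sup>2 \<and> \<bar>Re z\<bar> * hx \<le> pi \<and> \<bar>Re w\<bar> * hy \<le> pi
     \<and> \<bar>Im z\<bar> \<le> tilt \<and> \<bar>Im w\<bar> \<le> tilt"

text \<open>At real frequencies the second moment is at most \<open>1 - c k |(\<xi>, \<eta>)|\<^sup>2\<close>; the tilt only perturbs this by \<open>O(k (1 + |\<xi>| + |\<eta>|))\<close>.\<close>

lemma mom2_pcoef_le_aux:
  obtains c M where "0 < c" "0 \<le> M"
    "\<And>k hx hy z w. admissible k hx hy z w \<Longrightarrow>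
       mom2 \<rho> (pcoef k hx hy z w) \<le> 1 - c * (k * ((Re z)\<^sup>2 + (Re w)\<^sup>2)) + M * (k * (1 + \<bar>Re z\<bar> + \<bar>Re w\<bar>))"
proof -
  \<comment> \<open>A bound for k t^2 on the frequency box: k <= Lam h^2 and |xi| h <= pi give k
    xi^2 <= Lam pi^2, and (1 + x + y)^2 <= 3 (1 + x^2 + y^2).\<close>
  define B where "B = 3 * (T + 2 * Lam * pi\<^sup>2)"
  define m where "m = \<bar>\<mu>x\<bar> + \<bar>\<mu>y\<bar> + 2"
  define r where "r = max \<rho>x \<rho>y"
  define M1 where "M1 = 8 * K\<^sup>2 * (1 + K\<^sup>2 * B) + 64 * K\<^sup>2 + 784 * K^4 * B"
  define M3 where "M3 = 2 * (1 + T + m * K\<^sup>2 * B) * (2 * m * K\<^sup>2)"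
  \<comment> \<open>An upper bound for the squared denominator. It keeps the dissipation gained in
    the numerator from being divided away, and it rests on B, hence on the boundedness of k /
    h^2.\<close>
  define M4 where "M4 = (1 + m * K\<^sup>2 * B)\<^sup>2"
  have B: "0 \<le> B" using T Lam by (simp add: B_def)
  have m: "2 \<le> m" by (simp add: m_def)
  have r: "0 \<le> r" "r < 1" "\<rho>x \<le> r" "\<rho>y \<le> r" using rx ry by (auto simp: r_def)
  have M1: "0 \<le> M1" and M3: "0 \<le> M3" using B m K1 T by (auto simp: M1_def M3_def)
  have M4: "1 \<le> M4" using B m by (simp add: M4_def)
  show ?thesis
  proof (rule that[of "(1 - r) / (6 * M4)" "4 * (M1 + M3)"])
    show "0 < (1 - r) / (6 * M4)" "0 \<le> 4 * (M1 + M3)" using r M4 M1 M3 by auto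
    fix k hx hy z w
    assume "admissible k hx hy z w"
    then have h: "0 < hx" "hx \<le> h0" "0 < hy" "hy \<le> h0" and k: "0 < k" "k \<le> T" "k \<le> Lam * hx\<^sup>2" "k \<le> Lam * hy\<^sup>2"
      and bz: "\<bar>Re z\<bar> * hx \<le> pi" and bw: "\<bar>Re w\<bar> * hy \<le> pi" and z: "\<bar>Im z\<bar> \<le> tilt" and w: "\<bar>Im w\<bar> \<le> tilt"
      by (simp_all add: admissible_def)
    define t where "t = 1 + \<bar>Re z\<bar> + \<bar>Re w\<bar>"
    have t: "1 \<le> t" "\<bar>Re z\<bar> + \<bar>Im z\<bar> \<le> t" "\<bar>Re w\<bar> + \<bar>Im w\<bar> \<le> t" "\<bar>Re z\<bar> \<le> t" "\<bar>Re w\<bar> \<le> t" "t \<le> t\<^sup>2"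
      using z w tilt_le1 by (auto simp: t_def power2_eq_square mult_le_cancel_left1)
    have kq: "k * x\<^sup>2 \<le> Lam * pi\<^sup>2" if "0 < h" "k \<le> Lam * h\<^sup>2" "\<bar>x\<bar> * h \<le> pi" for x h
    proof -
      have "k * x\<^sup>2 \<le> Lam * h\<^sup>2 * x\<^sup>2" using that by (intro mult_right_mono) auto
      also have "\<dots> = Lam * (\<bar>x\<bar> * h)\<^sup>2" by (simp add: power_mult_distrib)
      also have "\<dots> \<le> Lam * pi\<^sup>2" using that Lam by (intro mult_left_mono power_mono) auto
      finally show ?thesis .
    qed
    have kt: "k * t\<^sup>2 \<le> B"
    proof -
      have "t\<^sup>2 \<le> 3 * (1 + (Re z)\<^sup>2 + (Re w)\<^sup>2)"
        using sum_squares_bound[of 1 "\<bar>Re z\<bar>"] sum_squares_bound[of 1 "\<bar>Re w\<bar>"] sum_squares_bound[of "\<bar>Re z\<bar>" "\<bar>Re w\<bar>"]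
        by (simp add: t_def power2_eq_square algebra_simps)
      then have "k * t\<^sup>2 \<le> k * (3 * (1 + (Re z)\<^sup>2 + (Re w)\<^sup>2))" using k by (intro mult_left_mono) auto
      also have "\<dots> = 3 * (k + k * (Re z)\<^sup>2 + k * (Re w)\<^sup>2)" by (simp add: algebra_simps)
      also have "\<dots> \<le> B" unfolding B_def using kq[OF h(1) k(3) bz] kq[OF h(3) k(4) bw] k by simp
      finally show ?thesis .
    qed
    have cK: "cosh (Im z * hx) \<le> K" "cosh (Im w * hy) \<le> K" using h z w tilt_le1 by (auto intro!: cosh_le_K)
    have c0: "cosh (Im (complex_of_real x) * h) \<le> K" for x h using K1 by simp
    let ?zr = "complex_of_real (Re z)" and ?wr = "complex_of_real (Re w)"
    have Sz: "norm (dsin hx z) \<le> K * t" "norm (dsin hx ?zr) \<le> K * t" "norm (dsin hx z - dsin hx ?zr) \<le> 2 * K"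
      using norm_dsin_le[OF h(1) cK(1)] norm_dsin_le[OF h(1) c0, of "Re z"] norm_dsin_tilt[OF h(1) cK(1)] z tilt_le1 t K1
      by (auto intro: order_trans mult_left_mono simp: mult_left_le)
    have Sw: "norm (dsin hy w) \<le> K * t" "norm (dsin hy ?wr) \<le> K * t" "norm (dsin hy w - dsin hy ?wr) \<le> 2 * K"
      using norm_dsin_le[OF h(3) cK(2)] norm_dsin_le[OF h(3) c0, of "Re w"] norm_dsin_tilt[OF h(3) cK(2)] w tilt_le1 t K1
      by (auto intro: order_trans mult_left_mono simp: mult_left_le)
    have dC: "norm (dcos h v) \<le> K\<^sup>2 * t\<^sup>2 \<and> norm (dcos h (of_real (Re v))) \<le> K\<^sup>2 * t\<^sup>2 \<and> norm (dcos h v - dcos h (of_real (Re v))) \<le> 2 * K\<^sup>2 * t"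
      if "0 < h" "cosh (Im v * h) \<le> K" "\<bar>Im v\<bar> \<le> tilt" "\<bar>Re v\<bar> + \<bar>Im v\<bar> \<le> t" "\<bar>Re v\<bar> \<le> t" for h v
    proof (intro conjI)
      have "norm (dcos h v) \<le> K\<^sup>2 * (\<bar>Re v\<bar> + \<bar>Im v\<bar>)\<^sup>2" by (rule norm_dcos_le[OF that(1,2)])
      also have "\<dots> \<le> K\<^sup>2 * t\<^sup>2" using that by (intro mult_left_mono power_mono) auto
      finally show "norm (dcos h v) \<le> K\<^sup>2 * t\<^sup>2" .
      have "norm (dcos h (of_real (Re v))) \<le> K\<^sup>2 * (\<bar>Re v\<bar> + \<bar>0\<bar>)\<^sup>2" using norm_dcos_le[OF that(1) c0, of "Re v"] by simp
      also have "\<dots> \<le> K\<^sup>2 * t\<^sup>2" using that by (intro mult_left_mono power_mono) auto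
      finally show "norm (dcos h (of_real (Re v))) \<le> K\<^sup>2 * t\<^sup>2" .
      have "norm (dcos h v - dcos h (of_real (Re v))) \<le> 2 * K\<^sup>2 * \<bar>Im v\<bar> * (\<bar>Re v\<bar> + \<bar>Im v\<bar>)"
        by (rule norm_dcos_tilt[OF that(1,2)])
      also have "\<dots> \<le> 2 * K\<^sup>2 * 1 * t" using that tilt_le1 by (intro mult_mono) auto
      finally show "norm (dcos h v - dcos h (of_real (Re v))) \<le> 2 * K\<^sup>2 * t" by simp
    qed
    note Cz = dC[OF h(1) cK(1) z t(2,4)] and Cw = dC[OF h(3) cK(2) w t(3,5)]
    have KK: "K \<le> K\<^sup>2" using K1 by (simp add: power2_eq_square mult_le_cancel_left1)
    define d where "d = den k hx hy z w"
    define dr where "dr = den k hx hy ?zr ?wr"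
    have n4: "norm (\<i> * of_real \<mu>x * a + \<i> * of_real \<mu>y * b + c + e) \<le> \<bar>\<mu>x\<bar> * u + \<bar>\<mu>y\<bar> * u + u + u"
      if "norm a \<le> u" "norm b \<le> u" "norm c \<le> u" "norm e \<le> u" for a b c e u
      by (intro norm_triangle_le add_mono that) (auto simp: norm_mult intro!: mult_left_mono that)
    have symb: "norm (symD hx hy z w) \<le> m * (K\<^sup>2 * t\<^sup>2)" "norm (symD hx hy ?zr ?wr) \<le> m * (K\<^sup>2 * t\<^sup>2)"
    proof -
      have "K * t \<le> K\<^sup>2 * t\<^sup>2" using KK t K1 by (intro mult_mono) auto
      then show "norm (symD hx hy z w) \<le> m * (K\<^sup>2 * t\<^sup>2)" "norm (symD hx hy ?zr ?wr) \<le> m * (K\<^sup>2 * t\<^sup>2)"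
        using n4[of "dsin hx z" "K\<^sup>2 * t\<^sup>2" "dsin hy w" "dcos hx z" "dcos hy w"]
          n4[of "dsin hx ?zr" "K\<^sup>2 * t\<^sup>2" "dsin hy ?wr" "dcos hx ?zr" "dcos hy ?wr"] Sz Sw Cz Cw
        by (auto simp: symD_def m_def algebra_simps)
    qed
    have syd: "norm (symD hx hy z w - symD hx hy ?zr ?wr) \<le> m * (2 * K\<^sup>2 * t)"
    proof -
      have "2 * K \<le> 2 * K\<^sup>2 * t" using mult_mono[OF KK t(1)] K1 by simp
      then have "norm (\<i> * of_real \<mu>x * (dsin hx z - dsin hx ?zr) + \<i> * of_real \<mu>y * (dsin hy w - dsin hy ?wr)
         + (dcos hx z - dcos hx ?zr) + (dcos hy w - dcos hy ?wr)) \<le> m * (2 * K\<^sup>2 * t)"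
        using n4[of "dsin hx z - dsin hx ?zr" "2 * K\<^sup>2 * t" "dsin hy w - dsin hy ?wr" "dcos hx z - dcos hx ?zr" "dcos hy w - dcos hy ?wr"]
          Sz Sw Cz Cw by (auto simp: m_def algebra_simps)
      then show ?thesis by (simp add: symD_def algebra_simps)
    qed
    have kB: "k * (m * (K\<^sup>2 * t\<^sup>2)) \<le> m * K\<^sup>2 * B"
      using mult_left_mono[OF kt, of "m * K\<^sup>2"] m by (simp add: algebra_simps)
    have nd: "norm d \<le> 1 + m * K\<^sup>2 * B" "norm dr \<le> 1 + m * K\<^sup>2 * B"
    proof -
      have "norm (1 + of_real k * x) \<le> 1 + m * K\<^sup>2 * B" if "norm x \<le> m * (K\<^sup>2 * t\<^sup>2)" for x :: complex
      proof -
        have "norm (of_real k * x) = k * norm x" using k by (simp add: norm_mult)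
        also have "\<dots> \<le> k * (m * (K\<^sup>2 * t\<^sup>2))" using that k by (intro mult_left_mono) auto
        finally show ?thesis using norm_triangle_ineq[of 1 "of_real k * x"] kB by simp
      qed
      then show "norm d \<le> 1 + m * K\<^sup>2 * B" "norm dr \<le> 1 + m * K\<^sup>2 * B"
        using symb by (simp_all add: d_def dr_def den_def)
    qed
    have ndiff: "norm dr - norm d \<le> k * (m * (2 * K\<^sup>2 * t))"
    proof -
      have "norm dr - norm d \<le> norm (d - dr)" by (metis norm_minus_commute norm_triangle_ineq2)
      also have "d - dr = of_real k * (symD hx hy z w - symD hx hy ?zr ?wr)" by (simp add: d_def dr_def den_def algebra_simps)
      also have "norm \<dots> \<le> k * (m * (2 * K\<^sup>2 * t))" using syd k by (simp add: norm_mult)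
      finally show ?thesis .
    qed
    define Ax Ay where "Ax = k * ((1 - cos (Re z * hx)) / hx\<^sup>2)" and "Ay = k * ((1 - cos (Re w * hy)) / hy\<^sup>2)"
    have Ap: "0 \<le> Ax" "0 \<le> Ay" using k by (auto simp: Ax_def Ay_def)
    have Alow: "k * x\<^sup>2 / 12 \<le> k * ((1 - cos (x * h)) / h\<^sup>2)" if "0 < h" "\<bar>x\<bar> * h \<le> pi" for x h
    proof -
      have "(x * h)\<^sup>2 / 12 \<le> 1 - cos (x * h)" using that by (intro one_minus_cos_ge) (simp add: abs_mult)
      then have "x\<^sup>2 / 12 \<le> (1 - cos (x * h)) / h\<^sup>2" using that by (simp add: field_simps)
      then have "k * (x\<^sup>2 / 12) \<le> k * ((1 - cos (x * h)) / h\<^sup>2)" using k by (intro mult_left_mono) auto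
      then show ?thesis by simp
    qed
    \<comment> \<open>At real frequencies the drift terms of the symbol are purely imaginary, so the
      real part of the denominator is exactly 1 + Ax + Ay.\<close>
    have drn: "1 + Ax + Ay \<le> norm dr"
    proof -
      have "Re dr = 1 + Ax + Ay" by (simp add: dr_def den_def symD_def dsin_of_real dcos_of_real Ax_def Ay_def algebra_simps)
      then show ?thesis using complex_Re_le_cmod[of dr] by simp
    qed
    have dlow: "(1 + Ax + Ay)\<^sup>2 \<le> (norm d)\<^sup>2 + M3 * (k * t)"
    proof -
      have "(1 + Ax + Ay)\<^sup>2 \<le> (norm dr)\<^sup>2" using drn Ap by (intro power_mono) auto
      also have "\<dots> = (norm d)\<^sup>2 + (norm dr - norm d) * (norm dr + norm d)" by (simp add: power2_eq_square algebra_simps)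
      also have "\<dots> \<le> (norm d)\<^sup>2 + k * (m * (2 * K\<^sup>2 * t)) * ((1 + m * K\<^sup>2 * B) + (1 + m * K\<^sup>2 * B))"
        using k m t by (intro add_left_mono mult_mono ndiff add_mono nd) auto
      also have "\<dots> = (norm d)\<^sup>2 + 2 * (1 + m * K\<^sup>2 * B) * (2 * m * K\<^sup>2) * (k * t)" by (simp add: algebra_simps)
      also have "\<dots> \<le> (norm d)\<^sup>2 + M3 * (k * t)"
        unfolding M3_def using T m k t B by (intro add_left_mono mult_right_mono mult_mono) auto
      finally show ?thesis .
    qed
    define a ar b br where "a = of_real (sqrt (\<rho>x * k)) * dsin hx z" and "ar = sqrt (\<rho>x * k) * (sin (Re z * hx) / hx)"
      and "b = of_real (sqrt (\<rho>y * k)) * dsin hy w" and "br = sqrt (\<rho>y * k) * (sin (Re w * hy) / hy)"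
    have sq: "sqrt (x * k) \<le> sqrt k" if "x < 1" for x using that k by (simp add: mult_left_le)
    have sqn: "norm (complex_of_real (sqrt (x * k)) * v) \<le> sqrt k * u" if "0 \<le> x" "x < 1" "norm v \<le> u" for x v u
      unfolding norm_mult using that sq[OF that(2)] k by (intro mult_mono) auto
    have ar: "of_real ar = of_real (sqrt (\<rho>x * k)) * dsin hx ?zr" and br: "of_real br = of_real (sqrt (\<rho>y * k)) * dsin hy ?wr"
      by (simp_all add: ar_def br_def dsin_of_real)
    have "mom2 \<rho> (ncoef \<rho> a b) \<le> mom2 \<rho> (ncoef \<rho> (of_real ar) (of_real br)) + M1 * ((sqrt k)\<^sup>2 * t)"
      unfolding M1_def
    proof (rule mom2_ncoef_tilt[OF rho K1 t(1)])
      show "norm a \<le> sqrt k * K * t" "norm b \<le> sqrt k * K * t"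
        "norm (complex_of_real ar) \<le> sqrt k * K * t" "norm (complex_of_real br) \<le> sqrt k * K * t"
        unfolding a_def b_def ar br mult.assoc using Sz Sw rx ry by (auto intro!: sqn)
      have "a - of_real ar = of_real (sqrt (\<rho>x * k)) * (dsin hx z - dsin hx ?zr)"
        "b - of_real br = of_real (sqrt (\<rho>y * k)) * (dsin hy w - dsin hy ?wr)"
        unfolding a_def b_def ar br by (simp_all add: algebra_simps)
      then show "norm (a - of_real ar) \<le> 2 * K * sqrt k" "norm (b - of_real br) \<le> 2 * K * sqrt k"
        using sqn[OF rx Sz(3)] sqn[OF ry Sw(3)] by (simp_all add: mult_ac)
      show "(sqrt k)\<^sup>2 * t\<^sup>2 \<le> B" using kt k by simp
    qed (use k in auto)
    also have "mom2 \<rho> (ncoef \<rho> (of_real ar) (of_real br)) \<le> 1 + 2 * (\<rho>x * Ax + \<rho>y * Ay) + (Ax + Ay)\<^sup>2"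
    proof (rule mom2_ncoef_real_le[OF rho rx(1) ry(1) stab])
      \<comment> \<open>From sin^2 = (1 + cos) (1 - cos) <= 2 (1 - cos): the squared noise amplitude
        is controlled by the diffusion term of the implicit part, in the form the stability estimate
        expects.\<close>
      have sinsq: "(sqrt (x * k) * (sin y / h))\<^sup>2 \<le> 2 * x * (k * ((1 - cos y) / h\<^sup>2))" if "0 \<le> x" "0 < h" for x y h :: real
      proof -
        have "(sin y)\<^sup>2 = (1 + cos y) * (1 - cos y)" by (simp add: sin_squared_eq algebra_simps power2_eq_square)
        also have "\<dots> \<le> 2 * (1 - cos y)" by (intro mult_right_mono) (use cos_le_one[of y] in auto)
        finally have "x * k * ((sin y)\<^sup>2 / h\<^sup>2) \<le> x * k * (2 * (1 - cos y) / h\<^sup>2)"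
          using that k by (intro mult_left_mono divide_right_mono) auto
        also have "x * k * (2 * (1 - cos y) / h\<^sup>2) = 2 * x * (k * ((1 - cos y) / h\<^sup>2))" by (simp add: algebra_simps)
        finally show ?thesis using that k by (simp add: power_mult_distrib power_divide)
      qed
      show "ar\<^sup>2 \<le> 2 * \<rho>x * Ax" "br\<^sup>2 \<le> 2 * \<rho>y * Ay"
        unfolding ar_def br_def Ax_def Ay_def using sinsq rx ry h by auto
    qed (use Ap in auto)
    also have "1 + 2 * (\<rho>x * Ax + \<rho>y * Ay) + (Ax + Ay)\<^sup>2 \<le> 1 + 2 * (r * Ax + r * Ay) + (Ax + Ay)\<^sup>2"
      using r Ap by (intro add_mono mult_left_mono mult_right_mono order_refl) auto
    \<comment> \<open>The strict inequality r < 1 leaves a term linear in Ax + Ay over after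
      comparison with the squared denominator. This is the whole dissipation, of order k |(xi,
      eta)|^2.\<close>
    also have "\<dots> = (1 + Ax + Ay)\<^sup>2 - 2 * (1 - r) * (Ax + Ay)" by (simp add: power2_eq_square algebra_simps)
    also have "(1 + Ax + Ay)\<^sup>2 \<le> (norm d)\<^sup>2 + M3 * (k * t)" by (rule dlow)
    finally have main: "mom2 \<rho> (ncoef \<rho> a b) \<le> (norm d)\<^sup>2 - 2 * (1 - r) * (Ax + Ay) + (M1 + M3) * (k * t)"
      using k by (simp add: algebra_simps)
    have dne: "d \<noteq> 0" "norm (inverse d) \<le> 2" unfolding d_def using den_nonzero[OF h _ k(2) z w] k by auto
    have inv4: "(norm (inverse d))\<^sup>2 \<le> 4" using power_mono[OF dne(2), of 2] by simp
    have d4: "(norm d)\<^sup>2 \<le> M4" unfolding M4_def using nd by (intro power_mono) auto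
    have invM: "1 / M4 \<le> (norm (inverse d))\<^sup>2"
    proof -
      have "(norm (inverse d))\<^sup>2 = 1 / (norm d)\<^sup>2" by (simp add: inverse_eq_divide norm_divide power_divide)
      then show ?thesis using d4 dne by (simp add: frac_le)
    qed
    have "mom2 \<rho> (pcoef k hx hy z w) = (norm (inverse d))\<^sup>2 * mom2 \<rho> (ncoef \<rho> a b)"
      unfolding mom2_scale[symmetric] pcoef_def[abs_def] num_def a_def b_def d_def ..
    also have "\<dots> \<le> (norm (inverse d))\<^sup>2 * ((norm d)\<^sup>2 - 2 * (1 - r) * (Ax + Ay) + (M1 + M3) * (k * t))"
      using main by (intro mult_left_mono) auto
    also have "\<dots> = 1 - (norm (inverse d))\<^sup>2 * (2 * (1 - r) * (Ax + Ay)) + (norm (inverse d))\<^sup>2 * ((M1 + M3) * (k * t))"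
      using dne by (simp add: norm_inverse algebra_simps power_inverse)
    also have "\<dots> \<le> 1 - 1 / M4 * (2 * (1 - r) * (k * (Re z)\<^sup>2 / 12 + k * (Re w)\<^sup>2 / 12)) + 4 * ((M1 + M3) * (k * t))"
      using invM inv4 Alow[OF h(1) bz] Alow[OF h(3) bw] r k t M1 M3 M4 Ap
      by (intro add_mono diff_mono mult_mono mult_right_mono) (auto simp: Ax_def Ay_def)
    also have "\<dots> = 1 - (1 - r) / (6 * M4) * (k * ((Re z)\<^sup>2 + (Re w)\<^sup>2)) + 4 * (M1 + M3) * (k * (1 + \<bar>Re z\<bar> + \<bar>Re w\<bar>))"
      using M4 by (simp add: t_def field_simps)
    finally show "mom2 \<rho> (pcoef k hx hy z w) \<le> 1 - (1 - r) / (6 * M4) * (k * ((Re z)\<^sup>2 + (Re w)\<^sup>2)) + 4 * (M1 + M3) * (k * (1 + \<bar>Re z\<bar> + \<bar>Re w\<bar>))" .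
  qed
qed

text \<open>Young's inequality absorbs the linear growth caused by the tilt into half of the
  quadratic decay, at the price of a larger constant.\<close>

lemma mom2_pcoef_le:
  obtains c M where "0 < c" "0 \<le> M"
    "\<And>k hx hy z w. admissible k hx hy z w \<Longrightarrow>
       mom2 \<rho> (pcoef k hx hy z w) \<le> 1 + k * (M - c * ((Re z)\<^sup>2 + (Re w)\<^sup>2))"
proof -
  obtain c M where c: "0 < c" and M: "0 \<le> M" and
    *: "\<And>k hx hy z w. admissible k hx hy z w \<Longrightarrow>
       mom2 \<rho> (pcoef k hx hy z w) \<le> 1 - c * (k * ((Re z)\<^sup>2 + (Re w)\<^sup>2)) + M * (k * (1 + \<bar>Re z\<bar> + \<bar>Re w\<bar>))"
    using mom2_pcoef_le_aux by blast
  have amgm: "M * \<bar>x\<bar> \<le> c / 2 * x\<^sup>2 + M\<^sup>2 / (2 * c)" for x :: real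
  proof -
    have "0 \<le> (c * \<bar>x\<bar> - M)\<^sup>2 / (2 * c)" using c by simp
    then show ?thesis using c by (simp add: power2_eq_square field_simps)
  qed
  show ?thesis
  proof (rule that[of "c / 2" "M + M\<^sup>2 / c"])
    show "0 < c / 2" "0 \<le> M + M\<^sup>2 / c" using c M by auto
    fix k hx hy z w
    assume A: "admissible k hx hy z w"
    then have k: "0 < k" by (simp add: admissible_def)
    have "mom2 \<rho> (pcoef k hx hy z w) \<le> 1 - c * (k * ((Re z)\<^sup>2 + (Re w)\<^sup>2)) + M * (k * (1 + \<bar>Re z\<bar> + \<bar>Re w\<bar>))"
      by (rule *[OF A])
    also have "\<dots> = 1 + k * (M + M * \<bar>Re z\<bar> + M * \<bar>Re w\<bar> - c * ((Re z)\<^sup>2 + (Re w)\<^sup>2))" by (simp add: algebra_simps)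
    also have "\<dots> \<le> 1 + k * (M + (c / 2 * (Re z)\<^sup>2 + M\<^sup>2 / (2 * c)) + (c / 2 * (Re w)\<^sup>2 + M\<^sup>2 / (2 * c)) - c * ((Re z)\<^sup>2 + (Re w)\<^sup>2))"
      using k by (intro add_mono mult_left_mono diff_mono amgm order_refl) auto
    also have "\<dots> = 1 + k * (M + M\<^sup>2 / c - c / 2 * ((Re z)\<^sup>2 + (Re w)\<^sup>2))" using c by (simp add: field_simps)
    finally show "mom2 \<rho> (pcoef k hx hy z w) \<le> 1 + k * (M + M\<^sup>2 / c - c / 2 * ((Re z)\<^sup>2 + (Re w)\<^sup>2))" .
  qed
qed

end

section \<open>Differences between fine and coarse meshes\<close>

text \<open>A family indexed by the fine (\<open>False\<close>) and coarse (\<open>True\<close>) meshes in the two directions is regular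
  if its mixed differences have the sizes \<open>e1\<close>, \<open>e2\<close>, \<open>e1 * e2\<close>.\<close>

definition regular :: "real \<Rightarrow> real \<Rightarrow> real \<Rightarrow> (bool \<Rightarrow> bool \<Rightarrow> complex) \<Rightarrow> bool" where
  "regular e1 e2 G f \<longleftrightarrow> (\<forall>a b. norm (f a b) \<le> G) \<and> (\<forall>b. norm (f True b - f False b) \<le> G * e1)
     \<and> (\<forall>a. norm (f a True - f a False) \<le> G * e2)
     \<and> norm (f True True - f True False - f False True + f False False) \<le> G * (e1 * e2)"

context
  fixes e1 e2 :: real
  assumes e: "0 < e1" "0 < e2"
begin

lemma regular_nonneg: "regular e1 e2 G f \<Longrightarrow> 0 \<le> G"
  unfolding regular_def by (meson norm_ge_zero order_trans)

lemma regular_mono: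
  assumes "regular e1 e2 G f" "G \<le> G'" shows "regular e1 e2 G' f"
proof -
  have "G * e1 \<le> G' * e1" "G * e2 \<le> G' * e2" "G * (e1 * e2) \<le> G' * (e1 * e2)"
    using assms(2) e by (auto intro!: mult_right_mono)
  then show ?thesis using assms unfolding regular_def by (meson order_trans)
qed

lemma regular_const: "norm c \<le> G \<Longrightarrow> regular e1 e2 G (\<lambda>a b. c)"
proof -
  assume c: "norm c \<le> G"
  then have "0 \<le> G" using norm_ge_zero order_trans by blast
  then show ?thesis using c e unfolding regular_def by simp
qed

lemma regular_x:
  assumes "\<And>a. norm (f a) \<le> G" "norm (f True - f False) \<le> G * e1"
  shows "regular e1 e2 G (\<lambda>a b. f a)"
proof -
  have "0 \<le> G" using assms(1) norm_ge_zero order_trans by blast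
  then show ?thesis using assms e unfolding regular_def by simp
qed

lemma regular_y:
  assumes "\<And>a. norm (f a) \<le> G" "norm (f True - f False) \<le> G * e2"
  shows "regular e1 e2 G (\<lambda>a b. f b)"
proof -
  have "0 \<le> G" using assms(1) norm_ge_zero order_trans by blast
  then show ?thesis using assms e unfolding regular_def by simp
qed

lemma regular_add:
  assumes "regular e1 e2 G f" "regular e1 e2 H g" shows "regular e1 e2 (G + H) (\<lambda>a b. f a b + g a b)"
proof -
  have "norm (f a b + g a b) \<le> G + H" for a b
    using assms unfolding regular_def by (intro norm_triangle_le add_mono) auto
  moreover have "norm (f True b + g True b - (f False b + g False b)) \<le> (G + H) * e1" for b
    using assms unfolding regular_def add_diff_add distrib_right by (intro norm_triangle_le add_mono) auto
  moreover have "norm (f a True + g a True - (f a False + g a False)) \<le> (G + H) * e2" for a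
    using assms unfolding regular_def add_diff_add distrib_right by (intro norm_triangle_le add_mono) auto
  moreover have "norm ((f True True + g True True) - (f True False + g True False) - (f False True + g False True) + (f False False + g False False))
      \<le> (G + H) * (e1 * e2)"
  proof -
    have "(f True True + g True True) - (f True False + g True False) - (f False True + g False True) + (f False False + g False False)
      = (f True True - f True False - f False True + f False False) + (g True True - g True False - g False True + g False False)"
      by simp
    also have "norm \<dots> \<le> G * (e1 * e2) + H * (e1 * e2)"
      by (rule norm_triangle_le, rule add_mono) (use assms in \<open>auto simp: regular_def\<close>)
    finally show ?thesis by (simp add: distrib_right)
  qed
  ultimately show ?thesis unfolding regular_def by blast
qed

text \<open>The discrete Leibniz rule; the mixed difference of a product has four terms, which gives
  the factor 4.\<close>

lemma regular_mult:
  assumes f: "regular e1 e2 G f" and g: "regular e1 e2 H g"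
  shows "regular e1 e2 (4 * (G * H)) (\<lambda>a b. f a b * g a b)"
proof -
  have GH: "0 \<le> G" "0 \<le> H" using f g regular_nonneg by auto
  have m: "norm (u * v) \<le> U * V" if "norm u \<le> U" "norm v \<le> V" for u v :: complex and U V
    unfolding norm_mult using that by (intro mult_mono) (auto intro: order_trans[OF norm_ge_zero])
  have f': "norm (f a b) \<le> G" "norm (f True b - f False b) \<le> G * e1" "norm (f a True - f a False) \<le> G * e2"
    "norm (f True True - f True False - f False True + f False False) \<le> G * (e1 * e2)" for a b
    using f unfolding regular_def by auto
  have g': "norm (g a b) \<le> H" "norm (g True b - g False b) \<le> H * e1" "norm (g a True - g a False) \<le> H * e2"
    "norm (g True True - g True False - g False True + g False False) \<le> H * (e1 * e2)" for a b
    using g unfolding regular_def by auto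
  have p: "0 \<le> G * H" "0 \<le> G * H * e1" "0 \<le> G * H * e2" using GH e by auto
  have "norm (f a b * g a b) \<le> 4 * (G * H)" for a b using m[OF f'(1) g'(1), of a b a b] p by linarith
  moreover have "norm (f True b * g True b - f False b * g False b) \<le> 4 * (G * H) * e1" for b
  proof -
    have "f True b * g True b - f False b * g False b = (f True b - f False b) * g True b + f False b * (g True b - g False b)"
      by (simp add: algebra_simps)
    also have "norm \<dots> \<le> G * e1 * H + G * (H * e1)" by (intro norm_triangle_le add_mono m f' g')
    finally show ?thesis using p by (simp add: algebra_simps)
  qed
  moreover have "norm (f a True * g a True - f a False * g a False) \<le> 4 * (G * H) * e2" for a
  proof -
    have "f a True * g a True - f a False * g a False = (f a True - f a False) * g a True + f a False * (g a True - g a False)"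
      by (simp add: algebra_simps)
    also have "norm \<dots> \<le> G * e2 * H + G * (H * e2)" by (intro norm_triangle_le add_mono m f' g')
    finally show ?thesis using p by (simp add: algebra_simps)
  qed
  moreover have "norm (f True True * g True True - f True False * g True False - f False True * g False True + f False False * g False False)
     \<le> 4 * (G * H) * (e1 * e2)"
  proof -
    have "f True True * g True True - f True False * g True False - f False True * g False True + f False False * g False False
      = (f True True - f True False - f False True + f False False) * g True True
        + (f True False - f False False) * (g True True - g True False)
        + (f False True - f False False) * (g True True - g False True)
        + f False False * (g True True - g True False - g False True + g False False)"
      by (simp add: algebra_simps)
    also have "norm \<dots> \<le> G * (e1 * e2) * H + G * e1 * (H * e2) + G * e2 * (H * e1) + G * (H * (e1 * e2))"
      by (intro norm_triangle_le add_mono m f' g')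
    finally show ?thesis by (simp add: algebra_simps)
  qed
  ultimately show ?thesis unfolding regular_def by blast
qed

lemma regular_cmult:
  assumes f: "regular e1 e2 G f" and c: "norm c \<le> H"
  shows "regular e1 e2 (H * G) (\<lambda>a b. c * f a b)"
proof -
  have m: "norm (c * u) \<le> H * U" if "norm u \<le> U" for u U
    unfolding norm_mult using that c by (intro mult_mono) (auto intro: order_trans[OF norm_ge_zero])
  have "c * f True True - c * f True False - c * f False True + c * f False False = c * (f True True - f True False - f False True + f False False)"
    by (simp add: algebra_simps)
  then show ?thesis
    using f m unfolding regular_def right_diff_distrib[symmetric] mult.assoc by auto
qed

text \<open>For u = 1/f the Leibniz rule applied to f u = 1 expresses f times the mixed difference
  of u through lower differences of u. With |u| <= 2 the simple differences cost 4 G and the mixed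
  one 4 G + 16 G^2 <= 20 G^2.\<close>

lemma regular_inverse:
  assumes f: "regular e1 e2 G f" and G: "1 \<le> G" and n: "\<And>a b. f a b \<noteq> 0" "\<And>a b. norm (inverse (f a b)) \<le> 2"
  shows "regular e1 e2 (20 * G\<^sup>2) (\<lambda>a b. inverse (f a b))"
proof -
  have m: "norm (u * v) \<le> U * V" if "norm u \<le> U" "norm v \<le> V" for u v :: complex and U V
    unfolding norm_mult using that by (intro mult_mono) (auto intro: order_trans[OF norm_ge_zero])
  have f': "norm (f a b) \<le> G" "norm (f True b - f False b) \<le> G * e1" "norm (f a True - f a False) \<le> G * e2"
    "norm (f True True - f True False - f False True + f False False) \<le> G * (e1 * e2)" for a b
    using f unfolding regular_def by auto
  have G2: "G \<le> G\<^sup>2" "1 \<le> G\<^sup>2" using G by (auto simp: power2_eq_square mult_le_cancel_left1 intro: order_trans)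
  have x: "norm (inverse (f True b) - inverse (f False b)) \<le> 4 * G * e1" for b
  proof -
    have "inverse (f True b) - inverse (f False b) = - ((f True b - f False b) * (inverse (f True b) * inverse (f False b)))"
      using n by (simp add: field_simps)
    also have "norm \<dots> \<le> G * e1 * (2 * 2)" unfolding norm_minus_cancel by (intro m f' n)
    finally show ?thesis by simp
  qed
  have y: "norm (inverse (f a True) - inverse (f a False)) \<le> 4 * G * e2" for a
  proof -
    have "inverse (f a True) - inverse (f a False) = - ((f a True - f a False) * (inverse (f a True) * inverse (f a False)))"
      using n by (simp add: field_simps)
    also have "norm \<dots> \<le> G * e2 * (2 * 2)" unfolding norm_minus_cancel by (intro m f' n)
    finally show ?thesis by simp
  qed
  have xy: "norm (inverse (f True True) - inverse (f True False) - inverse (f False True) + inverse (f False False)) \<le> 20 * G\<^sup>2 * (e1 * e2)"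
  proof -
    define u where "u a b = inverse (f a b)" for a b
    have fu: "f a b * u a b = 1" for a b using n by (simp add: u_def)
    have "f False False * (u True True - u True False - u False True + u False False)
      = - ((f True True - f True False - f False True + f False False) * u True True
        + (f True False - f False False) * (u True True - u True False)
        + (f False True - f False False) * (u True True - u False True))"
      using fu[of True True] fu[of True False] fu[of False True] fu[of False False]
      by (simp add: algebra_simps)
    then have "u False False * (f False False * (u True True - u True False - u False True + u False False))
      = u False False * - ((f True True - f True False - f False True + f False False) * u True True
        + (f True False - f False False) * (u True True - u True False)
        + (f False True - f False False) * (u True True - u False True))" by simp
    moreover have "u False False * (f False False * v) = v" for v
      using fu[of False False] by (metis mult.assoc mult.commute mult.left_neutral)
    ultimately have "u True True - u True False - u False True + u False False
      = u False False * - ((f True True - f True False - f False True + f False False) * u True True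
        + (f True False - f False False) * (u True True - u True False)
        + (f False True - f False False) * (u True True - u False True))" by simp
    also have "norm \<dots> \<le> 2 * (G * (e1 * e2) * 2 + G * e1 * (4 * G * e2) + G * e2 * (4 * G * e1))"
      unfolding u_def by (rule m[OF n(2)], unfold norm_minus_cancel) (intro norm_triangle_le add_mono m f' n x y)
    also have "\<dots> = (4 * G + 16 * G\<^sup>2) * (e1 * e2)" by (simp add: power2_eq_square algebra_simps)
    also have "\<dots> \<le> 20 * G\<^sup>2 * (e1 * e2)" using G2 e by (intro mult_right_mono) auto
    finally show ?thesis by (simp add: u_def)
  qed
  have "4 * G \<le> 20 * G\<^sup>2" "2 \<le> 20 * G\<^sup>2" using G2 by auto
  then have "4 * G * e1 \<le> 20 * G\<^sup>2 * e1" "4 * G * e2 \<le> 20 * G\<^sup>2 * e2" "2 \<le> 20 * G\<^sup>2"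
    using e by (auto intro!: mult_right_mono)
  then show ?thesis using x y xy n(2) unfolding regular_def by (meson order_trans)
qed

end

section \<open>One time step acting on the vector of scaled differences\<close>

definition wt :: "real \<Rightarrow> nat \<Rightarrow> real" where
  "wt k i = [k, sqrt k, sqrt k, k, k, k] ! i"

text \<open>A component y of the difference vector evolves to c y + d, with d the coupling to the
  lower components, of relative size D. Coefficients deviate from (1, 0, ..., 0) by
  \<open>wt\<close> times G, so the cross terms are of size k |y| D and k |y| G D. The requirement G
  D <= V removes G from the result.\<close>

lemma mom2_step:
  assumes r: "\<bar>\<rho>\<bar> \<le> 1" and k: "0 < k" "k \<le> T" and G: "1 \<le> G" "G * D \<le> V" "0 \<le> D"
    and c: "\<And>i. i < 6 \<Longrightarrow> c i = (if i = 0 then 1 else 0) + of_real (wt k i) * g i" "\<And>i. i < 6 \<Longrightarrow> norm (g i) \<le> G"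
    and d: "\<And>i. i < 6 \<Longrightarrow> norm (d i) \<le> wt k i * D"
  shows "mom2 \<rho> (\<lambda>i. c i * y + d i) \<le> mom2 \<rho> c * (norm y)\<^sup>2 + (200 + 300 * T) * k * ((norm y)\<^sup>2 + V\<^sup>2)"
proof -
  define Y where "Y = norm y"
  have Y: "0 \<le> Y" by (simp add: Y_def)
  have DV: "D \<le> V" using G mult_right_mono[of 1 G D] by auto
  have V: "0 \<le> V" using DV G by simp
  have s: "sqrt k * sqrt k = k" using k by simp
  have wg: "norm (c i) \<le> wt k i * G" if "i < 6" "i \<noteq> 0" for i
  proof -
    have "0 \<le> wt k i" using that k by (auto simp: wt_def less_Suc_eq numeral_eq_Suc)
    then show ?thesis using c[OF that(1)] that by (simp add: norm_mult mult_left_mono)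
  qed
  have c0: "norm (c 0) \<le> 1 + k * G"
  proof -
    have "norm (of_real k * g 0) \<le> k * G" using c(2)[of 0] k by (simp add: norm_mult)
    then show ?thesis using c(1)[of 0] norm_triangle_ineq[of 1 "of_real k * g 0"] by (simp add: wt_def)
  qed
  have c1: "level1 c \<le> 2 * (sqrt k * G)" using wg[of 1] wg[of 2] by (simp add: level1_def wt_def)
  have c2: "level2 c \<le> 3 * (k * G)" using wg[of 3] wg[of 4] wg[of 5] by (simp add: level2_def wt_def)
  have d0: "norm (d 0) \<le> k * D" using d[of 0] by (simp add: wt_def)
  have d1: "level1 d \<le> 2 * (sqrt k * D)" using d[of 1] d[of 2] by (simp add: level1_def wt_def)
  have d2: "level2 d \<le> 3 * (k * D)" using d[of 3] d[of 4] d[of 5] by (simp add: level2_def wt_def)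
  have lev: "level1 (\<lambda>i. y * c i) = Y * level1 c" "level2 (\<lambda>i. y * c i) = Y * level2 c" "norm (y * c 0) = Y * norm (c 0)"
    by (simp_all add: level1_def level2_def Y_def norm_mult algebra_simps)
  have "mom2 \<rho> (\<lambda>i. c i * y + d i) = mom2 \<rho> (\<lambda>i. y * c i + d i)" by (simp add: mult.commute)
  also have "\<dots> \<le> mom2 \<rho> (\<lambda>i. y * c i)
    + (2 * (Y * norm (c 0)) * norm (d 0) + (norm (d 0))\<^sup>2)
    + (4 * (Y * level1 c) * level1 d + 2 * (level1 d)\<^sup>2)
    + (16 * (Y * level2 c) * level2 d + 8 * (level2 d)\<^sup>2)"
    using mom2_add_le[OF r, of "\<lambda>i. y * c i" d] unfolding lev by simp
  also have "\<dots> \<le> mom2 \<rho> (\<lambda>i. y * c i)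
    + (2 * (Y * (1 + k * G)) * (k * D) + (k * D)\<^sup>2)
    + (4 * (Y * (2 * (sqrt k * G))) * (2 * (sqrt k * D)) + 2 * (2 * (sqrt k * D))\<^sup>2)
    + (16 * (Y * (3 * (k * G))) * (3 * (k * D)) + 8 * (3 * (k * D))\<^sup>2)"
    using c0 c1 c2 d0 d1 d2 k G Y
    by (intro add_mono mult_mono power_mono mult_left_mono order_refl mult_nonneg_nonneg) auto
  \<comment> \<open>Only the degree-one parts contribute sqrt k, and they do so in pairs. The
    numerals come from the degrees 0 and 2: 146 = 2 + 144 and 73 = 1 + 72. The later constants are
    rounded up generously.\<close>
  also have "\<dots> = mom2 \<rho> (\<lambda>i. y * c i) + (2 * Y * k * D + 146 * (Y * k) * k * (G * D) + 73 * (k * k) * D\<^sup>2 )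
     + (16 * Y * (sqrt k * sqrt k) * (G * D) + 8 * (sqrt k * sqrt k) * D\<^sup>2)"
    by (simp add: power2_eq_square algebra_simps del: real_sqrt_mult_self)
  also have "\<dots> \<le> mom2 \<rho> (\<lambda>i. y * c i) + (2 * Y * k * V + 146 * (Y * k) * T * V + 73 * (T * k) * V\<^sup>2)
     + (16 * Y * k * V + 8 * k * V\<^sup>2)"
    unfolding s using Y k G V DV
    by (intro add_mono mult_mono mult_left_mono mult_right_mono power_mono order_refl mult_nonneg_nonneg) auto
  also have "\<dots> = mom2 \<rho> (\<lambda>i. y * c i) + (18 + 146 * T) * k * (Y * V) + (8 + 73 * T) * k * V\<^sup>2"
    by (simp add: algebra_simps)
  also have "\<dots> \<le> mom2 \<rho> (\<lambda>i. y * c i) + (18 + 146 * T) * k * (Y\<^sup>2 + V\<^sup>2) + (8 + 73 * T) * k * (Y\<^sup>2 + V\<^sup>2)"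
  proof -
    have "2 * (Y * V) \<le> Y\<^sup>2 + V\<^sup>2" using sum_squares_bound[of Y V] by simp
    then have "Y * V \<le> Y\<^sup>2 + V\<^sup>2" using Y V mult_nonneg_nonneg[of Y V] by linarith
    then show ?thesis using k by (intro add_mono mult_left_mono order_refl) auto
  qed
  also have "\<dots> = mom2 \<rho> (\<lambda>i. y * c i) + (26 + 219 * T) * k * (Y\<^sup>2 + V\<^sup>2)" by (simp add: algebra_simps)
  also have "\<dots> \<le> mom2 \<rho> (\<lambda>i. y * c i) + (200 + 300 * T) * k * (Y\<^sup>2 + V\<^sup>2)"
    using k by (intro add_left_mono mult_right_mono) auto
  finally show ?thesis unfolding mom2_scale Y_def by (simp add: mult.commute)
qed

definition corner_norm :: "real \<Rightarrow> real \<Rightarrow> (bool \<Rightarrow> bool \<Rightarrow> complex) \<Rightarrow> real" where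
  "corner_norm e1 e2 X = (norm (X False False))\<^sup>2 + (norm ((X True False - X False False) / of_real e1))\<^sup>2
     + (norm ((X False True - X False False) / of_real e2))\<^sup>2
     + (norm ((X True True - X True False - X False True + X False False) / of_real (e1 * e2)))\<^sup>2"

lemma corner_norm_nonneg: "0 \<le> corner_norm e1 e2 X"
  by (simp add: corner_norm_def)

text \<open>Differences of the coefficients are of size \<open>wt\<close> times G u. Divided by the
  unit u G^2 they leave \<open>wt\<close> / G, so the coupling has D = V / G and G D = V. This is
  the reason for the square of G in the units: the surplus over q is O(k) with a constant free of G,
  hence free of the frequency.\<close>

lemma nn_integral_corner_step:
  assumes r: "\<bar>\<rho>\<bar> \<le> 1" and k: "0 < k" "k \<le> T" and G: "1 \<le> G" and u: "0 < u1" "0 < u2"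
    and c: "\<And>a b i. i < 6 \<Longrightarrow> c a b i = (if i = 0 then 1 else 0) + of_real (wt k i) * g i a b"
    and g: "\<And>i. i < 6 \<Longrightarrow> regular u1 u2 G (g i)"
    and q: "\<And>a b. mom2 \<rho> (c a b) \<le> q"
  shows "(\<integral>\<^sup>+z. ennreal (corner_norm (u1 * G\<^sup>2) (u2 * G\<^sup>2) (\<lambda>a b. chaos \<rho> (c a b) z * X a b)) \<partial>std_binormal \<rho>)
    \<le> ennreal ((q + (2600 + 3900 * T) * k) * corner_norm (u1 * G\<^sup>2) (u2 * G\<^sup>2) X)"
proof -
  define e1 e2 where "e1 = u1 * G\<^sup>2" and "e2 = u2 * G\<^sup>2"
  have e: "0 < e1" "0 < e2" using u G by (auto simp: e1_def e2_def)
  define y1 y2 y3 y4 where "y1 = X False False" and "y2 = (X True False - X False False) / of_real e1"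
    and "y3 = (X False True - X False False) / of_real e2"
    and "y4 = (X True True - X True False - X False True + X False False) / of_real (e1 * e2)"
  \<comment> \<open>The off-diagonal entries of the triangular evolution. Each diagonal entry is the
    factor at the corner reached by the difference, so what is left of the Leibniz rule involves
    only components of lower order.\<close>
  define d2 d3 d4 where "d2 i = (c True False i - c False False i) / of_real e1 * y1"
    and "d3 i = (c False True i - c False False i) / of_real e2 * y1"
    and "d4 i = (c True True i - c True False i) / of_real e2 * y2 + (c True True i - c False True i) / of_real e1 * y3
       + (c True True i - c True False i - c False True i + c False False i) / of_real (e1 * e2) * y1" for i
  have Xs: "X False False = y1" "X True False = y1 + of_real e1 * y2" "X False True = y1 + of_real e2 * y3"
    "X True True = y1 + of_real e1 * y2 + of_real e2 * y3 + of_real (e1 * e2) * y4"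
    using e by (simp_all add: y1_def y2_def y3_def y4_def)
  have 1: "chaos \<rho> (c False False) z * X False False = chaos \<rho> (\<lambda>i. c False False i * y1) z" for z
    unfolding Xs chaos_def by (simp add: algebra_simps)
  have 2: "(chaos \<rho> (c True False) z * X True False - chaos \<rho> (c False False) z * X False False) / of_real e1
      = chaos \<rho> (\<lambda>i. c True False i * y2 + d2 i) z" for z
    unfolding Xs chaos_def d2_def using e by (simp add: field_simps)
  have 3: "(chaos \<rho> (c False True) z * X False True - chaos \<rho> (c False False) z * X False False) / of_real e2
      = chaos \<rho> (\<lambda>i. c False True i * y3 + d3 i) z" for z
    unfolding Xs chaos_def d3_def using e by (simp add: field_simps)
  have 4: "(chaos \<rho> (c True True) z * X True True - chaos \<rho> (c True False) z * X True False
        - chaos \<rho> (c False True) z * X False True + chaos \<rho> (c False False) z * X False False) / of_real (e1 * e2)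
      = chaos \<rho> (\<lambda>i. c True True i * y4 + d4 i) z" for z
    unfolding Xs chaos_def d4_def using e by (simp add: field_simps)
  define V where "V = norm y1 + norm y2 + norm y3"
  have V: "0 \<le> V" by (simp add: V_def)
  define C where "C = 200 + 300 * T"
  have C: "0 \<le> C" using k by (simp add: C_def)
  have gb: "norm (g i a b) \<le> G" "norm (g i True b - g i False b) / e1 \<le> 1 / G" "norm (g i a True - g i a False) / e2 \<le> 1 / G"
    "norm (g i True True - g i True False - g i False True + g i False False) / (e1 * e2) \<le> 1 / G" if "i < 6" for i a b
  proof -
    have *: "norm (g i a b) \<le> G" "norm (g i True b - g i False b) \<le> G * u1" "norm (g i a True - g i a False) \<le> G * u2"
      "norm (g i True True - g i True False - g i False True + g i False False) \<le> G * (u1 * u2)"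
      using g[OF that] unfolding regular_def by auto
    show "norm (g i a b) \<le> G" by fact
    show "norm (g i True b - g i False b) / e1 \<le> 1 / G" "norm (g i a True - g i a False) / e2 \<le> 1 / G"
      using *(2,3) u G by (simp_all add: e1_def e2_def divide_simps power2_eq_square) (simp_all add: algebra_simps)
    have "G * (u1 * u2) / (e1 * e2) = 1 / G * (1 / (G * G))" using u G by (simp add: e1_def e2_def power2_eq_square field_simps)
    also have "\<dots> \<le> 1 / G * 1" using G by (intro mult_left_mono) (auto simp: divide_le_eq_1 intro: order_trans[OF _ mult_mono[of 1 G 1 G]])
    finally show "norm (g i True True - g i True False - g i False True + g i False False) / (e1 * e2) \<le> 1 / G"
      using divide_right_mono[OF *(4), of "e1 * e2"] e by simp
  qed
  have w0: "0 \<le> wt k i" if "i < 6" for i using that k by (auto simp: wt_def less_Suc_eq numeral_eq_Suc)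
  have nrm: "norm ((of_real w * (x :: complex)) / of_real e * y) \<le> w * (1 / G * norm y)" if "norm x / e \<le> 1 / G" "0 \<le> w" "0 < e" for w x e y
  proof -
    have "norm ((of_real w * x) / of_real e * y) = w * ((norm x / e) * norm y)" using that by (simp add: norm_mult norm_divide)
    also have "\<dots> \<le> w * (1 / G * norm y)" using that by (intro mult_left_mono mult_right_mono) auto
    finally show ?thesis .
  qed
  have step: "mom2 \<rho> (\<lambda>i. c a b i * y + d i) \<le> q * (norm y)\<^sup>2 + C * k * ((norm y)\<^sup>2 + V\<^sup>2)"
    if "\<And>i. i < 6 \<Longrightarrow> norm (d i) \<le> wt k i * (1 / G * V)" for a b y d
  proof -
    have "mom2 \<rho> (\<lambda>i. c a b i * y + d i) \<le> mom2 \<rho> (c a b) * (norm y)\<^sup>2 + C * k * ((norm y)\<^sup>2 + V\<^sup>2)"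
      unfolding C_def using G V by (intro mom2_step[where G = G and D = "1 / G * V" and g = "\<lambda>i. g i a b"] r k c gb that) auto
    also have "\<dots> \<le> q * (norm y)\<^sup>2 + C * k * ((norm y)\<^sup>2 + V\<^sup>2)" using q by (intro add_right_mono mult_right_mono) auto
    finally show ?thesis .
  qed
  have dx: "norm (d2 i) \<le> wt k i * (1 / G * V)" "norm (d3 i) \<le> wt k i * (1 / G * V)" "norm (d4 i) \<le> wt k i * (1 / G * V)" if i: "i < 6" for i
  proof -
    have cd: "c a b i - c a' b' i = of_real (wt k i) * (g i a b - g i a' b')" for a b a' b'
      using c[OF i] by (simp add: algebra_simps)
    have cdd: "c True True i - c True False i - c False True i + c False False i
       = of_real (wt k i) * (g i True True - g i True False - g i False True + g i False False)"
      using c[OF i] by (simp add: algebra_simps)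
    have V1: "wt k i * (1 / G * norm y1) \<le> wt k i * (1 / G * V)" using w0[OF i] G by (intro mult_left_mono) (auto simp: V_def)
    show "norm (d2 i) \<le> wt k i * (1 / G * V)" "norm (d3 i) \<le> wt k i * (1 / G * V)"
      unfolding d2_def d3_def cd using i e w0[OF i] by (intro order_trans[OF nrm V1] gb; simp)+
    have "norm (d4 i) \<le> wt k i * (1 / G * norm y2) + wt k i * (1 / G * norm y3) + wt k i * (1 / G * norm y1)"
      unfolding d4_def cdd unfolding cd using i e w0[OF i] by (intro norm_triangle_le add_mono nrm gb) auto
    then show "norm (d4 i) \<le> wt k i * (1 / G * V)" by (simp add: V_def algebra_simps add_divide_distrib)
  qed
  have meas: "(\<lambda>z. ennreal ((norm (chaos \<rho> d z))\<^sup>2)) \<in> borel_measurable (std_binormal \<rho>)" for d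
  proof -
    have "(\<lambda>z. (norm (chaos \<rho> d z))\<^sup>2) \<in> borel_measurable borel"
      unfolding chaos_def by (intro borel_measurable_continuous_onI continuous_intros)
    then show ?thesis by (simp add: std_binormal_def)
  qed
  define cn where "cn = corner_norm e1 e2 X"
  have cn: "cn = (norm y1)\<^sup>2 + (norm y2)\<^sup>2 + (norm y3)\<^sup>2 + (norm y4)\<^sup>2"
    by (simp add: cn_def corner_norm_def y1_def y2_def y3_def y4_def)
  have V2: "V\<^sup>2 \<le> 3 * cn"
  proof -
    have "V\<^sup>2 \<le> 3 * ((norm y1)\<^sup>2 + (norm y2)\<^sup>2 + (norm y3)\<^sup>2)"
      using sum_squares_bound[of "norm y1" "norm y2"] sum_squares_bound[of "norm y1" "norm y3"] sum_squares_bound[of "norm y2" "norm y3"]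
      by (simp add: V_def power2_eq_square algebra_simps)
    then show ?thesis unfolding cn by (simp add: distrib_left add_increasing2)
  qed
  have "(\<integral>\<^sup>+z. ennreal (corner_norm e1 e2 (\<lambda>a b. chaos \<rho> (c a b) z * X a b)) \<partial>std_binormal \<rho>)
    = (\<integral>\<^sup>+z. ennreal ((norm (chaos \<rho> (\<lambda>i. c False False i * y1 + 0) z))\<^sup>2) + ennreal ((norm (chaos \<rho> (\<lambda>i. c True False i * y2 + d2 i) z))\<^sup>2)
       + ennreal ((norm (chaos \<rho> (\<lambda>i. c False True i * y3 + d3 i) z))\<^sup>2) + ennreal ((norm (chaos \<rho> (\<lambda>i. c True True i * y4 + d4 i) z))\<^sup>2) \<partial>std_binormal \<rho>)"
    unfolding corner_norm_def 2 3 4 unfolding 1 by (simp add: ennreal_plus)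
  also have "\<dots> = ennreal (mom2 \<rho> (\<lambda>i. c False False i * y1 + 0)) + ennreal (mom2 \<rho> (\<lambda>i. c True False i * y2 + d2 i))
       + ennreal (mom2 \<rho> (\<lambda>i. c False True i * y3 + d3 i)) + ennreal (mom2 \<rho> (\<lambda>i. c True True i * y4 + d4 i))"
    by (subst nn_integral_add; (intro borel_measurable_add meas)?)+ (simp only: nn_integral_chaos[OF r])
  also have "\<dots> = ennreal (mom2 \<rho> (\<lambda>i. c False False i * y1 + 0) + mom2 \<rho> (\<lambda>i. c True False i * y2 + d2 i)
       + mom2 \<rho> (\<lambda>i. c False True i * y3 + d3 i) + mom2 \<rho> (\<lambda>i. c True True i * y4 + d4 i))"
    by (simp add: mom2_nonneg ennreal_plus)
  also have "\<dots> \<le> ennreal ((q * (norm y1)\<^sup>2 + C * k * ((norm y1)\<^sup>2 + V\<^sup>2)) + (q * (norm y2)\<^sup>2 + C * k * ((norm y2)\<^sup>2 + V\<^sup>2))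
       + (q * (norm y3)\<^sup>2 + C * k * ((norm y3)\<^sup>2 + V\<^sup>2)) + (q * (norm y4)\<^sup>2 + C * k * ((norm y4)\<^sup>2 + V\<^sup>2)))"
    using dx V G w0 by (intro ennreal_leI add_mono step) auto
  also have "\<dots> = ennreal (q * cn + C * k * (cn + 4 * V\<^sup>2))" by (simp add: cn algebra_simps)
  \<comment> \<open>Here 13 = 1 + 4 * 3: the norm itself, and four components each charged with V^2
    <= 3 times the norm. Multiplied by 200 and 300 this gives 2600 and 3900.\<close>
  also have "\<dots> \<le> ennreal (q * cn + C * k * (13 * cn))"
  proof -
    have "C * k * (cn + 4 * V\<^sup>2) \<le> C * k * (13 * cn)" using V2 C k by (intro mult_left_mono) auto
    then show ?thesis by (intro ennreal_leI) simp
  qed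
  also have "\<dots> = ennreal ((q + (2600 + 3900 * T) * k) * cn)" by (simp add: C_def algebra_simps)
  finally show ?thesis unfolding cn_def e1_def e2_def .
qed

section \<open>Independent increments\<close>

lemma prob_space_std_binormal: "prob_space (std_binormal \<rho>)"
proof -
  interpret std_normal: prob_space std_normal by (rule prob_space_normal_density) simp
  interpret pair_prob_space std_normal std_normal ..
  have "(\<lambda>(u, v). (u, \<rho> * u + sqrt (1 - \<rho>\<^sup>2) * v)) \<in> std_normal \<Otimes>\<^sub>M std_normal \<rightarrow>\<^sub>M borel"
    unfolding borel_prod[symmetric] by measurable
  then show ?thesis unfolding std_binormal_def by (rule prob_space_distr)
qed

lemma sets_std_binormal [simp, measurable_cong]: "sets (std_binormal \<rho>) = sets borel"
  by (simp add: std_binormal_def)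

lemma borel_measurable_chaos [measurable]: "chaos \<rho> c \<in> borel_measurable borel"
  unfolding chaos_def[abs_def] by (intro borel_measurable_continuous_onI continuous_intros)

text \<open>The one-step bound holds for every deterministic vector X. Integrating the last
  increment first, with the earlier ones frozen, lets the product accumulated so far play the role
  of X.\<close>

lemma nn_integral_corner_iterate:
  assumes step: "\<And>X. (\<integral>\<^sup>+z. ennreal (corner_norm e1 e2 (\<lambda>a b. chaos \<rho> (c a b) z * X a b)) \<partial>std_binormal \<rho>)
      \<le> ennreal (Q * corner_norm e1 e2 X)" and Q: "0 \<le> Q"
  shows "(\<integral>\<^sup>+zs. ennreal (corner_norm e1 e2 (\<lambda>a b. X a b * (\<Prod>m<n. chaos \<rho> (c a b) (zs m)))) \<partial>(PiM {..<n} (\<lambda>_. std_binormal \<rho>)))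
    \<le> ennreal (Q ^ n * corner_norm e1 e2 X)"
proof -
  interpret B: prob_space "std_binormal \<rho>" by (rule prob_space_std_binormal)
  interpret product_sigma_finite "\<lambda>_. std_binormal \<rho>" by standard
  show ?thesis
  proof (induction n)
    case 0
    show ?case unfolding lessThan_0 by (subst nn_integral_empty) auto
  next
    case (Suc n)
    define F where "F n zs = ennreal (corner_norm e1 e2 (\<lambda>a b. X a b * (\<Prod>m<n. chaos \<rho> (c a b) (zs m))))" for n :: nat and zs
    have meas: "F n \<in> borel_measurable (PiM {..<n} (\<lambda>_. std_binormal \<rho>))" for n
    proof -
      have [measurable]: "(\<lambda>zs. \<Prod>m<n. chaos \<rho> (c a b) (zs m)) \<in> borel_measurable (PiM {..<n} (\<lambda>_. std_binormal \<rho>))" for a b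
        by (intro borel_measurable_prod measurable_compose[OF measurable_component_singleton]) (auto simp: measurable_cong_sets[OF sets_std_binormal refl] borel_measurable_chaos)
      show ?thesis unfolding F_def[abs_def] corner_norm_def by measurable
    qed
    have "(\<integral>\<^sup>+zs. F (Suc n) zs \<partial>(PiM {..<Suc n} (\<lambda>_. std_binormal \<rho>)))
      = (\<integral>\<^sup>+zs. (\<integral>\<^sup>+z. F (Suc n) (zs(n := z)) \<partial>std_binormal \<rho>) \<partial>(PiM {..<n} (\<lambda>_. std_binormal \<rho>)))"
      using meas[of "Suc n"] unfolding lessThan_Suc by (intro product_nn_integral_insert) auto
    also have "\<dots> \<le> (\<integral>\<^sup>+zs. ennreal Q * F n zs \<partial>(PiM {..<n} (\<lambda>_. std_binormal \<rho>)))"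
    proof (rule nn_integral_mono)
      fix zs
      have "(\<integral>\<^sup>+z. F (Suc n) (zs(n := z)) \<partial>std_binormal \<rho>)
        = (\<integral>\<^sup>+z. ennreal (corner_norm e1 e2 (\<lambda>a b. chaos \<rho> (c a b) z * (X a b * (\<Prod>m<n. chaos \<rho> (c a b) (zs m))))) \<partial>std_binormal \<rho>)"
        unfolding F_def by (simp add: mult_ac)
      also have "\<dots> \<le> ennreal (Q * corner_norm e1 e2 (\<lambda>a b. X a b * (\<Prod>m<n. chaos \<rho> (c a b) (zs m))))" by (rule step)
      also have "\<dots> = ennreal Q * F n zs" unfolding F_def using Q by (simp add: ennreal_mult corner_norm_nonneg)
      finally show "(\<integral>\<^sup>+z. F (Suc n) (zs(n := z)) \<partial>std_binormal \<rho>) \<le> ennreal Q * F n zs" .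
    qed
    also have "\<dots> = ennreal Q * (\<integral>\<^sup>+zs. F n zs \<partial>(PiM {..<n} (\<lambda>_. std_binormal \<rho>)))"
      using meas by (intro nn_integral_cmult)
    also have "\<dots> \<le> ennreal Q * ennreal (Q ^ n * corner_norm e1 e2 X)"
      using Suc unfolding F_def by (intro mult_left_mono) auto
    also have "\<dots> = ennreal (Q ^ Suc n * corner_norm e1 e2 X)"
      using Q by (simp add: corner_norm_nonneg mult.assoc flip: ennreal_mult)
    finally show ?case unfolding F_def .
  qed
qed

definition incr :: "(real \<Rightarrow> 'a \<Rightarrow> real \<times> real) \<Rightarrow> real \<Rightarrow> 'a \<Rightarrow> nat \<Rightarrow> real \<times> real" where
  "incr W k \<omega> n = (Zx W k n \<omega>, Zy W k n \<omega>)"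

lemma measurable_increment:
  assumes BM: "correlated_BM M \<rho> W" and k: "0 < k"
  shows "(\<lambda>\<omega>. incr W k \<omega> n) \<in> borel_measurable M"
proof -
  have [measurable]: "W (real n * k) \<in> borel_measurable M" for n using BM k unfolding correlated_BM_def by auto
  have [measurable]: "Zx W k n \<in> borel_measurable M" "Zy W k n \<in> borel_measurable M"
    unfolding Zx_def[abs_def] Zy_def[abs_def]
    by (intro borel_measurable_divide borel_measurable_diff borel_measurable_const
      measurable_compose[OF _ borel_measurable_continuous_onI[OF continuous_on_fst]]
      measurable_compose[OF _ borel_measurable_continuous_onI[OF continuous_on_snd]] continuous_on_id; measurable)+
  show ?thesis unfolding borel_prod[symmetric] incr_def by measurable
qed

text \<open>Independence and the common law of the normalised increments identify their joint law
  with a product measure, so expectations over paths become iterated integrals.\<close>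

lemma nn_integral_increments:
  assumes BM: "correlated_BM M \<rho> W" and k: "0 < k" and N: "0 < N"
    and F: "F \<in> borel_measurable (PiM {..<N} (\<lambda>_. borel))"
  shows "(\<integral>\<^sup>+\<omega>. F (\<lambda>n\<in>{..<N}. incr W k \<omega> n) \<partial>M) = (\<integral>\<^sup>+zs. F zs \<partial>(PiM {..<N} (\<lambda>_. std_binormal \<rho>)))"
proof -
  interpret prob_space M using BM unfolding correlated_BM_def by simp
  define Z where "Z n \<omega> = incr W k \<omega> n" for n \<omega>
  have Zmeas: "Z n \<in> borel_measurable M" for n unfolding Z_def[abs_def] by (rule measurable_increment[OF BM k])
  have Zeq: "Z n \<omega> = (1 / sqrt k) *\<^sub>R (W (real (Suc n) * k) \<omega> - W (real n * k) \<omega>)" for n \<omega>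
    by (rule prod_eqI) (simp_all add: Z_def incr_def Zx_def Zy_def)
  have "mono (\<lambda>n. real n * k)" using k by (intro monoI mult_right_mono) auto
  then have "indep_vars (\<lambda>_. borel) (\<lambda>i \<omega>. W (real (Suc i) * k) \<omega> - W (real i * k) \<omega>) {..<N}"
    using BM k unfolding correlated_BM_def by (elim conjE allE[of _ "\<lambda>n. real n * k"]) auto
  then have "indep_vars (\<lambda>_. borel) (\<lambda>i \<omega>. (1 / sqrt k) *\<^sub>R (W (real (Suc i) * k) \<omega> - W (real i * k) \<omega>)) {..<N}"
    by (rule indep_vars_compose2) (intro borel_measurable_continuous_onI continuous_intros)
  then have "indep_vars (\<lambda>_. borel) Z {..<N}" unfolding Zeq[abs_def] .
  then have "distr M (PiM {..<N} (\<lambda>_. borel)) (\<lambda>\<omega>. \<lambda>n\<in>{..<N}. Z n \<omega>) = PiM {..<N} (\<lambda>n. distr M borel (Z n))"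
    using N Zmeas by (subst (asm) indep_vars_iff_distr_eq_PiM) auto
  also have "\<dots> = PiM {..<N} (\<lambda>_. std_binormal \<rho>)"
  proof (intro PiM_cong refl)
    fix n
    have "0 \<le> real n * k \<and> real n * k < real (Suc n) * k" using k by simp
    then have "distr M borel (\<lambda>\<omega>. (1 / sqrt (real (Suc n) * k - real n * k)) *\<^sub>R (W (real (Suc n) * k) \<omega> - W (real n * k) \<omega>)) = std_binormal \<rho>"
      using BM unfolding correlated_BM_def by blast
    moreover have "real (Suc n) * k - real n * k = k" by (simp add: algebra_simps)
    ultimately show "distr M borel (Z n) = std_binormal \<rho>" unfolding Zeq[abs_def] by simp
  qed
  finally have "PiM {..<N} (\<lambda>_. std_binormal \<rho>) = distr M (PiM {..<N} (\<lambda>_. borel)) (\<lambda>\<omega>. \<lambda>n\<in>{..<N}. Z n \<omega>)" ..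
  moreover have "(\<lambda>\<omega>. \<lambda>n\<in>{..<N}. Z n \<omega>) \<in> M \<rightarrow>\<^sub>M PiM {..<N} (\<lambda>_. borel)"
    by (intro measurable_restrict Zmeas)
  ultimately show ?thesis
    using F by (simp add: nn_integral_distr Z_def[symmetric])
qed

text \<open>The coarse mesh resolves fewer frequencies than the fine one. On the excess frequencies the coarse amplification
  factor is replaced by the fine one and the coarse initial value by \<open>0\<close>; there \<open>1 \<le> h\<^sup>2 \<xi>\<^sup>2\<close>, so all
  differences still have the expected order.\<close>

definition coarse :: "real \<Rightarrow> real \<Rightarrow> real" where
  "coarse h x = (if \<bar>x\<bar> * (2 * h) \<le> pi then 2 * h else h)"

definition msh :: "real \<Rightarrow> real \<Rightarrow> bool \<Rightarrow> real" where
  "msh h x a = (if a then coarse h x else h)"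

lemma msh_simps: 
  assumes "0 < h" "2 * h \<le> h0" "\<bar>x\<bar> * h \<le> pi"
  shows "0 < msh h x a" "msh h x a \<le> h0" "\<bar>x\<bar> * msh h x a \<le> pi" "h \<le> msh h x a"
  using assms by (auto simp: msh_def coarse_def)

section \<open>Regularity of the amplification coefficients across meshes\<close>

context milstein_spde
begin

text \<open>With q = K t the symbols are bounded by q and q^2, and the exact coarsening formulas
  give h^2 q^3 and h^2 q^4; the exponent 4 serves all of them. On excess frequencies both meshes
  coincide and the differences vanish.\<close>

lemma dsin_msh:
  assumes h: "0 < h" "2 * h \<le> h0" and z: "\<bar>Im z\<bar> \<le> 1" and t: "1 \<le> t" "\<bar>Re z\<bar> + \<bar>Im z\<bar> \<le> t"
  shows "norm (dsin (msh h x a) z) \<le> (K * t)^4" "norm (dcos (msh h x a) z) \<le> (K * t)^4"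
    "norm (dsin (msh h x True) z - dsin (msh h x False) z) \<le> (K * t)^4 * h\<^sup>2"
    "norm (dcos (msh h x True) z - dcos (msh h x False) z) \<le> (K * t)^4 * h\<^sup>2"
proof -
  define q where "q = K * t"
  have q: "1 \<le> q" using mult_mono[OF K1 t(1)] K1 by (simp add: q_def)
  have m: "0 < msh h x a" "msh h x a \<le> h0" for a using h by (auto simp: msh_def coarse_def)
  have S: "norm (dsin h' z) \<le> q" if "0 < h'" "h' \<le> h0" for h'
  proof -
    have "norm (dsin h' z) \<le> K * (\<bar>Re z\<bar> + \<bar>Im z\<bar>)" using that z by (intro norm_dsin_le cosh_le_K) auto
    also have "\<dots> \<le> q" unfolding q_def using t K1 by (intro mult_left_mono) auto
    finally show ?thesis .
  qed
  have C: "norm (dcos h' z) \<le> q\<^sup>2" if "0 < h'" "h' \<le> h0" for h'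
  proof -
    have "norm (dcos h' z) \<le> K\<^sup>2 * (\<bar>Re z\<bar> + \<bar>Im z\<bar>)\<^sup>2" using that z by (intro norm_dcos_le cosh_le_K) auto
    also have "\<dots> \<le> K\<^sup>2 * t\<^sup>2" using t K1 by (intro mult_left_mono power_mono) auto
    finally show ?thesis by (simp add: q_def power_mult_distrib)
  qed
  have pw: "q \<le> q^4" "q\<^sup>2 \<le> q^4" "q * q\<^sup>2 \<le> q^4" using q self_le_power[of q 4] power_increasing[of 2 4 q] power_increasing[of 3 4 q]
    by (auto simp: power3_eq_cube power2_eq_square)
  show "norm (dsin (msh h x a) z) \<le> (K * t)^4" "norm (dcos (msh h x a) z) \<le> (K * t)^4"
    using S[OF m[of a]] C[OF m[of a]] pw unfolding q_def[symmetric] by auto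
  have hh: "h \<le> h0" using h by simp
  have q4: "0 \<le> q^4 * h\<^sup>2" using q by simp
  have "norm (dsin (2 * h) z - dsin h z) \<le> q^4 * h\<^sup>2"
  proof -
    have "norm (dsin (2 * h) z - dsin h z) = norm (dsin h z - dsin (2 * h) z)" by (rule norm_minus_commute)
    also have "\<dots> = h\<^sup>2 * (norm (dsin h z) * norm (dcos h z))" using h by (simp add: dsin_coarsen norm_mult norm_power)
    also have "\<dots> \<le> h\<^sup>2 * (q * q\<^sup>2)" using S[OF h(1) hh] C[OF h(1) hh] q by (intro mult_left_mono mult_mono) auto
    also have "\<dots> \<le> h\<^sup>2 * q^4" using pw by (intro mult_left_mono) auto
    finally show ?thesis by (simp add: mult.commute)
  qed
  then show "norm (dsin (msh h x True) z - dsin (msh h x False) z) \<le> (K * t)^4 * h\<^sup>2"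
    unfolding q_def[symmetric] msh_def coarse_def using q4 by auto
  have "norm (dcos (2 * h) z - dcos h z) \<le> q^4 * h\<^sup>2"
  proof -
    have "norm (dcos (2 * h) z - dcos h z) = norm (dcos h z - dcos (2 * h) z)" by (rule norm_minus_commute)
    also have "\<dots> = h\<^sup>2 * (norm (dcos h z))\<^sup>2 / 2" using h by (simp add: dcos_coarsen norm_mult norm_power norm_divide)
    also have "\<dots> \<le> h\<^sup>2 * (q\<^sup>2)\<^sup>2 / 2" using C[OF h(1) hh] by (intro divide_right_mono mult_left_mono power_mono) auto
    also have "\<dots> \<le> q^4 * h\<^sup>2" using q4 by (simp add: mult.commute)
    finally show ?thesis .
  qed
  then show "norm (dcos (msh h x True) z - dcos (msh h x False) z) \<le> (K * t)^4 * h\<^sup>2"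
    unfolding q_def[symmetric] msh_def coarse_def using q4 by auto
qed

text \<open>The coefficients of the amplification factor with the leading 1 removed and the power of
  k from \<open>wt\<close> divided out; at index 0 this is (num - den) / (k den). In this form
  regularity constants can be uniform as k tends to 0.\<close>

definition gcoef :: "real \<Rightarrow> real \<Rightarrow> real \<Rightarrow> complex \<Rightarrow> complex \<Rightarrow> nat \<Rightarrow> complex" where
  "gcoef k hx hy z w i = inverse (den k hx hy z w) *
     [of_real (- (\<rho> * sqrt \<rho>x * sqrt \<rho>y)) * (dsin hx z * dsin hy w) + (- 1) * symD hx hy z w,
      (- \<i> * of_real (sqrt \<rho>x)) * dsin hx z, (- \<i> * of_real (sqrt \<rho>y)) * dsin hy w,
      of_real (- (\<rho>x / 2)) * (dsin hx z * dsin hx z), of_real (- (\<rho>y / 2)) * (dsin hy w * dsin hy w),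
      of_real (- (sqrt \<rho>x * sqrt \<rho>y)) * (dsin hx z * dsin hy w)] ! i"

lemma pcoef_eq_gcoef:
  assumes k: "0 < k" and d: "den k hx hy z w \<noteq> 0" and i: "i < 6"
  shows "pcoef k hx hy z w i = (if i = 0 then 1 else 0) + of_real (wt k i) * gcoef k hx hy z w i"
proof -
  define d where "d = den k hx hy z w"
  have d0: "d \<noteq> 0" using d by (simp add: d_def)
  have sd: "of_real k * symD hx hy z w = d - 1" by (simp add: d_def den_def)
  define s where "s = complex_of_real (sqrt k)"
  have s: "of_real k = s * s" using k by (simp add: s_def flip: of_real_mult)
  have rr: "of_real \<rho>x = complex_of_real (sqrt \<rho>x) * of_real (sqrt \<rho>x)" "of_real \<rho>y = complex_of_real (sqrt \<rho>y) * of_real (sqrt \<rho>y)"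
    using rx ry by (simp_all flip: of_real_mult)
  have sq: "complex_of_real (sqrt (\<rho>x * k)) = of_real (sqrt \<rho>x) * s" "complex_of_real (sqrt (\<rho>y * k)) = of_real (sqrt \<rho>y) * s"
    by (simp_all add: s_def real_sqrt_mult)
  consider "i = 0" | "i = 1" | "i = 2" | "i = 3" | "i = 4" | "i = 5" using i by linarith
  then show ?thesis
  proof cases
    case 1
    have "pcoef k hx hy z w i = inverse d * (1 - of_real k * (of_real (\<rho> * sqrt \<rho>x * sqrt \<rho>y) * (dsin hx z * dsin hy w)))"
      unfolding pcoef_def num_def ncoef_def sq d_def[symmetric] 1 s by (simp add: algebra_simps)
    also have "\<dots> = 1 + inverse d * (- (of_real k * (of_real (\<rho> * sqrt \<rho>x * sqrt \<rho>y) * (dsin hx z * dsin hy w))) - of_real k * symD hx hy z w)"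
      unfolding sd using d0 by (simp add: algebra_simps)
    finally show ?thesis unfolding 1 gcoef_def wt_def d_def[symmetric] by (simp add: algebra_simps)
  qed (simp_all add: pcoef_def num_def ncoef_def sq gcoef_def wt_def d_def[symmetric] s_def[symmetric] s rr power2_eq_square algebra_simps)
qed

definition mm :: real where "mm = \<bar>\<mu>x\<bar> + \<bar>\<mu>y\<bar> + 2"
text \<open>The number 80 = 4 * 20 is the product of the constants of \<open>regular_mult\<close>
  and \<open>regular_inverse\<close>. The exponent 16 is the square of a fourth power for the
  inverse denominator, times an eighth power for the quadratic terms of the numerator.\<close>

definition C0 :: real where "C0 = 80 * (1 + T * mm)\<^sup>2 * (4 + mm) * K^16"

lemma C0_ge_1: "1 \<le> C0"
proof -
  have "1 \<le> (1 + T * mm)\<^sup>2" using T by (intro one_le_power) (simp add: mm_def)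
  moreover have "1 \<le> K^16" using K1 by (rule one_le_power)
  moreover have "1 \<le> 4 + mm" by (simp add: mm_def)
  ultimately have "1 * 1 * 1 * 1 \<le> 80 * (1 + T * mm)\<^sup>2 * (4 + mm) * K^16" by (intro mult_mono) auto
  then show ?thesis by (simp add: C0_def)
qed

text \<open>Sines, cosines, denominator and numerator are handled by the calculus of regular
  families. The growth in the frequency is crude but polynomial, which suffices against Gaussian
  decay.\<close>

lemma gcoef_regular:
  assumes h: "0 < hx" "2 * hx \<le> h0" "0 < hy" "2 * hy \<le> h0" and k: "0 < k" "k \<le> T"
    and z: "\<bar>Im z\<bar> \<le> tilt" and w: "\<bar>Im w\<bar> \<le> tilt" and i: "i < 6"
  shows "regular (hx\<^sup>2) (hy\<^sup>2) (C0 * (1 + \<bar>Re z\<bar> + \<bar>Re w\<bar>)^16)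
    (\<lambda>a b. gcoef k (msh hx (Re z) a) (msh hy (Re w) b) z w i)"
proof -
  define t where "t = 1 + \<bar>Re z\<bar> + \<bar>Re w\<bar>"
  define Q where "Q = K * t"
  have t: "1 \<le> t" "\<bar>Re z\<bar> + \<bar>Im z\<bar> \<le> t" "\<bar>Re w\<bar> + \<bar>Im w\<bar> \<le> t"
    using z w tilt_le1 by (auto simp: t_def)
  have Q: "1 \<le> Q" using mult_mono[OF K1 t(1)] K1 by (simp add: Q_def)
  have Q4: "1 \<le> Q^4" using Q by (rule one_le_power)
  have mm: "2 \<le> mm" by (simp add: mm_def)
  have e: "0 < hx\<^sup>2" "0 < hy\<^sup>2" using h by auto
  note reg = regular_mono[OF e] regular_add[OF e] regular_mult[OF e] regular_cmult[OF e] regular_inverse[OF e]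
  have z1: "\<bar>Im z\<bar> \<le> 1" "\<bar>Im w\<bar> \<le> 1" using z w tilt_le1 by auto
  define Sx Cx Sy Cy where "Sx a b = dsin (msh hx (Re z) a) z" and "Cx a b = dcos (msh hx (Re z) a) z"
    and "Sy a b = dsin (msh hy (Re w) b) w" and "Cy a b = dcos (msh hy (Re w) b) w" for a b :: bool
  have Sx: "regular (hx\<^sup>2) (hy\<^sup>2) (Q^4) Sx" and Cx: "regular (hx\<^sup>2) (hy\<^sup>2) (Q^4) Cx"
    unfolding Sx_def[abs_def] Cx_def[abs_def] Q_def using dsin_msh[OF h(1,2) z1(1) t(1,2)]
    by (auto intro!: regular_x[OF e])
  have Sy: "regular (hx\<^sup>2) (hy\<^sup>2) (Q^4) Sy" and Cy: "regular (hx\<^sup>2) (hy\<^sup>2) (Q^4) Cy"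
    unfolding Sy_def[abs_def] Cy_def[abs_def] Q_def using dsin_msh[OF h(3,4) z1(2) t(1,3)]
    by (auto intro!: regular_y[OF e])
  define D where "D a b = symD (msh hx (Re z) a) (msh hy (Re w) b) z w" for a b
  have D: "regular (hx\<^sup>2) (hy\<^sup>2) (mm * Q^4) D"
  proof -
    have "regular (hx\<^sup>2) (hy\<^sup>2) (\<bar>\<mu>x\<bar> * Q^4 + \<bar>\<mu>y\<bar> * Q^4 + Q^4 + Q^4)
       (\<lambda>a b. \<i> * of_real \<mu>x * Sx a b + \<i> * of_real \<mu>y * Sy a b + Cx a b + Cy a b)"
      by (intro reg(2,4) Sx Cx Sy Cy) (simp_all add: norm_mult)
    then show ?thesis by (simp add: D_def[abs_def] symD_def Sx_def Sy_def Cx_def Cy_def mm_def algebra_simps)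
  qed
  define G1 where "G1 = (1 + T * mm) * Q^4"
  have kT: "k * (mm * Q^4) \<le> T * (mm * Q^4)" using k mm Q by (intro mult_right_mono) auto
  have G1: "1 \<le> G1" using T mm mult_mono[of 1 "1 + T * mm" 1 "Q^4"] Q4 by (simp add: G1_def)
  have "regular (hx\<^sup>2) (hy\<^sup>2) (Q^4 + k * (mm * Q^4)) (\<lambda>a b. 1 + of_real k * D a b)"
    using Q4 k by (intro reg(2,4) D regular_const[OF e]) auto
  then have den: "regular (hx\<^sup>2) (hy\<^sup>2) G1 (\<lambda>a b. den k (msh hx (Re z) a) (msh hy (Re w) b) z w)"
    unfolding den_def D_def[symmetric] by (rule reg(1)) (use kT in \<open>simp add: G1_def algebra_simps\<close>)
  have m: "0 < msh hx x a" "msh hx x a \<le> h0" "0 < msh hy x a" "msh hy x a \<le> h0" for x a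
    using h by (auto simp: msh_def coarse_def)
  have R: "regular (hx\<^sup>2) (hy\<^sup>2) (20 * G1\<^sup>2) (\<lambda>a b. inverse (den k (msh hx (Re z) a) (msh hy (Re w) b) z w))"
    using m k z w by (intro reg(5) den G1 den_nonzero) auto
  have r1: "sqrt \<rho>x \<le> 1" "sqrt \<rho>y \<le> 1" "0 \<le> sqrt \<rho>x" "0 \<le> sqrt \<rho>y" using rx ry by auto
  have r2: "sqrt \<rho>x * sqrt \<rho>y \<le> 1" using r1 by (intro mult_le_one) auto
  have r3: "\<bar>\<rho> * sqrt \<rho>x * sqrt \<rho>y\<bar> \<le> 1"
    unfolding abs_mult using rho r1 by (intro mult_le_one) auto
  define E where "E = (4 + mm) * Q^8"
  have Q8: "Q^4 \<le> Q^8" "Q^4 * Q^4 = Q^8" using Q by (auto simp flip: power_add intro: power_increasing)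
  have Q80: "0 \<le> Q^8" using Q by simp
  have E1: "1 * (4 * (Q^4 * Q^4)) + 1 * (mm * Q^4) \<le> E" "1 * Q^4 \<le> E" "1 * (4 * (Q^4 * Q^4)) \<le> E"
  proof -
    have "mm * Q^4 \<le> mm * Q^8" "0 \<le> mm * Q^8" using mm Q8 Q80 by (auto intro: mult_left_mono)
    then show "1 * (4 * (Q^4 * Q^4)) + 1 * (mm * Q^4) \<le> E" "1 * Q^4 \<le> E" "1 * (4 * (Q^4 * Q^4)) \<le> E"
      using Q8 Q80 by ((simp add: E_def distrib_right; linarith)+)
  qed
  have fin: "4 * (20 * G1\<^sup>2 * E) = C0 * t^16"
  proof -
    have "4 * (20 * G1\<^sup>2 * E) = 80 * (1 + T * mm)\<^sup>2 * (4 + mm) * (Q^4 * Q^4 * Q^8)"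
      unfolding E_def G1_def power_mult_distrib by (simp add: power2_eq_square mult_ac)
    also have "Q^4 * Q^4 * Q^8 = K^16 * t^16" by (simp add: Q_def flip: power_add power_mult_distrib)
    finally show ?thesis by (simp add: C0_def mult_ac)
  qed
  have "regular (hx\<^sup>2) (hy\<^sup>2) E (\<lambda>a b. [of_real (- (\<rho> * sqrt \<rho>x * sqrt \<rho>y)) * (Sx a b * Sy a b) + (- 1) * D a b,
      (- \<i> * of_real (sqrt \<rho>x)) * Sx a b, (- \<i> * of_real (sqrt \<rho>y)) * Sy a b,
      of_real (- (\<rho>x / 2)) * (Sx a b * Sx a b), of_real (- (\<rho>y / 2)) * (Sy a b * Sy a b),
      of_real (- (sqrt \<rho>x * sqrt \<rho>y)) * (Sx a b * Sy a b)] ! i)"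
  proof -
    have n: "norm (complex_of_real (- (\<rho> * sqrt \<rho>x * sqrt \<rho>y))) \<le> 1" "norm (- 1 :: complex) \<le> 1" "norm (- \<i> * of_real (sqrt \<rho>x)) \<le> 1"
       "norm (- \<i> * of_real (sqrt \<rho>y)) \<le> 1" "norm (complex_of_real (- (\<rho>x / 2))) \<le> 1" "norm (complex_of_real (- (\<rho>y / 2))) \<le> 1"
       "norm (complex_of_real (- (sqrt \<rho>x * sqrt \<rho>y))) \<le> 1"
      using r1 r2 r3 rx ry by (simp_all only: norm_of_real norm_mult abs_minus_cancel) (simp_all add: abs_mult)
    consider "i = 0" | "i = 1" | "i = 2" | "i = 3" | "i = 4" | "i = 5" using i by linarith
    then show ?thesis
    proof cases
      case 1 show ?thesis unfolding 1 nth_Cons_0 by (rule reg(1)[OF _ E1(1)]) (intro reg(2,3,4) Sx Sy D n)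
    next
      case 2
      have "regular (hx\<^sup>2) (hy\<^sup>2) E (\<lambda>a b. (- \<i> * of_real (sqrt \<rho>x)) * Sx a b)" by (rule reg(1)[OF _ E1(2)]) (intro reg(4) Sx n)
      then show ?thesis by (simp add: 2)
    next
      case 3
      have "regular (hx\<^sup>2) (hy\<^sup>2) E (\<lambda>a b. (- \<i> * of_real (sqrt \<rho>y)) * Sy a b)" by (rule reg(1)[OF _ E1(2)]) (intro reg(4) Sy n)
      then show ?thesis by (simp add: 3)
    next
      case 4
      have "regular (hx\<^sup>2) (hy\<^sup>2) E (\<lambda>a b. of_real (- (\<rho>x / 2)) * (Sx a b * Sx a b))" by (rule reg(1)[OF _ E1(3)]) (intro reg(3,4) Sx n)
      then show ?thesis by (simp add: 4)
    next
      case 5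
      have "regular (hx\<^sup>2) (hy\<^sup>2) E (\<lambda>a b. of_real (- (\<rho>y / 2)) * (Sy a b * Sy a b))" by (rule reg(1)[OF _ E1(3)]) (intro reg(3,4) Sy n)
      then show ?thesis by (simp add: 5)
    next
      case 6
      have "regular (hx\<^sup>2) (hy\<^sup>2) E (\<lambda>a b. of_real (- (sqrt \<rho>x * sqrt \<rho>y)) * (Sx a b * Sy a b))" by (rule reg(1)[OF _ E1(3)]) (intro reg(3,4) Sx Sy n)
      then show ?thesis by (simp add: 6)
    qed
  qed
  from reg(3)[OF R this] show ?thesis
    unfolding fin t_def[symmetric] gcoef_def Sx_def Sy_def D_def by simp
qed

end

section \<open>The mixed difference of the Fourier modes\<close>

text \<open>With s = x^2 + y^2 the polynomial is at most (3 (1 + s))^n, and (a (1 + s) / n)^n <= (1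
  + a (1 + s) / n)^n <= exp (a (1 + s)).\<close>

lemma power_mult_exp_bounded:
  fixes a :: real assumes "a > 0"
  obtains C where "C > 0" "\<And>x y. (1 + \<bar>x\<bar> + \<bar>y\<bar>) ^ (2 * n) * exp (- (2 * a) * (x\<^sup>2 + y\<^sup>2)) \<le> C * exp (- a * (x\<^sup>2 + y\<^sup>2))"
proof (cases "n = 0")
  case True
  show ?thesis by (rule that[of 1]) (use assms True in \<open>auto simp: mult_right_mono\<close>)
next
  case False
  show ?thesis
  proof (rule that[of "(3 * real n / a) ^ n * exp a"])
    show "0 < (3 * real n / a) ^ n * exp a" using assms False by simp
    fix x y :: real
    define s where "s = x\<^sup>2 + y\<^sup>2"
    have s: "0 \<le> s" by (simp add: s_def)
    have "(1 + \<bar>x\<bar> + \<bar>y\<bar>)\<^sup>2 \<le> 3 * (1 + s)"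
      using sum_squares_bound[of 1 "\<bar>x\<bar>"] sum_squares_bound[of 1 "\<bar>y\<bar>"] sum_squares_bound[of "\<bar>x\<bar>" "\<bar>y\<bar>"]
      by (simp add: s_def power2_eq_square algebra_simps)
    then have "((1 + \<bar>x\<bar> + \<bar>y\<bar>)\<^sup>2) ^ n \<le> (3 * (1 + s)) ^ n" by (intro power_mono) auto
    also have "\<dots> = (3 * real n / a) ^ n * (a * (1 + s) / real n) ^ n"
      using assms False by (simp flip: power_mult_distrib)
    also have "(a * (1 + s) / real n) ^ n \<le> (1 + a * (1 + s) / real n) ^ n"
      using assms s by (intro power_mono) auto
    also have "\<dots> \<le> exp (a * (1 + s))"
    proof (rule exp_ge_one_plus_x_over_n_power_n)
      have "0 \<le> a * (1 + s)" using assms s by auto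
      then show "- real n \<le> a * (1 + s)" by linarith
    qed (use False in auto)
    finally have "(1 + \<bar>x\<bar> + \<bar>y\<bar>) ^ (2 * n) \<le> (3 * real n / a) ^ n * exp (a * (1 + s))"
      using assms by (simp add: power_mult mult_left_mono)
    then have "(1 + \<bar>x\<bar> + \<bar>y\<bar>) ^ (2 * n) * exp (- (2 * a) * s) \<le> (3 * real n / a) ^ n * exp (a * (1 + s)) * exp (- (2 * a) * s)"
      by (rule mult_right_mono) auto
    also have "\<dots> = (3 * real n / a) ^ n * exp a * exp (- a * s)"
      by (simp add: mult.assoc algebra_simps flip: exp_add)
    finally show "(1 + \<bar>x\<bar> + \<bar>y\<bar>) ^ (2 * n) * exp (- (2 * a) * (x\<^sup>2 + y\<^sup>2)) \<le> (3 * real n / a) ^ n * exp a * exp (- a * (x\<^sup>2 + y\<^sup>2))"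
      unfolding s_def .
  qed
qed

lemma corner_norm_regular_le:
  assumes u: "0 < u1" "0 < u2" and G: "1 \<le> G" and X: "regular u1 u2 H X"
  shows "corner_norm (u1 * G) (u2 * G) X \<le> 4 * H\<^sup>2"
proof -
  have H: "0 \<le> H" using regular_nonneg[OF u X] .
  have d: "(norm (x / complex_of_real e))\<^sup>2 \<le> H\<^sup>2" if "norm x \<le> H * v" "0 < v" "v \<le> e" for x v e
  proof -
    have "norm x \<le> H * e" using that H by (meson mult_left_mono order_trans)
    then have "norm (x / of_real e) \<le> H" using that by (simp add: norm_divide divide_le_eq)
    then show ?thesis by (intro power_mono) auto
  qed
  have G2: "1 \<le> G * G" using mult_mono[OF G G] G by simp
  have "u1 \<le> u1 * G" "u2 \<le> u2 * G" "u1 * u2 \<le> (u1 * G) * (u2 * G)"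
    using u G G2 mult_left_mono[OF G2, of "u1 * u2"] by (auto simp: mult_ac mult_le_cancel_left1)
  note e = this
  have X': "norm (X False False) \<le> H" "norm (X True False - X False False) \<le> H * u1" "norm (X False True - X False False) \<le> H * u2"
    "norm (X True True - X True False - X False True + X False False) \<le> H * (u1 * u2)"
    using X unfolding regular_def by auto
  have "corner_norm (u1 * G) (u2 * G) X \<le> H\<^sup>2 + H\<^sup>2 + H\<^sup>2 + H\<^sup>2"
    unfolding corner_norm_def
    by (intro add_mono d[OF X'(2) _ e(1)] d[OF X'(3) _ e(2)] d[OF X'(4) _ e(3)] power_mono X' u mult_pos_pos) auto
  then show ?thesis by simp
qed

context milstein_spde
begin

text \<open>The square of the regularity constant of \<open>gcoef\<close>: the frequency weight G^2
  in the units of the one-step estimate.\<close>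

definition wgt :: "complex \<Rightarrow> complex \<Rightarrow> real" where
  "wgt z w = (C0 * (1 + \<bar>Re z\<bar> + \<bar>Re w\<bar>) ^ 16)\<^sup>2"

text \<open>The frequency is only required to fit the fine mesh; the bounds by h0 on the doubled
  meshes keep the coarse meshes within the range where \<open>K\<close> controls the hyperbolic
  factors.\<close>

definition resolved :: "real \<Rightarrow> nat \<Rightarrow> real \<Rightarrow> real \<Rightarrow> real \<Rightarrow> real \<Rightarrow> bool" where
  "resolved k N hx hy \<xi> \<eta> \<longleftrightarrow> 0 < hx \<and> 2 * hx \<le> h0 \<and> 0 < hy \<and> 2 * hy \<le> h0 \<and> 0 < k \<and> 0 < N \<and> real N * k = T
     \<and> k \<le> Lam * hx\<^sup>2 \<and> k \<le> Lam * hy\<^sup>2 \<and> \<bar>\<xi>\<bar> * hx \<le> pi \<and> \<bar>\<eta>\<bar> * hy \<le> pi"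

definition start :: "real \<Rightarrow> complex \<Rightarrow> bool \<Rightarrow> complex" where
  "start h z a = (if a \<and> \<not> \<bar>Re z\<bar> * (2 * h) \<le> pi then 0 else kern (msh h (Re z) a) z)"

definition corner :: "real \<Rightarrow> real \<Rightarrow> real \<Rightarrow> real \<Rightarrow> real \<Rightarrow> nat \<Rightarrow> (nat \<Rightarrow> real \<times> real) \<Rightarrow> complex \<Rightarrow> complex \<Rightarrow> bool \<Rightarrow> bool \<Rightarrow> complex" where
  "corner x0 y0 k hx hy N Z z w a b = exp (- \<i> * (z * of_real x0 + w * of_real y0)) * (start hx z a * start hy w b)
     * (\<Prod>n<N. chaos \<rho> (pcoef k (msh hx (Re z) a) (msh hy (Re w) b) z w) (Z n))"

definition mixed :: "real \<Rightarrow> real \<Rightarrow> real \<Rightarrow> real \<Rightarrow> real \<Rightarrow> nat \<Rightarrow> (nat \<Rightarrow> real \<times> real) \<Rightarrow> complex \<Rightarrow> complex \<Rightarrow> complex" where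
  "mixed x0 y0 k hx hy N Z z w = corner x0 y0 k hx hy N Z z w True True - corner x0 y0 k hx hy N Z z w True False
     - corner x0 y0 k hx hy N Z z w False True + corner x0 y0 k hx hy N Z z w False False"

text \<open>Discrete Gronwall: the one-step factor is at most exp (k (const - c |(xi, eta)|^2)) by 1
  + x <= exp x, and N factors multiply to the time T because N k = T.\<close>

lemma nn_integral_corner_le:
  assumes BM: "correlated_BM M \<rho> W"
  obtains c A where "0 < c"
    "\<And>hx hy k N z w X. \<lbrakk>resolved k N hx hy (Re z) (Re w); \<bar>Im z\<bar> \<le> tilt; \<bar>Im w\<bar> \<le> tilt\<rbrakk> \<Longrightarrow>
       (\<integral>\<^sup>+\<omega>. ennreal (corner_norm (hx\<^sup>2 * wgt z w) (hy\<^sup>2 * wgt z w)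
          (\<lambda>a b. X a b * (\<Prod>n<N. chaos \<rho> (pcoef k (msh hx (Re z) a) (msh hy (Re w) b) z w) (incr W k \<omega> n)))) \<partial>M)
       \<le> ennreal (exp (A - c * ((Re z)\<^sup>2 + (Re w)\<^sup>2)) * corner_norm (hx\<^sup>2 * wgt z w) (hy\<^sup>2 * wgt z w) X)"
proof -
  obtain c B where c: "0 < c" and "0 \<le> B" and q:
    "\<And>k hx hy z w. admissible k hx hy z w \<Longrightarrow>
       mom2 \<rho> (pcoef k hx hy z w) \<le> 1 + k * (B - c * ((Re z)\<^sup>2 + (Re w)\<^sup>2))"
    using mom2_pcoef_le by blast
  show ?thesis
  proof (rule that[of "c * T" "(B + (2600 + 3900 * T)) * T"])
    show "0 < c * T" using c T by simp
    fix hx hy k N z w X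
    assume "resolved k N hx hy (Re z) (Re w)" and z: "\<bar>Im z\<bar> \<le> tilt" and w: "\<bar>Im w\<bar> \<le> tilt"
    then have h: "0 < hx" "2 * hx \<le> h0" "0 < hy" "2 * hy \<le> h0" and k: "0 < k" and N: "0 < N" "real N * k = T"
      and kh: "k \<le> Lam * hx\<^sup>2" "k \<le> Lam * hy\<^sup>2" and bz: "\<bar>Re z\<bar> * hx \<le> pi" and bw: "\<bar>Re w\<bar> * hy \<le> pi"
      by (simp_all add: resolved_def)
    define t where "t = 1 + \<bar>Re z\<bar> + \<bar>Re w\<bar>"
    define G where "G = C0 * t ^ 16"
    have t: "1 \<le> t" by (simp add: t_def)
    have G: "1 \<le> G" using mult_mono[OF C0_ge_1 one_le_power[OF t, of 16]] C0_ge_1 by (simp add: G_def)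
    have kT: "k \<le> T" using N k mult_right_mono[of 1 "real N" k] by simp
    define p where "p a b = pcoef k (msh hx (Re z) a) (msh hy (Re w) b) z w" for a b
    define q where "q = 1 + k * (B - c * ((Re z)\<^sup>2 + (Re w)\<^sup>2))"
    note mx = msh_simps[OF h(1,2) bz] and my = msh_simps[OF h(3,4) bw]
    have km: "k \<le> Lam * (msh h x a)\<^sup>2" if "0 < h" "k \<le> Lam * h\<^sup>2" "h \<le> msh h x a" for h x a
      using that Lam by (meson less_imp_le mult_left_mono order_trans power_mono)
    have pq: "mom2 \<rho> (p a b) \<le> q" for a b
      unfolding p_def q_def using mx my km h bz bw kh k kT z w by (intro q) (auto simp: admissible_def)
    define Q where "Q = q + (2600 + 3900 * T) * k"
    define n where "n = corner_norm (hx\<^sup>2 * G\<^sup>2) (hy\<^sup>2 * G\<^sup>2)"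
    have "0 \<le> q" using pq[of True True] mom2_nonneg order_trans by blast
    then have Q0: "0 \<le> Q" using T k by (simp add: Q_def)
    have step: "(\<integral>\<^sup>+z. ennreal (n (\<lambda>a b. chaos \<rho> (p a b) z * X a b)) \<partial>std_binormal \<rho>) \<le> ennreal (Q * n X)" for X
      unfolding n_def Q_def
    proof (rule nn_integral_corner_step[OF rho k kT G])
      fix a b i assume i: "i < (6::nat)"
      have "den k (msh hx (Re z) a) (msh hy (Re w) b) z w \<noteq> 0"
        using mx my k kT z w by (intro den_nonzero) auto
      then show "p a b i = (if i = 0 then 1 else 0) + of_real (wt k i) * gcoef k (msh hx (Re z) a) (msh hy (Re w) b) z w i"
        unfolding p_def using k i by (intro pcoef_eq_gcoef)
    next
      fix i assume i: "i < (6::nat)"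
      show "regular (hx\<^sup>2) (hy\<^sup>2) G (\<lambda>a b. gcoef k (msh hx (Re z) a) (msh hy (Re w) b) z w i)"
        unfolding G_def t_def by (rule gcoef_regular[OF h k kT z w i])
    qed (use h pq in auto)
    define F where "F zs = ennreal (n (\<lambda>a b. X a b * (\<Prod>m<N. chaos \<rho> (p a b) (zs m))))" for zs
    have Fm: "F \<in> borel_measurable (PiM {..<N} (\<lambda>_. borel))"
    proof -
      have [measurable]: "(\<lambda>zs. \<Prod>m<N. chaos \<rho> (p a b) (zs m)) \<in> borel_measurable (PiM {..<N} (\<lambda>_. borel))" for a b
        by (intro borel_measurable_prod measurable_compose[OF _ borel_measurable_chaos] measurable_component_singleton) auto
      show ?thesis unfolding F_def[abs_def] n_def corner_norm_def by measurable
    qed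
    have "(\<integral>\<^sup>+\<omega>. ennreal (n (\<lambda>a b. X a b * (\<Prod>m<N. chaos \<rho> (p a b) (incr W k \<omega> m)))) \<partial>M)
      = (\<integral>\<^sup>+\<omega>. F (\<lambda>m\<in>{..<N}. (incr W k \<omega> m)) \<partial>M)"
      unfolding F_def by (intro nn_integral_cong arg_cong[where f = ennreal] arg_cong[where f = n] ext arg_cong2[where f = "(*)"] refl prod.cong) auto
    also have "\<dots> = (\<integral>\<^sup>+zs. F zs \<partial>(PiM {..<N} (\<lambda>_. std_binormal \<rho>)))" by (rule nn_integral_increments[OF BM k N(1) Fm])
    also have "\<dots> \<le> ennreal (Q ^ N * n X)" unfolding F_def n_def by (rule nn_integral_corner_iterate[OF step[unfolded n_def] Q0])
    also have "\<dots> \<le> ennreal (exp ((B + (2600 + 3900 * T)) * T - c * T * ((Re z)\<^sup>2 + (Re w)\<^sup>2)) * n X)"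
    proof (intro ennreal_leI mult_right_mono)
      have "Q \<le> exp (k * (B + (2600 + 3900 * T) - c * ((Re z)\<^sup>2 + (Re w)\<^sup>2)))"
        using exp_ge_add_one_self[of "k * (B + (2600 + 3900 * T) - c * ((Re z)\<^sup>2 + (Re w)\<^sup>2))"]
        by (simp add: Q_def q_def algebra_simps)
      then have "Q ^ N \<le> exp (k * (B + (2600 + 3900 * T) - c * ((Re z)\<^sup>2 + (Re w)\<^sup>2))) ^ N" using Q0 by (intro power_mono)
      also have "\<dots> = exp (real N * k * (B + (2600 + 3900 * T) - c * ((Re z)\<^sup>2 + (Re w)\<^sup>2)))"
        by (simp add: exp_of_nat_mult mult.assoc)
      finally show "Q ^ N \<le> exp ((B + (2600 + 3900 * T)) * T - c * T * ((Re z)\<^sup>2 + (Re w)\<^sup>2))"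
        unfolding N(2) by (simp add: algebra_simps)
    qed (simp add: n_def corner_norm_nonneg)
    finally show "(\<integral>\<^sup>+\<omega>. ennreal (corner_norm (hx\<^sup>2 * wgt z w) (hy\<^sup>2 * wgt z w)
          (\<lambda>a b. X a b * (\<Prod>n<N. chaos \<rho> (pcoef k (msh hx (Re z) a) (msh hy (Re w) b) z w) (incr W k \<omega> n)))) \<partial>M)
       \<le> ennreal (exp ((B + (2600 + 3900 * T)) * T - c * T * ((Re z)\<^sup>2 + (Re w)\<^sup>2)) * corner_norm (hx\<^sup>2 * wgt z w) (hy\<^sup>2 * wgt z w) X)"
      unfolding n_def G_def t_def p_def wgt_def .
  qed
qed

lemma start_bounds:
  assumes h: "0 < h" "2 * h \<le> h0" and bz: "\<bar>Re z\<bar> * h \<le> pi" and z: "0 < Im z" "Im z \<le> 1" and t: "1 \<le> t" "\<bar>Re z\<bar> + \<bar>Im z\<bar> \<le> t"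
  shows "norm (start h z a) \<le> ((1 + Im z * h0) / Im z + K) * t\<^sup>2"
    "norm (start h z True - start h z False) \<le> ((1 + Im z * h0) / Im z + K) * t\<^sup>2 * h\<^sup>2"
proof -
  define A where "A = (1 + Im z * h0) / Im z"
  have A: "0 \<le> A" using z h0 by (simp add: A_def)
  have t2: "1 \<le> t\<^sup>2" "t \<le> t\<^sup>2" using t by (auto simp: power2_eq_square mult_le_cancel_left1 intro: order_trans)
  have kb: "norm (kern h' z) \<le> A" if "0 < h'" "h' \<le> h0" for h' unfolding A_def by (rule norm_kern_le[OF that z(1)])
  have At: "A \<le> (A + K) * t\<^sup>2" using mult_mono[of A "A + K" 1 "t\<^sup>2"] A K1 t2 by simp
  have "norm (start h z a) \<le> A"
    unfolding start_def using msh_simps[OF h bz, of a] A by (auto intro: kb)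
  then show "norm (start h z a) \<le> ((1 + Im z * h0) / Im z + K) * t\<^sup>2" using At unfolding A_def by linarith
  show "norm (start h z True - start h z False) \<le> ((1 + Im z * h0) / Im z + K) * t\<^sup>2 * h\<^sup>2"
    unfolding A_def[symmetric]
  proof (cases "\<bar>Re z\<bar> * (2 * h) \<le> pi")
    case True
    have "norm (start h z True - start h z False) = norm (kern h z - kern (2 * h) z)"
      using True by (simp add: start_def msh_def coarse_def norm_minus_commute)
    also have "\<dots> \<le> h\<^sup>2 * (K * (\<bar>Re z\<bar> + \<bar>Im z\<bar>))"
      using h z True by (intro norm_kern_diff cosh_le_K) auto
    also have "\<dots> \<le> h\<^sup>2 * ((A + K) * t\<^sup>2)" using A K1 t t2 by (intro mult_left_mono mult_mono) auto
    finally show "norm (start h z True - start h z False) \<le> (A + K) * t\<^sup>2 * h\<^sup>2" by (simp add: mult.commute)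
  next
    case False
    \<comment> \<open>Excess frequencies satisfy |Re z| h > pi/2 > 1, so a jump that is merely
      bounded counts as O(h^2) at the price of |Re z|^2.\<close>
    have "1 \<le> (\<bar>Re z\<bar> * h)\<^sup>2" using False pi_gt3 by (intro one_le_power) linarith
    also have "\<dots> = \<bar>Re z\<bar>\<^sup>2 * h\<^sup>2" by (rule power_mult_distrib)
    also have "\<dots> \<le> t\<^sup>2 * h\<^sup>2" using t by (intro mult_right_mono power_mono) auto
    finally have "A * 1 \<le> (A + K) * (t\<^sup>2 * h\<^sup>2)" using A K1 by (intro mult_mono) auto
    moreover have "norm (start h z True - start h z False) \<le> A"
      using False kb[of h] h by (simp add: start_def msh_def)
    ultimately show "norm (start h z True - start h z False) \<le> (A + K) * t\<^sup>2 * h\<^sup>2" by simp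
  qed
qed

text \<open>The contour height tilt / 2 is positive, as the kernels demand, and inside the strip, as
  the amplification factors demand. The initial data are regular of order h^2 by
  \<open>start_bounds\<close>; propagating them and undoing the scaling yields the fourth powers of
  the meshes, while half of the Gaussian exponent pays for all polynomial weights.\<close>

lemma mixed_second_moment:
  assumes BM: "correlated_BM M \<rho> W"
  obtains C c where "0 \<le> C" "0 < c"
    "\<And>hx hy k N \<xi> \<eta>. resolved k N hx hy \<xi> \<eta> \<Longrightarrow>
       (\<integral>\<^sup>+\<omega>. ennreal ((norm (mixed x0 y0 k hx hy N (incr W k \<omega>) (Complex \<xi> (tilt / 2)) (Complex \<eta> (tilt / 2))))\<^sup>2) \<partial>M)
       \<le> ennreal (C * hx^4 * hy^4 * exp (- c * (\<xi>\<^sup>2 + \<eta>\<^sup>2)))"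
proof -
  obtain c A where c: "0 < c" and main:
    "\<And>hx hy k N z w X. \<lbrakk>resolved k N hx hy (Re z) (Re w); \<bar>Im z\<bar> \<le> tilt; \<bar>Im w\<bar> \<le> tilt\<rbrakk> \<Longrightarrow>
       (\<integral>\<^sup>+\<omega>. ennreal (corner_norm (hx\<^sup>2 * wgt z w) (hy\<^sup>2 * wgt z w)
          (\<lambda>a b. X a b * (\<Prod>n<N. chaos \<rho> (pcoef k (msh hx (Re z) a) (msh hy (Re w) b) z w) (incr W k \<omega> n)))) \<partial>M)
       \<le> ennreal (exp (A - c * ((Re z)\<^sup>2 + (Re w)\<^sup>2)) * corner_norm (hx\<^sup>2 * wgt z w) (hy\<^sup>2 * wgt z w) X)"
    using nn_integral_corner_le[OF BM] by blast
  \<comment> \<open>The power to be absorbed is 136 = 2 * 68: undoing the scaling gives L^4, which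
    contains t^128, and the initial data contribute t^8.\<close>
  obtain D where D: "0 < D" "\<And>x y. (1 + \<bar>x\<bar> + \<bar>y\<bar>) ^ (2 * 68) * exp (- (2 * (c / 2)) * (x\<^sup>2 + y\<^sup>2)) \<le> D * exp (- (c / 2) * (x\<^sup>2 + y\<^sup>2))"
    using power_mult_exp_bounded[of "c / 2" 68] c by auto
  define S where "S = (1 + tilt / 2 * h0) / (tilt / 2) + K"
  define ph where "ph = exp (tilt / 2 * (\<bar>x0\<bar> + \<bar>y0\<bar>))"
  define C where "C = C0^8 * exp A * (4 * (ph * (4 * (S * S)))\<^sup>2) * D"
  have S: "0 \<le> S" using tilt_pos h0 K1 by (simp add: S_def)
  have ph: "0 \<le> ph" by (simp add: ph_def)
  have C: "0 \<le> C" using C0_ge_1 D by (simp add: C_def)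
  show ?thesis
  proof (rule that[OF C half_gt_zero[OF c]])
    fix hx hy k N \<xi> \<eta>
    assume res: "resolved k N hx hy \<xi> \<eta>"
    then have h: "0 < hx" "2 * hx \<le> h0" "0 < hy" "2 * hy \<le> h0" and k: "0 < k" and bx: "\<bar>\<xi>\<bar> * hx \<le> pi" and be: "\<bar>\<eta>\<bar> * hy \<le> pi"
      by (simp_all add: resolved_def)
    define z w where "z = Complex \<xi> (tilt / 2)" and "w = Complex \<eta> (tilt / 2)"
    define t where "t = 1 + \<bar>\<xi>\<bar> + \<bar>\<eta>\<bar>"
    define L where "L = (C0 * t ^ 16)\<^sup>2"
    have t: "1 \<le> t" by (simp add: t_def)
    have "1 \<le> C0 * t ^ 16" using mult_mono[OF C0_ge_1 one_le_power[OF t, of 16]] C0_ge_1 by simp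
    then have L: "1 \<le> L" unfolding L_def by (rule one_le_power)
    define X where "X a b = exp (- \<i> * (z * of_real x0 + w * of_real y0)) * (start hx z a * start hy w b)" for a b
    define n where "n = corner_norm (hx\<^sup>2 * L) (hy\<^sup>2 * L)"
    have zw: "Re z = \<xi>" "Re w = \<eta>" "Im z = tilt / 2" "Im w = tilt / 2" by (simp_all add: z_def w_def)
    have tl: "0 < Im z" "Im z \<le> 1" "0 < Im w" "Im w \<le> 1" "\<bar>Im z\<bar> \<le> tilt" "\<bar>Im w\<bar> \<le> tilt" using tilt_pos tilt_le1 by (auto simp: zw)
    have tt: "\<bar>Re z\<bar> + \<bar>Im z\<bar> \<le> t" "\<bar>Re w\<bar> + \<bar>Im w\<bar> \<le> t" using tl by (auto simp: zw t_def)
    have hh: "0 < hx\<^sup>2" "0 < hy\<^sup>2" using h by auto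
    have "regular (hx\<^sup>2) (hy\<^sup>2) (S * t\<^sup>2) (\<lambda>a b. start hx z a)"
      using start_bounds[OF h(1,2) bx[folded zw] tl(1,2) t tt(1)] unfolding S_def zw by (intro regular_x[OF hh])
    moreover have "regular (hx\<^sup>2) (hy\<^sup>2) (S * t\<^sup>2) (\<lambda>a b. start hy w b)"
      using start_bounds[OF h(3,4) be[folded zw] tl(3,4) t tt(2)] unfolding S_def zw by (intro regular_y[OF hh])
    ultimately have "regular (hx\<^sup>2) (hy\<^sup>2) (4 * ((S * t\<^sup>2) * (S * t\<^sup>2))) (\<lambda>a b. start hx z a * start hy w b)"
      by (rule regular_mult[OF hh])
    moreover have "norm (exp (- \<i> * (z * of_real x0 + w * of_real y0))) \<le> ph"
    proof -
      have "x0 \<le> \<bar>x0\<bar>" "y0 \<le> \<bar>y0\<bar>" by auto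
      then have "tilt / 2 * x0 + tilt / 2 * y0 \<le> tilt / 2 * (\<bar>x0\<bar> + \<bar>y0\<bar>)"
        using tilt_pos by (simp flip: distrib_left add: mult_left_mono)
      then show ?thesis by (simp add: ph_def zw)
    qed
    ultimately have "regular (hx\<^sup>2) (hy\<^sup>2) (ph * (4 * ((S * t\<^sup>2) * (S * t\<^sup>2)))) X"
      unfolding X_def[abs_def] by (rule regular_cmult[OF hh])
    then have nX: "n X \<le> 4 * (ph * (4 * ((S * t\<^sup>2) * (S * t\<^sup>2))))\<^sup>2"
      unfolding n_def by (intro corner_norm_regular_le hh L)
    also have "\<dots> = 4 * (ph * (4 * (S * S)))\<^sup>2 * t^8"
    proof -
      have "(S * t\<^sup>2) * (S * t\<^sup>2) = S * S * t^4" by (simp add: mult_ac flip: power_add)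
      then have *: "ph * (4 * ((S * t\<^sup>2) * (S * t\<^sup>2))) = (ph * (4 * (S * S))) * t^4" by (simp only: mult.assoc)
      show ?thesis unfolding * power_mult_distrib[of "ph * (4 * (S * S))" "t^4"] by (simp flip: power_mult)
    qed
    finally have nX: "n X \<le> 4 * (ph * (4 * (S * S)))\<^sup>2 * t^8" .
    define Y where "Y \<omega> a b = X a b * (\<Prod>n<N. chaos \<rho> (pcoef k (msh hx (Re z) a) (msh hy (Re w) b) z w) (incr W k \<omega> n))" for \<omega> a b
    have Y: "corner x0 y0 k hx hy N (incr W k \<omega>) z w a b = Y \<omega> a b" for \<omega> a b
      by (simp add: corner_def Y_def X_def)
    have L0: "0 < (hx\<^sup>2 * L) * (hy\<^sup>2 * L)" using hh L by (intro mult_pos_pos) auto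
    \<comment> \<open>The mixed difference is the fourth component of the vector times the product
      of both units hx^2 L and hy^2 L; squaring gives hx^4 hy^4 L^4.\<close>
    have mx: "(norm (mixed x0 y0 k hx hy N (incr W k \<omega>) z w))\<^sup>2 \<le> hx^4 * hy^4 * L^4 * n (Y \<omega>)" for \<omega>
    proof -
      define m where "m = mixed x0 y0 k hx hy N (incr W k \<omega>) z w"
      have "(norm (m / of_real ((hx\<^sup>2 * L) * (hy\<^sup>2 * L))))\<^sup>2 \<le> n (Y \<omega>)"
        unfolding n_def corner_norm_def m_def mixed_def Y by simp
      then have "(norm m)\<^sup>2 / ((hx\<^sup>2 * L) * (hy\<^sup>2 * L))\<^sup>2 \<le> n (Y \<omega>)"
        using L0 by (simp only: norm_divide norm_of_real power_divide power2_abs)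
      then have "(norm m)\<^sup>2 \<le> n (Y \<omega>) * ((hx\<^sup>2 * L) * (hy\<^sup>2 * L))\<^sup>2"
        using zero_less_power[OF L0, of 2] by (simp only: pos_divide_le_eq)
      also have "((hx\<^sup>2 * L) * (hy\<^sup>2 * L))\<^sup>2 = hx^4 * hy^4 * L^4"
      proof -
        have "((hx\<^sup>2 * L) * (hy\<^sup>2 * L))\<^sup>2 = (hx\<^sup>2)\<^sup>2 * (hy\<^sup>2)\<^sup>2 * (L\<^sup>2 * L\<^sup>2)" by (simp add: power_mult_distrib mult_ac)
        then show ?thesis by (simp flip: power_mult power_add)
      qed
      finally show ?thesis unfolding m_def by (simp add: mult_ac)
    qed
    have "(\<integral>\<^sup>+\<omega>. ennreal ((norm (mixed x0 y0 k hx hy N (incr W k \<omega>) z w))\<^sup>2) \<partial>M)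
      \<le> (\<integral>\<^sup>+\<omega>. ennreal (hx^4 * hy^4 * L^4) * ennreal (n (Y \<omega>)) \<partial>M)"
      using mx L by (intro nn_integral_mono) (simp add: n_def corner_norm_nonneg ennreal_leI flip: ennreal_mult)
    also have "\<dots> = ennreal (hx^4 * hy^4 * L^4) * (\<integral>\<^sup>+\<omega>. ennreal (n (Y \<omega>)) \<partial>M)"
    proof (rule nn_integral_cmult)
      have [measurable]: "(\<lambda>\<omega>. \<Prod>n<N. chaos \<rho> p (incr W k \<omega> n)) \<in> borel_measurable M" for p
        by (intro borel_measurable_prod measurable_compose[OF measurable_increment[OF BM k] borel_measurable_chaos])
      show "(\<lambda>\<omega>. ennreal (n (Y \<omega>))) \<in> borel_measurable M" unfolding n_def corner_norm_def Y_def by measurable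
    qed
    also have "\<dots> \<le> ennreal (hx^4 * hy^4 * L^4) * ennreal (exp (A - c * ((Re z)\<^sup>2 + (Re w)\<^sup>2)) * n X)"
      using main[OF res[folded zw(1,2)] tl(5,6), of X] unfolding n_def L_def Y_def t_def wgt_def zw[symmetric]
      by (intro mult_left_mono) auto
    also have "\<dots> \<le> ennreal (hx^4 * hy^4 * L^4) * ennreal (exp (A - c * (\<xi>\<^sup>2 + \<eta>\<^sup>2)) * (4 * (ph * (4 * (S * S)))\<^sup>2 * t^8))"
      unfolding zw by (intro mult_left_mono ennreal_leI nX) auto
    also have "\<dots> = ennreal (hx^4 * hy^4 * L^4 * (exp (A - c * (\<xi>\<^sup>2 + \<eta>\<^sup>2)) * (4 * (ph * (4 * (S * S)))\<^sup>2 * t^8)))"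
      using L by (intro ennreal_mult[symmetric]) auto
    also have "\<dots> \<le> ennreal (C * hx^4 * hy^4 * exp (- (c / 2) * (\<xi>\<^sup>2 + \<eta>\<^sup>2)))"
    proof (rule ennreal_leI)
      have "L^4 * t^8 = C0^8 * (t^128 * t^8)" unfolding L_def power_mult_distrib power_mult[symmetric] by simp
      then have "L^4 * t^8 = C0^8 * t^(2 * 68)" by (simp flip: power_add)
      then have "hx^4 * hy^4 * L^4 * (exp (A - c * (\<xi>\<^sup>2 + \<eta>\<^sup>2)) * (4 * (ph * (4 * (S * S)))\<^sup>2 * t^8))
        = hx^4 * hy^4 * C0^8 * exp A * (4 * (ph * (4 * (S * S)))\<^sup>2) * (t^(2 * 68) * exp (- (2 * (c / 2)) * (\<xi>\<^sup>2 + \<eta>\<^sup>2)))"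
      proof -
        assume *: "L^4 * t^8 = C0^8 * t^(2 * 68)"
        have "exp (A - c * (\<xi>\<^sup>2 + \<eta>\<^sup>2)) = exp A * exp (- (2 * (c / 2)) * (\<xi>\<^sup>2 + \<eta>\<^sup>2))" by (simp flip: exp_add)
        then have "hx^4 * hy^4 * L^4 * (exp (A - c * (\<xi>\<^sup>2 + \<eta>\<^sup>2)) * (4 * (ph * (4 * (S * S)))\<^sup>2 * t^8))
          = hx^4 * hy^4 * exp A * (4 * (ph * (4 * (S * S)))\<^sup>2) * ((L^4 * t^8) * exp (- (2 * (c / 2)) * (\<xi>\<^sup>2 + \<eta>\<^sup>2)))"
          by (simp only: mult_ac)
        then show ?thesis unfolding * by (simp only: mult_ac)
      qed
      also have "\<dots> \<le> hx^4 * hy^4 * C0^8 * exp A * (4 * (ph * (4 * (S * S)))\<^sup>2) * (D * exp (- (c / 2) * (\<xi>\<^sup>2 + \<eta>\<^sup>2)))"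
        using D(2)[of \<xi> \<eta>] C0_ge_1 unfolding t_def by (intro mult_left_mono) auto
      finally show "hx^4 * hy^4 * L^4 * (exp (A - c * (\<xi>\<^sup>2 + \<eta>\<^sup>2)) * (4 * (ph * (4 * (S * S)))\<^sup>2 * t^8)) \<le> C * hx^4 * hy^4 * exp (- (c / 2) * (\<xi>\<^sup>2 + \<eta>\<^sup>2))"
        by (simp add: C_def mult_ac)
    qed
    finally show "(\<integral>\<^sup>+\<omega>. ennreal ((norm (mixed x0 y0 k hx hy N (incr W k \<omega>) (Complex \<xi> (tilt / 2)) (Complex \<eta> (tilt / 2))))\<^sup>2) \<partial>M)
       \<le> ennreal (C * hx^4 * hy^4 * exp (- (c / 2) * (\<xi>\<^sup>2 + \<eta>\<^sup>2)))"
      unfolding z_def w_def .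
  qed
qed

end

section \<open>Fourier integrals on tilted contours\<close>

text \<open>The strip is convex, so g has a primitive G there. By periodicity G (z + 2 L) - G z has
  derivative 0 and is one constant on the strip, and the integral over a period at any height equals
  that constant.\<close>

lemma integral_periodic_strip:
  fixes g :: "complex \<Rightarrow> complex"
  assumes hol: "g holomorphic_on {z. \<bar>Im z\<bar> < d}" and per: "\<And>z. \<bar>Im z\<bar> < d \<Longrightarrow> g (z + of_real (2 * L)) = g z"
    and L: "0 \<le> L" and ab: "\<bar>a\<bar> < d" "\<bar>b\<bar> < d"
  shows "integral {- L..L} (\<lambda>x. g (Complex x a)) = integral {- L..L} (\<lambda>x. g (Complex x b))"
proof -
  define S where "S = {z :: complex. \<bar>Im z\<bar> < d}"
  have S: "S = {z. Im z < d} \<inter> {z. Im z > - d}" by (auto simp: S_def)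
  have oS: "open S" unfolding S by (intro open_Int open_halfspace_Im_lt open_halfspace_Im_gt)
  have cS: "convex S" unfolding S by (intro convex_Int convex_halfspace_Im_lt convex_halfspace_Im_gt)
  obtain G where G: "\<And>z. z \<in> S \<Longrightarrow> (G has_field_derivative g z) (at z within S)"
    using holomorphic_convex_primitive'[OF cS oS] hol unfolding S_def by metis
  have G': "(G has_field_derivative g z) (at z)" if "z \<in> S" for z
    using G[OF that] at_within_open[OF that oS] by simp
  have shift: "z + of_real (2 * L) \<in> S" if "z \<in> S" for z using that by (simp add: S_def)
  have "((\<lambda>z. G (z + of_real (2 * L)) - G z) has_field_derivative 0) (at z within S)" if "z \<in> S" for z
  proof -
    have "((\<lambda>z. G (z + of_real (2 * L)) - G z) has_field_derivative (g (z + of_real (2 * L)) * 1 - g z)) (at z within S)"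
    proof (intro DERIV_diff G[OF that] DERIV_chain2[where f = G and g = "\<lambda>z. z + of_real (2 * L)"] G' shift that)
      show "((\<lambda>z. z + of_real (2 * L)) has_field_derivative 1) (at z within S)"
        by (auto intro!: derivative_eq_intros)
    qed
    then show ?thesis using per that by (simp add: S_def)
  qed
  then obtain c where c: "\<And>z. z \<in> S \<Longrightarrow> G (z + of_real (2 * L)) - G z = c"
    using has_field_derivative_zero_constant[OF cS, of "\<lambda>z. G (z + of_real (2 * L)) - G z"] by blast
  have "integral {- L..L} (\<lambda>x. g (Complex x y)) = c" if y: "\<bar>y\<bar> < d" for y
  proof -
    have "((\<lambda>x. g (Complex x y)) has_integral (G (Complex L y) - G (Complex (- L) y))) {- L..L}"
    proof (rule fundamental_theorem_of_calculus)
      fix x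
      have "Complex x y \<in> S" using y by (simp add: S_def)
      moreover have "((\<lambda>x. complex_of_real x + \<i> * of_real y) has_vector_derivative (of_real 1 + 0)) (at x within {- L..L})"
        by (intro has_vector_derivative_add has_vector_derivative_of_real DERIV_ident has_vector_derivative_const)
      then have "((\<lambda>x. Complex x y) has_vector_derivative 1) (at x within {- L..L})"
        by (simp add: Complex_eq)
      ultimately have "((G \<circ> (\<lambda>x. Complex x y)) has_vector_derivative (1 * g (Complex x y))) (at x within {- L..L})"
        by (intro field_vector_diff_chain_within DERIV_subset[OF G']) auto
      then show "((\<lambda>x. G (Complex x y)) has_vector_derivative g (Complex x y)) (at x within {- L..L})"
        by (simp add: o_def)
    qed (use L in simp)
    moreover have "G (Complex L y) - G (Complex (- L) y) = c"
    proof -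
      have "Complex (- L) y + of_real (2 * L) = Complex L y" by (simp add: complex_eq_iff)
      then show ?thesis using c[of "Complex (- L) y"] y by (simp add: S_def)
    qed
    ultimately show ?thesis by (simp add: integral_unique)
  qed
  then show ?thesis using ab by simp
qed

definition freq_box :: "real \<Rightarrow> real \<Rightarrow> (real \<times> real) set" where
  "freq_box hx hy = cbox (- (pi / hx), - (pi / hy)) (pi / hx, pi / hy)"

definition fint :: "real \<Rightarrow> real \<Rightarrow> real \<Rightarrow> real \<Rightarrow> (complex \<Rightarrow> complex \<Rightarrow> complex) \<Rightarrow> complex" where
  "fint hx hy a b f = integral (freq_box hx hy) (\<lambda>p. f (Complex (fst p) a) (Complex (snd p) b))"

text \<open>Symbols that extend holomorphically to the strip of width \<open>d\<close> with the periods of the grid: their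
  Fourier integrals may be moved to any contour inside the strip.\<close>

definition strip_symbol :: "real \<Rightarrow> real \<Rightarrow> real \<Rightarrow> (complex \<Rightarrow> complex \<Rightarrow> complex) \<Rightarrow> bool" where
  "strip_symbol d hx hy f \<longleftrightarrow>
     (\<forall>w. \<bar>Im w\<bar> < d \<longrightarrow> (\<lambda>z. f z w) holomorphic_on {z. \<bar>Im z\<bar> < d}) \<and>
     (\<forall>z. \<bar>Im z\<bar> < d \<longrightarrow> f z holomorphic_on {w. \<bar>Im w\<bar> < d}) \<and>
     continuous_on ({z. \<bar>Im z\<bar> < d} \<times> {w. \<bar>Im w\<bar> < d}) (\<lambda>p. f (fst p) (snd p)) \<and>
     (\<forall>z w. \<bar>Im z\<bar> < d \<longrightarrow> \<bar>Im w\<bar> < d \<longrightarrow>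
        f (z + of_real (2 * (pi / hx))) w = f z w \<and> f z (w + of_real (2 * (pi / hy))) = f z w)"

lemma strip_symbol_const: "strip_symbol d hx hy (\<lambda>z w. c)"
  by (simp add: strip_symbol_def)

lemma strip_symbol_add:
  "strip_symbol d hx hy f \<Longrightarrow> strip_symbol d hx hy g \<Longrightarrow> strip_symbol d hx hy (\<lambda>z w. f z w + g z w)"
  by (simp add: strip_symbol_def holomorphic_on_add continuous_on_add)

lemma strip_symbol_mult:
  "strip_symbol d hx hy f \<Longrightarrow> strip_symbol d hx hy g \<Longrightarrow> strip_symbol d hx hy (\<lambda>z w. f z w * g z w)"
  by (simp add: strip_symbol_def holomorphic_on_mult continuous_on_mult)

lemma strip_symbol_inverse:
  "strip_symbol d hx hy f \<Longrightarrow> (\<And>z w. \<bar>Im z\<bar> < d \<Longrightarrow> \<bar>Im w\<bar> < d \<Longrightarrow> f z w \<noteq> 0) \<Longrightarrow> strip_symbol d hx hy (\<lambda>z w. inverse (f z w))"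
  unfolding strip_symbol_def
  by (intro conjI allI impI holomorphic_on_inverse continuous_on_inverse) auto

lemma strip_symbol_prod:
  "(\<And>n. n \<in> A \<Longrightarrow> strip_symbol d hx hy (f n)) \<Longrightarrow> strip_symbol d hx hy (\<lambda>z w. \<Prod>n\<in>A. f n z w)"
  by (induction A rule: infinite_finite_induct) (simp_all add: strip_symbol_const strip_symbol_mult)

lemma strip_symbol_x:
  assumes "f holomorphic_on UNIV" "\<And>z. f (z + of_real (2 * (pi / hx))) = f z"
  shows "strip_symbol d hx hy (\<lambda>z w. f z)"
proof -
  have "continuous_on UNIV f" using assms(1) by (rule holomorphic_on_imp_continuous_on)
  then have "continuous_on S (\<lambda>p. f (fst p))" for S :: "(complex \<times> complex) set"
    by (rule continuous_on_compose2[OF _ continuous_on_fst[OF continuous_on_id]]) simp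
  then show ?thesis using assms(2) holomorphic_on_subset[OF assms(1) subset_UNIV] by (simp add: strip_symbol_def)
qed

lemma strip_symbol_y:
  assumes "f holomorphic_on UNIV" "\<And>z. f (z + of_real (2 * (pi / hy))) = f z"
  shows "strip_symbol d hx hy (\<lambda>z w. f w)"
proof -
  have "continuous_on UNIV f" using assms(1) by (rule holomorphic_on_imp_continuous_on)
  then have "continuous_on S (\<lambda>p. f (snd p))" for S :: "(complex \<times> complex) set"
    by (rule continuous_on_compose2[OF _ continuous_on_snd[OF continuous_on_id]]) simp
  then show ?thesis using assms(2) holomorphic_on_subset[OF assms(1) subset_UNIV] by (simp add: strip_symbol_def)
qed

lemma continuous_on_Complex [continuous_intros]:
  "continuous_on S f \<Longrightarrow> continuous_on S g \<Longrightarrow> continuous_on S (\<lambda>x. Complex (f x) (g x))"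
  unfolding Complex_eq by (intro continuous_intros)

lemma strip_symbol_continuous:
  assumes f: "strip_symbol d hx hy f" and ab: "\<bar>a\<bar> < d" "\<bar>b\<bar> < d"
  shows "continuous_on S (\<lambda>p. f (Complex (fst p) a) (Complex (snd p) b))"
proof -
  have "continuous_on ({z. \<bar>Im z\<bar> < d} \<times> {w. \<bar>Im w\<bar> < d}) (\<lambda>p. f (fst p) (snd p))"
    using f unfolding strip_symbol_def by blast
  then have "continuous_on S (\<lambda>p. f (fst (Complex (fst p) a, Complex (snd p) b)) (snd (Complex (fst p) a, Complex (snd p) b)))"
    by (rule continuous_on_compose2) (use ab in \<open>auto intro!: continuous_intros\<close>)
  then show ?thesis by simp
qed

text \<open>The contours are moved one variable at a time, the other being frozen, with an exchange
  of the order of integration in between.\<close>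

lemma fint_shift:
  assumes f: "strip_symbol d hx hy f" and h: "0 < hx" "0 < hy"
    and ab: "\<bar>a\<bar> < d" "\<bar>b\<bar> < d" "\<bar>a'\<bar> < d" "\<bar>b'\<bar> < d"
  shows "fint hx hy a b f = fint hx hy a' b' f"
proof -
  have inner: "fint hx hy a b f = integral {- (pi / hx)..pi / hx} (\<lambda>x. integral {- (pi / hy)..pi / hy} (\<lambda>y. f (Complex x a) (Complex y b)))"
    if "\<bar>a\<bar> < d" "\<bar>b\<bar> < d" for a b
    unfolding fint_def freq_box_def using strip_symbol_continuous[OF f that] by (subst integral_prod_continuous) auto
  have swap: "integral {- (pi / hx)..pi / hx} (\<lambda>x. integral {- (pi / hy)..pi / hy} (\<lambda>y. f (Complex x a) (Complex y b)))
     = integral {- (pi / hy)..pi / hy} (\<lambda>y. integral {- (pi / hx)..pi / hx} (\<lambda>x. f (Complex x a) (Complex y b)))"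
    if "\<bar>a\<bar> < d" "\<bar>b\<bar> < d" for a b
    using integral_swap_continuous[of "- (pi / hx)" "- (pi / hy)" "pi / hx" "pi / hy" "\<lambda>x y. f (Complex x a) (Complex y b)"]
      strip_symbol_continuous[OF f that] by (simp add: case_prod_beta')
  have L: "0 \<le> pi / hx" "0 \<le> pi / hy" using h by auto
  have "fint hx hy a b f = integral {- (pi / hx)..pi / hx} (\<lambda>x. integral {- (pi / hy)..pi / hy} (\<lambda>y. f (Complex x a) (Complex y b')))"
    unfolding inner[OF ab(1,2)] using f ab L
    by (intro integral_cong integral_periodic_strip[where d = d]) (auto simp: strip_symbol_def)
  also have "\<dots> = integral {- (pi / hy)..pi / hy} (\<lambda>y. integral {- (pi / hx)..pi / hx} (\<lambda>x. f (Complex x a') (Complex y b')))"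
    unfolding swap[OF ab(1,4)] using f ab L
    by (intro integral_cong integral_periodic_strip[where d = d and g = "\<lambda>z. f z w" for w]) (auto simp: strip_symbol_def)
  also have "\<dots> = fint hx hy a' b' f" using swap[OF ab(3,4)] inner[OF ab(3,4)] by simp
  finally show ?thesis .
qed

section \<open>Square-summable grids and uniqueness for the implicit step\<close>

lemma l2_grid_diff:
  assumes "U \<in> l2_grid" "V \<in> l2_grid" shows "(\<lambda>i j. U i j - V i j) \<in> l2_grid"
proof -
  have "(\<lambda>p. 2 * (U (fst p) (snd p))\<^sup>2 + 2 * (V (fst p) (snd p))\<^sup>2) summable_on UNIV"
    using assms unfolding l2_grid_def by (intro summable_on_add summable_on_cmult_right) (auto simp: case_prod_beta')
  then have "(\<lambda>p. (U (fst p) (snd p) - V (fst p) (snd p))\<^sup>2) summable_on UNIV"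
  proof (rule summable_on_comparison_test)
    show "(U (fst p) (snd p) - V (fst p) (snd p))\<^sup>2 \<le> 2 * (U (fst p) (snd p))\<^sup>2 + 2 * (V (fst p) (snd p))\<^sup>2" for p
    proof -
      have "0 \<le> (U (fst p) (snd p) + V (fst p) (snd p))\<^sup>2" by simp
      then show ?thesis by (simp add: power2_eq_square algebra_simps)
    qed
  qed simp
  then show ?thesis by (simp add: l2_grid_def case_prod_beta')
qed

text \<open>The energy identity: pairing the implicit operator with its argument, the first order terms cancel by
  translation invariance and the second order terms are nonnegative.\<close>

lemma implicit_op_injective:
  assumes U: "U \<in> l2_grid" and k: "0 \<le> k" and eq: "implicit_op \<mu>x \<mu>y k hx hy U = (\<lambda>i j. 0)"
  shows "U = (\<lambda>i j. 0)"
proof -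
  define u where "u p = U (fst p) (snd p)" for p :: "int \<times> int"
  define sh where "sh m p = (fst p + fst m, snd p + snd m)" for m p :: "int \<times> int"
  have bij: "bij (sh m)" for m
    by (rule o_bij[where g = "sh (- m)"]) (simp_all add: sh_def o_def id_def)
  have sq: "(\<lambda>p. (u p)\<^sup>2) summable_on UNIV" using U by (simp add: l2_grid_def u_def case_prod_beta')
  have sqm: "(\<lambda>p. (u (sh m p))\<^sup>2) summable_on UNIV" "(\<Sum>\<^sub>\<infinity>p. (u (sh m p))\<^sup>2) = (\<Sum>\<^sub>\<infinity>p. (u p)\<^sup>2)" for m
    using sq summable_on_reindex_bij_betw[OF bij, of "\<lambda>p. (u p)\<^sup>2" m]
      infsum_reindex_bij_betw[OF bij, of "\<lambda>p. (u p)\<^sup>2" m] by blast+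
  have prod: "(\<lambda>p. u p * u (sh m p)) summable_on UNIV" for m
  proof (rule abs_summable_summable, rule summable_on_comparison_test)
    show "(\<lambda>p. (u p)\<^sup>2 + (u (sh m p))\<^sup>2) summable_on UNIV" by (intro summable_on_add sq sqm)
    show "norm (u p * u (sh m p)) \<le> (u p)\<^sup>2 + (u (sh m p))\<^sup>2" for p
    proof -
      have "2 * \<bar>u p\<bar> * \<bar>u (sh m p)\<bar> \<le> (u p)\<^sup>2 + (u (sh m p))\<^sup>2" using sum_squares_bound[of "\<bar>u p\<bar>" "\<bar>u (sh m p)\<bar>"] by simp
      moreover have "0 \<le> \<bar>u p\<bar> * \<bar>u (sh m p)\<bar>" by simp
      ultimately show ?thesis unfolding real_norm_def abs_mult by linarith
    qed
  qed auto
  \<comment> \<open>The autocorrelation of the grid function. Only two facts about it are needed: it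
    is even, and it is maximal at shift 0.\<close>
  define q where "q m = (\<Sum>\<^sub>\<infinity>p. u p * u (sh m p))" for m
  have q0: "q (0, 0) = (\<Sum>\<^sub>\<infinity>p. (u p)\<^sup>2)" by (simp add: q_def sh_def power2_eq_square)
  have sym: "q (- m) = q m" for m
  proof -
    have "q (- m) = (\<Sum>\<^sub>\<infinity>p. u (sh m p) * u (sh (- m) (sh m p)))"
      unfolding q_def by (rule infsum_reindex_bij_betw[OF bij, symmetric])
    then show ?thesis by (simp add: q_def sh_def mult.commute)
  qed
  have qle: "q m \<le> q (0, 0)" for m
  proof -
    have "2 * q m = (\<Sum>\<^sub>\<infinity>p. 2 * (u p * u (sh m p)))" unfolding q_def by (rule infsum_cmult_right'[symmetric])
    also have "\<dots> \<le> (\<Sum>\<^sub>\<infinity>p. (u p)\<^sup>2 + (u (sh m p))\<^sup>2)"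
    proof (rule infsum_mono)
      show "2 * (u p * u (sh m p)) \<le> (u p)\<^sup>2 + (u (sh m p))\<^sup>2" for p using sum_squares_bound[of "u p" "u (sh m p)"] by simp
    qed (intro summable_on_add sq sqm prod summable_on_cmult_right)+
    also have "\<dots> = 2 * q (0, 0)" using infsum_add[OF sq sqm(1)] sqm(2) by (simp add: q0)
    finally show ?thesis by simp
  qed
  define A0 A1 A2 A3 A4 where "A0 = 1 + k / hx\<^sup>2 + k / hy\<^sup>2"
    and "A1 = \<mu>x * k / (2 * hx) - k / (2 * hx\<^sup>2)" and "A2 = - (\<mu>x * k / (2 * hx)) - k / (2 * hx\<^sup>2)"
    and "A3 = \<mu>y * k / (2 * hy) - k / (2 * hy\<^sup>2)" and "A4 = - (\<mu>y * k / (2 * hy)) - k / (2 * hy\<^sup>2)"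
  have e: "A0 * (u p * u (sh (0, 0) p)) + A1 * (u p * u (sh (1, 0) p)) + A2 * (u p * u (sh (-1, 0) p))
     + A3 * (u p * u (sh (0, 1) p)) + A4 * (u p * u (sh (0, -1) p)) = 0" for p
  proof -
    have ex: "u p * (a + B1 * (b - c) + B2 * (d - e') - B3 * (b - 2 * a + c) - B4 * (d - 2 * a + e'))
       = (1 + 2 * B3 + 2 * B4) * (u p * a) + (B1 - B3) * (u p * b) + (- B1 - B3) * (u p * c) + (B2 - B4) * (u p * d) + (- B2 - B4) * (u p * e')"
      for a b c d e' B1 B2 B3 B4 by (simp add: algebra_simps)
    have k2: "2 * (k / (2 * hx\<^sup>2)) = k / hx\<^sup>2" "2 * (k / (2 * hy\<^sup>2)) = k / hy\<^sup>2" by simp_all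
    have "u p * implicit_op \<mu>x \<mu>y k hx hy U (fst p) (snd p) = 0" unfolding eq by simp
    then show ?thesis
      unfolding implicit_op_def Dx_def Dy_def Dxx_def Dyy_def ex k2 A0_def A1_def A2_def A3_def A4_def
      by (simp add: u_def sh_def)
  qed
  have hs: "((\<lambda>p. u p * u (sh m p)) has_sum q m) UNIV" for m unfolding q_def using prod by (rule has_sum_infsum)
  have "((\<lambda>p. A0 * (u p * u (sh (0, 0) p)) + A1 * (u p * u (sh (1, 0) p)) + A2 * (u p * u (sh (-1, 0) p))
     + A3 * (u p * u (sh (0, 1) p)) + A4 * (u p * u (sh (0, -1) p))) has_sum
     (A0 * q (0, 0) + A1 * q (1, 0) + A2 * q (-1, 0) + A3 * q (0, 1) + A4 * q (0, -1))) UNIV"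
    by (intro has_sum_add has_sum_cmult_right hs)
  then have "A0 * q (0, 0) + A1 * q (1, 0) + A2 * q (-1, 0) + A3 * q (0, 1) + A4 * q (0, -1) = 0"
    unfolding e by (rule has_sum_unique) simp
  moreover have "q (-1, 0) = q (1, 0)" "q (0, -1) = q (0, 1)" using sym[of "(1, 0)"] sym[of "(0, 1)"] by simp_all
  ultimately have "q (0, 0) + k / hx\<^sup>2 * (q (0, 0) - q (1, 0)) + k / hy\<^sup>2 * (q (0, 0) - q (0, 1)) = 0"
  proof -
    assume *: "A0 * q (0, 0) + A1 * q (1, 0) + A2 * q (-1, 0) + A3 * q (0, 1) + A4 * q (0, -1) = 0"
      "q (-1, 0) = q (1, 0)" "q (0, -1) = q (0, 1)"
    \<comment> \<open>Evenness pairs opposite shifts, and in the sum of their weights the drift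
      cancels; only the diffusion remains, with the sign that favours q (0, 0).\<close>
    have A: "A1 + A2 = - (k / hx\<^sup>2)" "A3 + A4 = - (k / hy\<^sup>2)" by (simp_all add: A1_def A2_def A3_def A4_def)
    have "A0 * q (0, 0) + (A1 + A2) * q (1, 0) + (A3 + A4) * q (0, 1) = 0"
      using * by (simp add: distrib_right)
    then show ?thesis unfolding A A0_def by (simp add: left_diff_distrib right_diff_distrib distrib_right)
  qed
  moreover have "0 \<le> k / hx\<^sup>2 * (q (0, 0) - q (1, 0))" "0 \<le> k / hy\<^sup>2 * (q (0, 0) - q (0, 1))"
    using qle k by auto
  ultimately have "q (0, 0) \<le> 0" by linarith
  then have le: "(\<Sum>\<^sub>\<infinity>p. (u p)\<^sup>2) \<le> 0" by (simp only: q0)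
  have "(u p)\<^sup>2 = 0" for p
    by (rule nonneg_infsum_le_0D[OF le sq]) simp_all
  note z = this
  have "U i j = 0" for i j using z[of "(i, j)"] by (simp add: u_def)
  then show ?thesis by (simp add: fun_eq_iff)
qed

section \<open>Grid functions synthesised from plane waves\<close>

definition wave :: "real \<Rightarrow> real \<Rightarrow> int \<Rightarrow> complex \<Rightarrow> complex" where
  "wave h x0 i z = exp (\<i> * (z * of_real (of_int i * h - x0)))"

text \<open>Inverse Fourier transform over the frequency box, centred at the source point so that
  the symbol 1 gives the discrete Dirac datum. Taking the real part makes the grid real without any
  symmetry of the symbol having to be verified, and it commutes with stencils because their
  coefficients are real.\<close>

definition gridf :: "real \<Rightarrow> real \<Rightarrow> real \<Rightarrow> real \<Rightarrow> (complex \<Rightarrow> complex \<Rightarrow> complex) \<Rightarrow> grid" where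
  "gridf hx hy x0 y0 f i j = Re (fint hx hy 0 0 (\<lambda>z w. wave hx x0 i z * wave hy y0 j w * f z w)) / (4 * pi\<^sup>2)"

lemma wave_periodic:
  assumes h: "0 < h" and x0: "x0 / h \<in> \<int>"
  shows "wave h x0 i (z + of_real (2 * (pi / h))) = wave h x0 i z"
proof -
  obtain n where n: "x0 / h = of_int n" using x0 by (auto elim: Ints_cases)
  have e: "of_real (2 * (pi / h)) * complex_of_real (of_int i * h - x0) = of_int (i - n) * (of_real pi * 2)"
  proof -
    have "2 * (pi / h) * (of_int i * h - x0) = of_int (i - n) * (pi * 2)"
      using h n by (simp add: field_simps)
    then show ?thesis by (metis of_real_mult of_real_of_int_eq of_real_numeral)
  qed
  have "wave h x0 i (z + of_real (2 * (pi / h))) = exp (\<i> * (z * of_real (of_int i * h - x0)) + \<i> * (of_int (i - n) * (of_real pi * 2)))"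
    unfolding wave_def distrib_right[of z] e by (simp add: distrib_left)
  also have "\<dots> = wave h x0 i z" unfolding exp_add exp_2pi_1_int wave_def by simp
  finally show ?thesis .
qed

lemma wave_holomorphic: "wave h x0 i holomorphic_on S"
  unfolding wave_def by (intro holomorphic_intros)

lemma strip_symbol_wave:
  assumes "0 < hx" "0 < hy" "x0 / hx \<in> \<int>" "y0 / hy \<in> \<int>"
  shows "strip_symbol d hx hy (\<lambda>z w. wave hx x0 i z * wave hy y0 j w)"
  using assms by (intro strip_symbol_mult strip_symbol_x strip_symbol_y wave_holomorphic wave_periodic)

lemma norm_wave: "norm (wave h x0 i z) = exp (- Im z * (of_int i * h - x0))"
  by (simp add: wave_def)

text \<open>Stencil identities are evaluated on the real contour only, where continuity of the
  symbol suffices.\<close>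

definition real_continuous :: "(complex \<Rightarrow> complex \<Rightarrow> complex) \<Rightarrow> bool" where
  "real_continuous f \<longleftrightarrow> continuous_on UNIV (\<lambda>p. f (Complex (fst p) 0) (Complex (snd p) 0))"

lemma strip_symbol_real_continuous: "strip_symbol d hx hy f \<Longrightarrow> 0 < d \<Longrightarrow> real_continuous f"
  unfolding real_continuous_def by (rule strip_symbol_continuous) auto

lemma continuous_on_wave: "continuous_on S (\<lambda>p. wave h x0 i (Complex (f p) a))" if "continuous_on S f" for f
  unfolding wave_def by (intro continuous_intros that)

text \<open>A stencil is a list of triples: coefficient, shift in i, shift in j. It acts on the
  symbol through its trigonometric polynomial, so the implicit and the explicit operator reduce to
  comparing two finite sums of exponentials.\<close>

lemma gridf_stencil:
  assumes f: "real_continuous f"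
  shows "(\<Sum>(c, p, q)\<leftarrow>L. c * gridf hx hy x0 y0 f (i + p) (j + q))
    = gridf hx hy x0 y0 (\<lambda>z w. (\<Sum>(c, p, q)\<leftarrow>L. of_real c * exp (\<i> * (z * of_real (of_int p * hx) + w * of_real (of_int q * hy)))) * f z w) i j"
proof -
  define s where "s L = (\<lambda>z w. (\<Sum>(c, p, q)\<leftarrow>L. of_real c * exp (\<i> * (z * of_real (of_int p * hx) + w * of_real (of_int q * hy)))))" for L :: "(real \<times> int \<times> int) list"
  have s_Cons: "s ((c, p, q) # L) z w = of_real c * exp (\<i> * (z * of_real (of_int p * hx) + w * of_real (of_int q * hy))) + s L z w" for c p q L z w
    by (simp add: s_def)
  have cs: "continuous_on UNIV (\<lambda>u. s L (Complex (fst u) 0) (Complex (snd u) 0))" for L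
  proof (induction L)
    case Nil then show ?case by (simp add: s_def)
  next
    case (Cons a L)
    obtain c p q where a: "a = (c, p, q)" by (cases a)
    show ?case unfolding a s_Cons by (intro continuous_intros Cons.IH)
  qed
  have cf: "continuous_on UNIV (\<lambda>u. f (Complex (fst u) 0) (Complex (snd u) 0))" using f unfolding real_continuous_def .
  have int: "(\<lambda>u. F u) integrable_on freq_box hx hy" if "continuous_on UNIV F" for F :: "real \<times> real \<Rightarrow> complex"
    unfolding freq_box_def using that by (intro integrable_continuous) (auto intro: continuous_on_subset)
  note ci = continuous_intros continuous_on_wave
  have "(\<Sum>(c, p, q)\<leftarrow>L. c * gridf hx hy x0 y0 f (i + p) (j + q)) = gridf hx hy x0 y0 (\<lambda>z w. s L z w * f z w) i j"
  proof (induction L)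
    case Nil then show ?case by (simp add: s_def gridf_def fint_def)
  next
    case (Cons a L)
    obtain c p q where a: "a = (c, p, q)" by (cases a)
    have sh: "wave h x (i + p) z = exp (\<i> * (z * of_real (of_int p * h))) * wave h x i z" for h x i p z
      unfolding wave_def exp_add[symmetric] by (simp add: algebra_simps)
    have w1: "of_real c * (wave hx x0 (i + p) z * wave hy y0 (j + q) w * f z w) + wave hx x0 i z * wave hy y0 j w * (s L z w * f z w)
        = wave hx x0 i z * wave hy y0 j w * (s (a # L) z w * f z w)" for z w
      unfolding a s_Cons sh by (simp add: exp_add distrib_left algebra_simps)
    have "c * gridf hx hy x0 y0 f (i + p) (j + q) + gridf hx hy x0 y0 (\<lambda>z w. s L z w * f z w) i j
       = Re (of_real c * fint hx hy 0 0 (\<lambda>z w. wave hx x0 (i + p) z * wave hy y0 (j + q) w * f z w)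
           + fint hx hy 0 0 (\<lambda>z w. wave hx x0 i z * wave hy y0 j w * (s L z w * f z w))) / (4 * pi\<^sup>2)"
      by (simp add: gridf_def add_divide_distrib)
    also have "of_real c * fint hx hy 0 0 (\<lambda>z w. wave hx x0 (i + p) z * wave hy y0 (j + q) w * f z w)
           + fint hx hy 0 0 (\<lambda>z w. wave hx x0 i z * wave hy y0 j w * (s L z w * f z w))
       = fint hx hy 0 0 (\<lambda>z w. wave hx x0 i z * wave hy y0 j w * (s (a # L) z w * f z w))"
      unfolding fint_def integral_mult_right[symmetric] w1[symmetric]
      by (intro integral_add[symmetric] int ci cs cf)
    finally show ?case using Cons.IH by (simp add: gridf_def a)
  qed
  then show ?thesis unfolding s_def .
qed

text \<open>Orthogonality by contour shift: raising the contour by 1 multiplies a mode with offset c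
  by exp (- c), yet periodicity leaves the integral unchanged; for c different from 0 it must
  vanish.\<close>

lemma integral_wave:
  assumes h: "0 < h" and x0: "x0 / h \<in> \<int>"
  shows "integral {- (pi / h)..pi / h} (\<lambda>x. wave h x0 i (Complex x 0)) = (if of_int i = x0 / h then of_real (2 * (pi / h)) else 0)"
proof (cases "of_int i = x0 / h")
  case True
  then have "wave h x0 i z = 1" for z using h by (simp add: wave_def)
  then show ?thesis using True h by (simp add: scaleR_conv_of_real)
next
  case False
  define I where "I a = integral {- (pi / h)..pi / h} (\<lambda>x. wave h x0 i (Complex x a))" for a
  define c where "c = of_int i * h - x0"
  have c: "c \<noteq> 0" using False h by (simp add: c_def field_simps)
  have "I 1 = I 0"
    unfolding I_def using wave_periodic[OF h x0, of i] h
    by (intro integral_periodic_strip[where d = 2 and g = "wave h x0 i"] wave_holomorphic) auto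
  moreover have "I 1 = exp (- of_real c) * I 0"
  proof -
    have "wave h x0 i (Complex x 1) = exp (- of_real c) * wave h x0 i (Complex x 0)" for x
      unfolding wave_def c_def exp_add[symmetric] by (simp add: Complex_eq algebra_simps)
    then show ?thesis unfolding I_def by simp
  qed
  ultimately have "(1 - exp (- of_real c :: complex)) * I 0 = 0" by (simp add: algebra_simps)
  moreover have "exp (- of_real c :: complex) \<noteq> 1"
  proof -
    have "exp (- of_real c :: complex) = of_real (exp (- c))" by (simp flip: exp_of_real)
    then show ?thesis using c by (simp add: of_real_eq_1_iff)
  qed
  ultimately show ?thesis using False by (simp add: I_def)
qed

lemma gridf_one:
  assumes h: "0 < hx" "0 < hy" and x0: "x0 / hx \<in> \<int>" "y0 / hy \<in> \<int>"
  shows "gridf hx hy x0 y0 (\<lambda>z w. 1) i j = (if of_int i = x0 / hx \<and> of_int j = y0 / hy then 1 / (hx * hy) else 0)"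
proof -
  have "fint hx hy 0 0 (\<lambda>z w. wave hx x0 i z * wave hy y0 j w * 1)
    = integral {- (pi / hx)..pi / hx} (\<lambda>x. integral {- (pi / hy)..pi / hy} (\<lambda>y. wave hx x0 i (Complex x 0) * wave hy y0 j (Complex y 0)))"
    unfolding fint_def freq_box_def
    by (subst integral_prod_continuous) (auto intro!: continuous_intros continuous_on_wave)
  also have "\<dots> = (if of_int i = x0 / hx then of_real (2 * (pi / hx)) else 0) * (if of_int j = y0 / hy then of_real (2 * (pi / hy)) else 0)"
    unfolding integral_mult_right integral_mult_left integral_wave[OF h(1) x0(1)] integral_wave[OF h(2) x0(2)] ..
  finally show ?thesis unfolding gridf_def using h by (simp add: power2_eq_square)
qed

lemma has_sum_int_power_abs:
  fixes r :: real assumes "0 \<le> r" "r < 1"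
  obtains S where "((\<lambda>i::int. r ^ nat \<bar>i\<bar>) has_sum S) UNIV"
proof -
  have s: "(\<lambda>n. r ^ n) summable_on UNIV"
    using assms by (intro norm_summable_imp_summable_on) (simp add: summable_geometric)
  have "(\<lambda>i::int. r ^ nat \<bar>i\<bar>) summable_on (range int \<union> range (\<lambda>n. - int n))"
    using s by (intro summable_on_union; subst summable_on_reindex) (auto simp: inj_on_def o_def)
  moreover have "range int \<union> range (\<lambda>n. - int n) = UNIV"
    by (auto, metis int_cases2 rangeI)
  ultimately have "(\<lambda>i::int. r ^ nat \<bar>i\<bar>) summable_on UNIV" by simp
  then show ?thesis by (rule that[OF has_sum_infsum])
qed

lemma strip_symbol_bounded:
  assumes f: "strip_symbol d hx hy f" and a: "\<bar>a\<bar> < d" "\<bar>b\<bar> < d"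
  obtains B where "0 \<le> B" "\<And>p. p \<in> freq_box hx hy \<Longrightarrow> norm (f (Complex (fst p) a) (Complex (snd p) b)) \<le> B"
proof -
  have "compact ((\<lambda>p. f (Complex (fst p) a) (Complex (snd p) b)) ` freq_box hx hy)"
    unfolding freq_box_def by (intro compact_continuous_image strip_symbol_continuous[OF f a] compact_cbox)
  then obtain B where B: "\<forall>x\<in>(\<lambda>p. f (Complex (fst p) a) (Complex (snd p) b)) ` freq_box hx hy. norm x \<le> B"
    using compact_imp_bounded bounded_iff by metis
  have M: "norm (f (Complex (fst p) a) (Complex (snd p) b)) \<le> max B 0" if "p \<in> freq_box hx hy" for p
    using B that by (simp add: le_max_iff_disj)
  show ?thesis using that[OF _ M] by simp
qed

lemma gridf_shift:
  assumes f: "strip_symbol d hx hy f" and h: "0 < hx" "0 < hy" and x0: "x0 / hx \<in> \<int>" "y0 / hy \<in> \<int>"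
    and a: "\<bar>a\<bar> < d" "\<bar>b\<bar> < d"
  shows "gridf hx hy x0 y0 f i j = Re (fint hx hy a b (\<lambda>z w. wave hx x0 i z * wave hy y0 j w * f z w)) / (4 * pi\<^sup>2)"
proof -
  have "0 < d" using a by linarith
  have "strip_symbol d hx hy (\<lambda>z w. wave hx x0 i z * wave hy y0 j w * f z w)"
    by (rule strip_symbol_mult[OF strip_symbol_wave[OF h x0] f])
  then have "fint hx hy 0 0 (\<lambda>z w. wave hx x0 i z * wave hy y0 j w * f z w) = fint hx hy a b (\<lambda>z w. wave hx x0 i z * wave hy y0 j w * f z w)"
    using \<open>0 < d\<close> a by (intro fint_shift[OF _ h]) auto
  then show ?thesis by (simp add: gridf_def)
qed

text \<open>A Paley-Wiener argument: the sign of the imaginary part of each frequency is chosen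
  according to the sign of the grid index, so that the wave decays geometrically in every direction.
  The four sign patterns require four bounds on the symbol.\<close>

lemma gridf_l2:
  assumes f: "strip_symbol d hx hy f" and d: "0 < d" and h: "0 < hx" "0 < hy" and x0: "x0 / hx \<in> \<int>" "y0 / hy \<in> \<int>"
  shows "gridf hx hy x0 y0 f \<in> l2_grid"
proof -
  define a where "a = d / 2"
  have a: "0 < a" "a < d" using d by (auto simp: a_def)
  define sg :: "int \<Rightarrow> real" where "sg i = (if i \<ge> 0 then a else - a)" for i
  have sg: "\<bar>sg i\<bar> < d" for i using a by (simp add: sg_def)
  obtain B1 where B1: "0 \<le> B1" "\<And>p. p \<in> freq_box hx hy \<Longrightarrow> norm (f (Complex (fst p) a) (Complex (snd p) a)) \<le> B1"
    by (rule strip_symbol_bounded[OF f, of a a]) (use a in auto)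
  obtain B2 where B2: "0 \<le> B2" "\<And>p. p \<in> freq_box hx hy \<Longrightarrow> norm (f (Complex (fst p) a) (Complex (snd p) (- a))) \<le> B2"
    by (rule strip_symbol_bounded[OF f, of a "- a"]) (use a in auto)
  obtain B3 where B3: "0 \<le> B3" "\<And>p. p \<in> freq_box hx hy \<Longrightarrow> norm (f (Complex (fst p) (- a)) (Complex (snd p) a)) \<le> B3"
    by (rule strip_symbol_bounded[OF f, of "- a" a]) (use a in auto)
  obtain B4 where B4: "0 \<le> B4" "\<And>p. p \<in> freq_box hx hy \<Longrightarrow> norm (f (Complex (fst p) (- a)) (Complex (snd p) (- a))) \<le> B4"
    by (rule strip_symbol_bounded[OF f, of "- a" "- a"]) (use a in auto)
  define B where "B = B1 + B2 + B3 + B4"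
  have B: "norm (f (Complex (fst p) (sg i)) (Complex (snd p) (sg j))) \<le> B" if "p \<in> freq_box hx hy" for p i j
    using B1(1) B2(1) B3(1) B4(1) B1(2)[OF that] B2(2)[OF that] B3(2)[OF that] B4(2)[OF that] by (simp add: B_def sg_def)
  have B0: "0 \<le> B" using B1 B2 B3 B4 by (simp add: B_def)
  define C where "C = exp (a * \<bar>x0\<bar>) * exp (a * \<bar>y0\<bar>) * B * measure lborel (freq_box hx hy)"
  have wv: "norm (wave h x i (Complex u (sg i))) \<le> exp (a * \<bar>x\<bar>) * exp (- a * h) ^ nat \<bar>i\<bar>" if "0 < h" for h x i u
  proof -
    have "- sg i * (of_int i * h - x) = sg i * x + real (nat \<bar>i\<bar>) * (- a * h)"
      by (simp add: sg_def algebra_simps)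
    also have "sg i * x \<le> a * \<bar>x\<bar>" using a by (auto simp: sg_def abs_if mult_le_0_iff)
    finally have "norm (wave h x i (Complex u (sg i))) \<le> exp (a * \<bar>x\<bar> + real (nat \<bar>i\<bar>) * (- a * h))"
      unfolding norm_wave by simp
    then show ?thesis unfolding exp_add exp_of_nat_mult .
  qed
  have bound: "\<bar>gridf hx hy x0 y0 f i j\<bar> \<le> C * (exp (- a * hx) ^ nat \<bar>i\<bar> * exp (- a * hy) ^ nat \<bar>j\<bar>)" for i j
  proof -
    let ?F = "\<lambda>z w. wave hx x0 i z * wave hy y0 j w * f z w"
    have c: "continuous_on UNIV (\<lambda>p. ?F (Complex (fst p) (sg i)) (Complex (snd p) (sg j)))"
      by (rule strip_symbol_continuous[OF strip_symbol_mult[OF strip_symbol_wave[OF h x0] f] sg sg])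
    have "norm (fint hx hy (sg i) (sg j) ?F)
      \<le> (exp (a * \<bar>x0\<bar>) * exp (- a * hx) ^ nat \<bar>i\<bar>) * (exp (a * \<bar>y0\<bar>) * exp (- a * hy) ^ nat \<bar>j\<bar>) * B * measure lborel (freq_box hx hy)"
      unfolding fint_def freq_box_def
    proof (rule has_integral_bound[OF _ integrable_integral[OF integrable_continuous[OF continuous_on_subset[OF c subset_UNIV]]]])
      fix p assume "p \<in> cbox (- (pi / hx), - (pi / hy)) (pi / hx, pi / hy)"
      then have "p \<in> freq_box hx hy" by (simp add: freq_box_def)
      then show "norm (?F (Complex (fst p) (sg i)) (Complex (snd p) (sg j))) \<le> (exp (a * \<bar>x0\<bar>) * exp (- a * hx) ^ nat \<bar>i\<bar>) * (exp (a * \<bar>y0\<bar>) * exp (- a * hy) ^ nat \<bar>j\<bar>) * B"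
        unfolding norm_mult using wv h B by (intro mult_mono) auto
    qed (use B0 in simp)
    also have "\<dots> = C * (exp (- a * hx) ^ nat \<bar>i\<bar> * exp (- a * hy) ^ nat \<bar>j\<bar>)" by (simp add: C_def)
    finally have n: "norm (fint hx hy (sg i) (sg j) ?F) \<le> C * (exp (- a * hx) ^ nat \<bar>i\<bar> * exp (- a * hy) ^ nat \<bar>j\<bar>)" .
    have "1 * 1 \<le> 4 * pi\<^sup>2" using pi_gt3 by (intro mult_mono one_le_power) auto
    then have "\<bar>Re (fint hx hy (sg i) (sg j) ?F) / (4 * pi\<^sup>2)\<bar> \<le> \<bar>Re (fint hx hy (sg i) (sg j) ?F)\<bar> / 1"
      unfolding abs_divide by (intro frac_le) auto
    also have "\<dots> \<le> norm (fint hx hy (sg i) (sg j) ?F)" using abs_Re_le_cmod by simp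
    finally show ?thesis
      unfolding gridf_shift[OF f h x0 sg[of i] sg[of j]] using n by linarith
  qed
  define r s where "r = (exp (- a * hx))\<^sup>2" and "s = (exp (- a * hy))\<^sup>2"
  have rs: "0 \<le> r" "r < 1" "0 \<le> s" "s < 1"
    using a h by (auto simp: r_def s_def power_less_one_iff abs_square_less_1)
  obtain R where R: "((\<lambda>i::int. r ^ nat \<bar>i\<bar>) has_sum R) UNIV" using has_sum_int_power_abs rs by blast
  obtain S where S: "((\<lambda>i::int. s ^ nat \<bar>i\<bar>) has_sum S) UNIV" using has_sum_int_power_abs rs by blast
  have "(\<lambda>(i, j). C\<^sup>2 * r ^ nat \<bar>i\<bar> * s ^ nat \<bar>j\<bar>) summable_on (UNIV \<times> UNIV)"
  proof (rule summable_on_SigmaI)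
    show "((\<lambda>j. case (i, j) of (i, j) \<Rightarrow> C\<^sup>2 * r ^ nat \<bar>i\<bar> * s ^ nat \<bar>j\<bar>) has_sum C\<^sup>2 * r ^ nat \<bar>i\<bar> * S) UNIV" for i
      unfolding prod.case by (intro has_sum_cmult_right S)
    show "(\<lambda>i::int. C\<^sup>2 * r ^ nat \<bar>i\<bar> * S) summable_on UNIV"
      by (intro summable_on_cmult_left summable_on_cmult_right has_sum_imp_summable[OF R])
  qed (use rs in auto)
  then have "(\<lambda>p. case p of (i, j) \<Rightarrow> C\<^sup>2 * r ^ nat \<bar>i\<bar> * s ^ nat \<bar>j\<bar>) summable_on UNIV" by simp
  then have "(\<lambda>p. case p of (i, j) \<Rightarrow> (gridf hx hy x0 y0 f i j)\<^sup>2) summable_on UNIV"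
  proof (rule summable_on_comparison_test)
    fix p :: "int \<times> int"
    obtain i j where p: "p = (i, j)" by (cases p)
    have "\<bar>gridf hx hy x0 y0 f i j\<bar>\<^sup>2 \<le> (C * (exp (- a * hx) ^ nat \<bar>i\<bar> * exp (- a * hy) ^ nat \<bar>j\<bar>))\<^sup>2"
      by (intro power_mono bound) auto
    also have "\<dots> = C\<^sup>2 * r ^ nat \<bar>i\<bar> * s ^ nat \<bar>j\<bar>"
      unfolding r_def s_def power_mult_distrib power_mult[symmetric] by (simp only: mult_ac)
    finally show "(case p of (i, j) \<Rightarrow> (gridf hx hy x0 y0 f i j)\<^sup>2) \<le> (case p of (i, j) \<Rightarrow> C\<^sup>2 * r ^ nat \<bar>i\<bar> * s ^ nat \<bar>j\<bar>)"
      unfolding p by simp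
  qed auto
  then show ?thesis by (simp add: l2_grid_def)
qed

section \<open>Fourier representation of the scheme\<close>

lemma dsin_holomorphic: "dsin h holomorphic_on S" and dcos_holomorphic: "dcos h holomorphic_on S"
  unfolding dsin_def dcos_def by (cases "h = 0"; intro holomorphic_intros; simp)+

lemma dsin_periodic: "h \<noteq> 0 \<Longrightarrow> dsin h (z + of_real (2 * (pi / h))) = dsin h z"
  and dcos_periodic: "h \<noteq> 0 \<Longrightarrow> dcos h (z + of_real (2 * (pi / h))) = dcos h z"
proof -
  assume h: "h \<noteq> 0"
  have "(z + of_real (2 * (pi / h))) * of_real h = z * of_real h + 2 * of_real pi" using h by (simp add: distrib_right)
  then show "dsin h (z + of_real (2 * (pi / h))) = dsin h z" "dcos h (z + of_real (2 * (pi / h))) = dcos h z"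
    by (simp_all add: dsin_def dcos_def sin_add cos_add sin_of_real[symmetric] cos_of_real[symmetric] flip: of_real_mult)
qed

lemma dsin_exp:
  assumes "h \<noteq> 0" shows "dsin h z = - \<i> * (exp (\<i> * (z * of_real h)) - exp (- (\<i> * (z * of_real h)))) / (2 * of_real h)"
proof -
  have "sin (z * of_real h) = - \<i> * (exp (\<i> * (z * of_real h)) - exp (- (\<i> * (z * of_real h)))) / 2"
    by (simp add: sin_exp_eq mult.commute) (simp add: field_simps)
  then show ?thesis by (simp add: dsin_def)
qed

lemma dcos_exp:
  assumes "h \<noteq> 0" shows "dcos h z = (2 - exp (\<i> * (z * of_real h)) - exp (- (\<i> * (z * of_real h)))) / (2 * (of_real h)\<^sup>2)"
proof -
  have "cos (z * of_real h) = (exp (\<i> * (z * of_real h)) + exp (- (\<i> * (z * of_real h)))) / 2"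
    by (simp add: cos_exp_eq)
  then have c: "1 - cos (z * of_real h) = (2 - exp (\<i> * (z * of_real h)) - exp (- (\<i> * (z * of_real h)))) / 2" by (simp add: field_simps)
  show ?thesis unfolding dcos_def c by simp
qed

context milstein_spde
begin

definition symb :: "real \<Rightarrow> real \<Rightarrow> real \<Rightarrow> (nat \<Rightarrow> real \<times> real) \<Rightarrow> nat \<Rightarrow> complex \<Rightarrow> complex \<Rightarrow> complex" where
  "symb k hx hy Z n z w = (\<Prod>m<n. chaos \<rho> (pcoef k hx hy z w) (Z m))"

lemma chaos_pcoef: "chaos \<rho> (pcoef k hx hy z w) p = inverse (den k hx hy z w) * chaos \<rho> (num k hx hy z w) p"
  unfolding chaos_def pcoef_def by (simp add: algebra_simps)

lemma strip_symbol_dsin: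
  assumes "0 < hx" "0 < hy"
  shows "strip_symbol d hx hy (\<lambda>z w. dsin hx z)" "strip_symbol d hx hy (\<lambda>z w. dsin hy w)"
    "strip_symbol d hx hy (\<lambda>z w. dcos hx z)" "strip_symbol d hx hy (\<lambda>z w. dcos hy w)"
  using assms
  by (intro strip_symbol_x strip_symbol_y dsin_holomorphic dcos_holomorphic dsin_periodic dcos_periodic; simp)+

lemma strip_symbol_den: "0 < hx \<Longrightarrow> 0 < hy \<Longrightarrow> strip_symbol d hx hy (den k hx hy)"
  unfolding den_def[abs_def] symD_def by (intro strip_symbol_add strip_symbol_mult strip_symbol_const strip_symbol_dsin)

lemma chaos_num: "chaos \<rho> (num k hx hy z w) p = 1
    + (- \<i> * of_real (sqrt (\<rho>x * k) * fst p)) * dsin hx z + (- \<i> * of_real (sqrt (\<rho>y * k) * snd p)) * dsin hy w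
    + of_real (- ((sqrt (\<rho>x * k))\<^sup>2 / 2 * ((fst p)\<^sup>2 - 1))) * (dsin hx z * dsin hx z)
    + of_real (- ((sqrt (\<rho>y * k))\<^sup>2 / 2 * ((snd p)\<^sup>2 - 1))) * (dsin hy w * dsin hy w)
    + of_real (- (sqrt (\<rho>x * k) * sqrt (\<rho>y * k) * fst p * snd p)) * (dsin hx z * dsin hy w)"
proof -
  obtain x y where p: "p = (x, y)" by (cases p)
  show ?thesis unfolding p num_def chaos_ncoef fst_conv snd_conv
    by (simp only: of_real_mult of_real_minus of_real_divide of_real_power power_mult_distrib power2_eq_square of_real_numeral) (simp add: algebra_simps)
qed

lemma strip_symbol_num: "0 < hx \<Longrightarrow> 0 < hy \<Longrightarrow> strip_symbol d hx hy (\<lambda>z w. chaos \<rho> (num k hx hy z w) p)"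
  unfolding chaos_num by (intro strip_symbol_add strip_symbol_mult strip_symbol_const strip_symbol_dsin)

text \<open>The numerators are entire, so only the zeros of the denominator limit the strip, and it
  has none up to height \<open>tilt\<close>.\<close>

lemma strip_symbol_symb:
  assumes "0 < hx" "hx \<le> h0" "0 < hy" "hy \<le> h0" "0 \<le> k" "k \<le> T"
  shows "strip_symbol tilt hx hy (symb k hx hy Z n)"
  unfolding symb_def[abs_def] chaos_pcoef
proof (intro strip_symbol_prod strip_symbol_mult strip_symbol_inverse strip_symbol_den strip_symbol_num assms)
  show "den k hx hy z w \<noteq> 0" if "\<bar>Im z\<bar> < tilt" "\<bar>Im w\<bar> < tilt" for z w
    using den_nonzero(1)[OF assms, of z w] that by simp
qed

lemma implicit_gridf:
  assumes f: "real_continuous f" and h: "0 < hx" "0 < hy"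
  shows "implicit_op \<mu>x \<mu>y k hx hy (gridf hx hy x0 y0 f) = gridf hx hy x0 y0 (\<lambda>z w. den k hx hy z w * f z w)"
proof -
  define B1 B2 B3 B4 where "B1 = \<mu>x * k / (2 * hx)" and "B2 = \<mu>y * k / (2 * hy)" and "B3 = k / (2 * hx\<^sup>2)" and "B4 = k / (2 * hy\<^sup>2)"
  define L :: "(real \<times> int \<times> int) list" where "L = [(1 + 2 * B3 + 2 * B4, 0, 0),
     (B1 - B3, 1, 0), (- B1 - B3, -1, 0), (B2 - B4, 0, 1), (- B2 - B4, 0, -1)]"
  have sym: "den k hx hy z w = (\<Sum>(c, p, q)\<leftarrow>L. of_real c * exp (\<i> * (z * of_real (of_int p * hx) + w * of_real (of_int q * hy))))" for z w
  proof -
    define e1 e1' e2 e2' where "e1 = exp (\<i> * (z * of_real hx))" and "e1' = exp (- (\<i> * (z * of_real hx)))"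
      and "e2 = exp (\<i> * (w * of_real hy))" and "e2' = exp (- (\<i> * (w * of_real hy)))"
    note e = e1_def[symmetric] e1'_def[symmetric] e2_def[symmetric] e2'_def[symmetric]
    have d: "dsin hx z = - \<i> * (e1 - e1') / (2 * of_real hx)" "dsin hy w = - \<i> * (e2 - e2') / (2 * of_real hy)"
      "dcos hx z = (2 - e1 - e1') / (2 * (of_real hx)\<^sup>2)" "dcos hy w = (2 - e2 - e2') / (2 * (of_real hy)\<^sup>2)"
      using h by (simp_all add: dsin_exp dcos_exp e)
    have t: "\<i> * of_real m * (- \<i> * x / (2 * of_real u)) = of_real (m / (2 * u)) * x" "x / (2 * (of_real u)\<^sup>2) = of_real (1 / (2 * u\<^sup>2)) * x" for m u :: real and x
      by (cases "u = 0"; simp add: field_simps)+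
    have "den k hx hy z w = 1 + of_real B1 * (e1 - e1') + of_real B2 * (e2 - e2') + of_real B3 * (2 - e1 - e1') + of_real B4 * (2 - e2 - e2')"
      unfolding den_def symD_def d t B1_def B2_def B3_def B4_def by (simp add: distrib_left mult_ac)
    then show ?thesis unfolding L_def by (simp add: e) (simp add: algebra_simps)
  qed
  have "implicit_op \<mu>x \<mu>y k hx hy (gridf hx hy x0 y0 f) i j = (\<Sum>(c, p, q)\<leftarrow>L. c * gridf hx hy x0 y0 f (i + p) (j + q))" for i j
    unfolding implicit_op_def Dx_def Dy_def Dxx_def Dyy_def L_def B1_def[symmetric] B2_def[symmetric] B3_def[symmetric] B4_def[symmetric]
    by (simp add: algebra_simps)
  then show ?thesis unfolding gridf_stencil[OF f] sym by blast
qed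

lemma explicit_gridf:
  assumes f: "real_continuous f" and h: "0 < hx" "0 < hy" and k: "0 \<le> k"
  shows "explicit_op \<rho>x \<rho>y k hx hy X Y (gridf hx hy x0 y0 f) = gridf hx hy x0 y0 (\<lambda>z w. chaos \<rho> (num k hx hy z w) (X, Y) * f z w)"
proof -
  define ax ay A B C where "ax = sqrt (\<rho>x * k) * X / (2 * hx)" and "ay = sqrt (\<rho>y * k) * Y / (2 * hy)"
    and "A = \<rho>x * k * (X\<^sup>2 - 1) / (8 * hx\<^sup>2)" and "B = \<rho>y * k * (Y\<^sup>2 - 1) / (8 * hy\<^sup>2)"
    and "C = sqrt (\<rho>x * \<rho>y) * k * X * Y / (4 * hx * hy)"
  \<comment> \<open>Composing a central difference with itself reaches shifts by 2 and returns -2 to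
    the centre; together with the diagonal shifts of the mixed operator this makes thirteen
    points.\<close>
  define L :: "(real \<times> int \<times> int) list" where "L = [(1 - 2 * A - 2 * B, 0, 0),
     (- ax, 1, 0), (ax, -1, 0), (- ay, 0, 1), (ay, 0, -1), (A, 2, 0), (A, -2, 0), (B, 0, 2), (B, 0, -2),
     (C, 1, 1), (- C, -1, 1), (- C, 1, -1), (C, -1, -1)]"
  have rs: "sqrt (\<rho>x * k) * sqrt (\<rho>y * k) = sqrt (\<rho>x * \<rho>y) * k" "(sqrt (\<rho>x * k))\<^sup>2 = \<rho>x * k" "(sqrt (\<rho>y * k))\<^sup>2 = \<rho>y * k"
  proof -
    have "sqrt (\<rho>x * k) * sqrt (\<rho>y * k) = sqrt ((\<rho>x * \<rho>y) * (k * k))" unfolding real_sqrt_mult[symmetric] by (simp add: mult_ac)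
    also have "\<dots> = sqrt (\<rho>x * \<rho>y) * k" unfolding real_sqrt_mult[of "\<rho>x * \<rho>y"] using k by simp
    finally show "sqrt (\<rho>x * k) * sqrt (\<rho>y * k) = sqrt (\<rho>x * \<rho>y) * k" .
    show "(sqrt (\<rho>x * k))\<^sup>2 = \<rho>x * k" "(sqrt (\<rho>y * k))\<^sup>2 = \<rho>y * k"
      using k rx ry by (intro real_sqrt_pow2 mult_nonneg_nonneg; simp)+
  qed
  have sym: "chaos \<rho> (num k hx hy z w) (X, Y) = (\<Sum>(c, p, q)\<leftarrow>L. of_real c * exp (\<i> * (z * of_real (of_int p * hx) + w * of_real (of_int q * hy))))" for z w
  proof -
    define e1 e1' e2 e2' where "e1 = exp (\<i> * (z * of_real hx))" and "e1' = exp (- (\<i> * (z * of_real hx)))"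
      and "e2 = exp (\<i> * (w * of_real hy))" and "e2' = exp (- (\<i> * (w * of_real hy)))"
    have d: "dsin hx z = - \<i> * (e1 - e1') / (2 * of_real hx)" "dsin hy w = - \<i> * (e2 - e2') / (2 * of_real hy)"
      using h by (simp_all add: dsin_exp e1_def e1'_def e2_def e2'_def)
    have ee: "e1 * e1' = 1" "e2 * e2' = 1" by (simp_all add: e1_def e1'_def e2_def e2'_def flip: exp_add)
    have E: "exp (\<i> * (z * of_real (of_int 1 * hx) + w * of_real (of_int 0 * hy))) = e1" 
      "exp (\<i> * (z * of_real (of_int (-1) * hx) + w * of_real (of_int 0 * hy))) = e1'"
      "exp (\<i> * (z * of_real (of_int 0 * hx) + w * of_real (of_int 1 * hy))) = e2"
      "exp (\<i> * (z * of_real (of_int 0 * hx) + w * of_real (of_int (-1) * hy))) = e2'"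
      "exp (\<i> * (z * of_real (of_int 2 * hx) + w * of_real (of_int 0 * hy))) = e1 * e1"
      "exp (\<i> * (z * of_real (of_int (-2) * hx) + w * of_real (of_int 0 * hy))) = e1' * e1'"
      "exp (\<i> * (z * of_real (of_int 0 * hx) + w * of_real (of_int 2 * hy))) = e2 * e2"
      "exp (\<i> * (z * of_real (of_int 0 * hx) + w * of_real (of_int (-2) * hy))) = e2' * e2'"
      "exp (\<i> * (z * of_real (of_int 1 * hx) + w * of_real (of_int 1 * hy))) = e1 * e2"
      "exp (\<i> * (z * of_real (of_int (-1) * hx) + w * of_real (of_int 1 * hy))) = e1' * e2"
      "exp (\<i> * (z * of_real (of_int 1 * hx) + w * of_real (of_int (-1) * hy))) = e1 * e2'"
      "exp (\<i> * (z * of_real (of_int (-1) * hx) + w * of_real (of_int (-1) * hy))) = e1' * e2'"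
      "exp (\<i> * (z * of_real (of_int 0 * hx) + w * of_real (of_int 0 * hy))) = 1"
      unfolding e1_def e1'_def e2_def e2'_def exp_add[symmetric] by (simp_all add: algebra_simps)
    have "chaos \<rho> (num k hx hy z w) (X, Y) = 1 - of_real ax * (e1 - e1') - of_real ay * (e2 - e2')
       + of_real A * ((e1 - e1') * (e1 - e1')) + of_real B * ((e2 - e2') * (e2 - e2')) + of_real C * ((e1 - e1') * (e2 - e2'))"
    proof -
      have t: "(- \<i> * of_real (s * x)) * (- \<i> * e / (2 * of_real u)) = - (of_real (s * x / (2 * u)) * e)" if "u \<noteq> 0" for s x u :: real and e
        using that by (simp add: field_simps)
      have t2: "of_real (- u) * ((- \<i> * e / (2 * of_real v)) * (- \<i> * e' / (2 * of_real v'))) = of_real (u / (4 * v * v')) * (e * e')"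
        if "v \<noteq> 0" "v' \<noteq> 0" for u v v' :: real and e e'
        using that by (simp add: field_simps)
      have c: "\<rho>x * k / 2 * (X\<^sup>2 - 1) / (4 * hx * hx) = A" "\<rho>y * k / 2 * (Y\<^sup>2 - 1) / (4 * hy * hy) = B"
        "sqrt (\<rho>x * \<rho>y) * k * X * Y / (4 * hx * hy) = C"
        by (simp_all add: A_def B_def C_def power2_eq_square)
      have h0: "hx \<noteq> 0" "hy \<noteq> 0" using h by auto
      show ?thesis unfolding chaos_num fst_conv snd_conv d rs t[OF h0(1)] t[OF h0(2)] t2[OF h0(1) h0(1)] t2[OF h0(2) h0(2)] t2[OF h0] c
        by (simp add: ax_def ay_def)
    qed
    also have "(e1 - e1') * (e1 - e1') = e1 * e1 + e1' * e1' - 2 * (e1 * e1')" by (simp add: algebra_simps)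
    also have "(e2 - e2') * (e2 - e2') = e2 * e2 + e2' * e2' - 2 * (e2 * e2')" by (simp add: algebra_simps)
    finally show ?thesis unfolding L_def list.map prod.case E ee by (simp add: algebra_simps)
  qed
  have "explicit_op \<rho>x \<rho>y k hx hy X Y (gridf hx hy x0 y0 f) i j = (\<Sum>(c, p, q)\<leftarrow>L. c * gridf hx hy x0 y0 f (i + p) (j + q))" for i j
    unfolding explicit_op_def A_def[symmetric] B_def[symmetric] C_def[symmetric] ax_def[symmetric] ay_def[symmetric]
      Dx_def Dy_def Dxy_def L_def by (simp add: algebra_simps)
  then show ?thesis unfolding gridf_stencil[OF f] sym by blast
qed

text \<open>The Fourier synthesis is a square-summable solution of the implicit equation, and the
  energy identity shows that it is the only one; hence it is the grid selected by the definite
  description.\<close>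

theorem milstein_eq_gridf:
  assumes h: "0 < hx" "hx \<le> h0" "0 < hy" "hy \<le> h0" and k: "0 \<le> k" "k \<le> T" and x0: "x0 / hx \<in> \<int>" "y0 / hy \<in> \<int>"
  shows "milstein \<mu>x \<mu>y \<rho>x \<rho>y x0 y0 k hx hy zx zy n = gridf hx hy x0 y0 (symb k hx hy (\<lambda>m. (zx m, zy m)) n)"
proof (induction n)
  case 0
  show ?case by (simp add: symb_def gridf_one h x0 fun_eq_iff)
next
  case (Suc n)
  define Z where "Z = (\<lambda>m. (zx m, zy m))"
  have strip: "strip_symbol tilt hx hy (symb k hx hy Z m)" for m using h k by (rule strip_symbol_symb)
  have rc: "real_continuous (symb k hx hy Z m)" for m by (rule strip_symbol_real_continuous[OF strip tilt_pos])
  let ?V = "\<lambda>m. gridf hx hy x0 y0 (symb k hx hy Z m)"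
  have l2: "?V (Suc n) \<in> l2_grid" by (rule gridf_l2[OF strip tilt_pos h(1,3) x0])
  have "implicit_op \<mu>x \<mu>y k hx hy (?V (Suc n)) = gridf hx hy x0 y0 (\<lambda>z w. den k hx hy z w * symb k hx hy Z (Suc n) z w)"
    by (rule implicit_gridf[OF rc h(1,3)])
  also have "\<dots> = gridf hx hy x0 y0 (\<lambda>z w. chaos \<rho> (num k hx hy z w) (zx n, zy n) * symb k hx hy Z n z w)"
  proof -
    \<comment> \<open>Cancelling the denominator is needed on the real contour only, since that is
      where \<open>gridf\<close> evaluates its symbol.\<close>
    have "den k hx hy (Complex u 0) (Complex v 0) * symb k hx hy Z (Suc n) (Complex u 0) (Complex v 0)
       = chaos \<rho> (num k hx hy (Complex u 0) (Complex v 0)) (zx n, zy n) * symb k hx hy Z n (Complex u 0) (Complex v 0)" for u v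
      using den_nonzero(1)[OF h k, of "Complex u 0" "Complex v 0"] tilt_pos by (simp add: symb_def chaos_pcoef Z_def)
    then show ?thesis unfolding gridf_def[abs_def] fint_def by simp
  qed
  also have "\<dots> = explicit_op \<rho>x \<rho>y k hx hy (zx n) (zy n) (?V n)"
    by (rule explicit_gridf[OF rc h(1,3) k(1), symmetric])
  finally have eq: "implicit_op \<mu>x \<mu>y k hx hy (?V (Suc n)) = explicit_op \<rho>x \<rho>y k hx hy (zx n) (zy n) (?V n)" .
  have "U = ?V (Suc n)" if U: "U \<in> l2_grid" "implicit_op \<mu>x \<mu>y k hx hy U = explicit_op \<rho>x \<rho>y k hx hy (zx n) (zy n) (?V n)" for U
  proof -
    have "implicit_op \<mu>x \<mu>y k hx hy (\<lambda>i j. U i j - ?V (Suc n) i j) i j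
       = implicit_op \<mu>x \<mu>y k hx hy U i j - implicit_op \<mu>x \<mu>y k hx hy (?V (Suc n)) i j" for i j
      unfolding implicit_op_def Dx_def Dy_def Dxx_def Dyy_def by (simp add: right_diff_distrib distrib_left)
    then have "implicit_op \<mu>x \<mu>y k hx hy (\<lambda>i j. U i j - ?V (Suc n) i j) = (\<lambda>i j. 0)" using U(2) eq by (simp add: fun_eq_iff)
    from implicit_op_injective[OF l2_grid_diff[OF U(1) l2] k(1) this]
    show ?thesis by (simp add: fun_eq_iff)
  qed
  note uniq = this
  have "(THE U. U \<in> l2_grid \<and> implicit_op \<mu>x \<mu>y k hx hy U = explicit_op \<rho>x \<rho>y k hx hy (zx n) (zy n) (?V n)) = ?V (Suc n)"
    by (rule the_equality) (use l2 eq in blast, blast intro: uniq)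
  then show ?case unfolding milstein.simps Suc.IH unfolding Z_def .
qed

end

section \<open>The quadrant functional\<close>

text \<open>The remainder after n terms is minus the integral of r^(n+1) / (1 - r) times F, which
  tends to 0 by the uniform bound \<theta> < 1. On a real contour |r| = 1 and no such bound exists.
  Absolute summability then turns the limit into an unordered sum over positive integers.\<close>

lemma integral_geometric_has_sum:
  fixes r F :: "'a::euclidean_space \<Rightarrow> complex"
  assumes F: "continuous_on (cbox a b) F" and r: "continuous_on (cbox a b) r"
    and th: "0 \<le> \<theta>" "\<theta> < 1" "\<And>p. p \<in> cbox a b \<Longrightarrow> norm (r p) \<le> \<theta>"
  shows "((\<lambda>j::int. integral (cbox a b) (\<lambda>p. r p ^ nat j * F p)) has_sum integral (cbox a b) (\<lambda>p. r p / (1 - r p) * F p)) {1..}"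
proof -
  have r1: "r p \<noteq> 1" if "p \<in> cbox a b" for p using th(2) th(3)[OF that] by auto
  have "compact (F ` cbox a b)" by (intro compact_continuous_image F compact_cbox)
  then obtain B where B: "\<forall>x\<in>F ` cbox a b. norm x \<le> B" using compact_imp_bounded bounded_iff by metis
  define B' where "B' = max B 0"
  have B': "0 \<le> B'" "norm (F p) \<le> B'" if "p \<in> cbox a b" for p using B that by (auto simp: B'_def le_max_iff_disj)
  have B0: "0 \<le> B'" by (simp add: B'_def)
  define V where "V = measure lborel (cbox a b)"
  define f where "f n = integral (cbox a b) (\<lambda>p. r p ^ Suc n * F p)" for n
  define I where "I = integral (cbox a b) (\<lambda>p. r p / (1 - r p) * F p)"
  have int: "G integrable_on cbox a b" if "continuous_on (cbox a b) G" for G :: "'a \<Rightarrow> complex"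
    using that by (rule integrable_continuous)
  have fn: "norm (f n) \<le> \<theta> ^ Suc n * B' * V" for n
    unfolding f_def V_def
  proof (rule integrable_bound)
    show "(\<lambda>p. r p ^ Suc n * F p) integrable_on cbox a b" by (intro int continuous_intros r F)
    show "norm (r p ^ Suc n * F p) \<le> \<theta> ^ Suc n * B'" if "p \<in> cbox a b" for p
      unfolding norm_mult norm_power using th(3)[OF that] B'[OF that] th by (intro mult_mono power_mono) auto
  qed (use B0 th in simp)
  have part: "norm ((\<Sum>m<n. f m) - I) \<le> \<theta> ^ Suc n / (1 - \<theta>) * B' * V" for n
  proof -
    have "(\<Sum>m<n. f m) = integral (cbox a b) (\<lambda>p. \<Sum>m<n. r p ^ Suc m * F p)"
      unfolding f_def by (intro integral_sum[symmetric] int continuous_intros r F) auto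
    also have "\<dots> - I = integral (cbox a b) (\<lambda>p. (\<Sum>m<n. r p ^ Suc m * F p) - r p / (1 - r p) * F p)"
      unfolding I_def using r1 by (intro integral_diff[symmetric] int continuous_intros r F) auto
    also have "\<dots> = integral (cbox a b) (\<lambda>p. - (r p ^ Suc n / (1 - r p)) * F p)"
    proof (rule integral_cong)
      fix p assume p: "p \<in> cbox a b"
      have "(\<Sum>m<n. r p ^ Suc m * F p) = r p * (\<Sum>m<n. r p ^ m) * F p"
        by (simp add: sum_distrib_left sum_distrib_right)
      also have "(\<Sum>m<n. r p ^ m) = (1 - r p ^ n) / (1 - r p)" using r1[OF p] by (simp add: sum_gp_strict)
      finally have e: "(\<Sum>m<n. r p ^ Suc m * F p) = r p * ((1 - r p ^ n) / (1 - r p)) * F p" .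
      show "(\<Sum>m<n. r p ^ Suc m * F p) - r p / (1 - r p) * F p = - (r p ^ Suc n / (1 - r p)) * F p"
        unfolding e divide_inverse by (simp add: algebra_simps)
    qed
    also have "norm \<dots> \<le> \<theta> ^ Suc n / (1 - \<theta>) * B' * V"
      unfolding V_def
    proof (rule integrable_bound)
      show "(\<lambda>p. - (r p ^ Suc n / (1 - r p)) * F p) integrable_on cbox a b" using r1 by (intro int continuous_intros r F) auto
      show "norm (- (r p ^ Suc n / (1 - r p)) * F p) \<le> \<theta> ^ Suc n / (1 - \<theta>) * B'" if p: "p \<in> cbox a b" for p
      proof -
        have "1 - \<theta> \<le> norm (1 - r p)" using norm_triangle_ineq2[of 1 "r p"] th(3)[OF p] by simp
        then show ?thesis
          unfolding norm_mult norm_minus_cancel norm_divide norm_power using th(3)[OF p] B'[OF p] th by (intro mult_mono frac_le power_mono) auto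
      qed
    qed (use B0 th in simp)
    finally show ?thesis .
  qed
  have "(\<lambda>n. \<theta> ^ Suc n / (1 - \<theta>) * B' * V) \<longlonglongrightarrow> 0 / (1 - \<theta>) * B' * V"
    using th by (intro tendsto_mult tendsto_divide tendsto_const LIMSEQ_Suc[OF LIMSEQ_realpow_zero]) auto
  then have "(\<lambda>n. (\<Sum>m<n. f m) - I) \<longlonglongrightarrow> 0"
    by (intro Lim_null_comparison[OF always_eventually[OF allI[OF part]]]) simp
  then have sums: "f sums I" unfolding sums_def by (simp add: LIM_zero_iff)
  have "summable (\<lambda>n. norm (f n))"
  proof (rule summable_comparison_test')
    show "summable (\<lambda>n. \<theta> ^ n * (\<theta> * B' * V))" using th by (intro summable_mult2 summable_geometric) auto
    show "norm (norm (f n)) \<le> \<theta> ^ n * (\<theta> * B' * V)" if "0 \<le> n" for n using fn[of n] by (simp add: mult_ac)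
  qed
  then have "(f has_sum I) UNIV" using sums by (rule norm_summable_imp_has_sum)
  moreover have "f = (\<lambda>j. integral (cbox a b) (\<lambda>p. r p ^ nat j * F p)) \<circ> (\<lambda>n. int (Suc n))"
    by (simp add: f_def fun_eq_iff nat_add_distrib)
  moreover have "range (\<lambda>n. int (Suc n)) = {1..}"
  proof -
    have "x \<in> range (\<lambda>n. int (Suc n))" if "1 \<le> x" for x :: int
      using that by (intro image_eqI[of _ _ "nat (x - 1)"]) auto
    then show ?thesis by auto
  qed
  ultimately have "((\<lambda>j::int. integral (cbox a b) (\<lambda>p. r p ^ nat j * F p)) has_sum I) {1..}"
  proof -
    assume *: "(f has_sum I) UNIV" "f = (\<lambda>j. integral (cbox a b) (\<lambda>p. r p ^ nat j * F p)) \<circ> (\<lambda>n. int (Suc n))"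
      "range (\<lambda>n. int (Suc n)) = {1..}"
    have inj: "inj (\<lambda>n. int (Suc n))" by (auto simp: inj_on_def)
    show ?thesis using *(1) unfolding *(2) has_sum_reindex[OF inj, symmetric] *(3) .
  qed
  then show ?thesis unfolding I_def .
qed

lemma kern_eq:
  assumes "exp (\<i> * z * of_real h) \<noteq> 1"
  shows "kern h z = of_real h * (exp (\<i> * z * of_real h) / (1 - exp (\<i> * z * of_real h)) + 1 / 2)"
proof -
  define r where "r = exp (\<i> * z * of_real h)"
  have "1 - r \<noteq> 0" using assms by (simp add: r_def)
  then show ?thesis unfolding kern_def r_def[symmetric] by (simp add: field_simps)
qed

lemma wave_nonneg: "0 \<le> i \<Longrightarrow> wave h x0 i z = exp (\<i> * z * of_real h) ^ nat i * exp (- \<i> * (z * of_real x0))"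
proof -
  assume "0 \<le> i"
  then have "wave h x0 i z = exp (of_nat (nat i) * (\<i> * z * of_real h) + (- \<i> * (z * of_real x0)))"
    unfolding wave_def by (simp add: algebra_simps)
  then show ?thesis unfolding exp_add exp_of_nat_mult .
qed

text \<open>On a contour with positive imaginary part the quadrant sum becomes a product of two geometric series.\<close>

lemma quadrant_functional_gridf:
  assumes f: "strip_symbol d hx hy f" and h: "0 < hx" "0 < hy" and x0: "x0 / hx \<in> \<int>" "y0 / hy \<in> \<int>"
    and a: "0 < a" "a < d"
  shows "quadrant_functional hx hy (gridf hx hy x0 y0 f)
    = Re (fint hx hy a a (\<lambda>z w. exp (- \<i> * (z * of_real x0 + w * of_real y0)) * (kern hx z * kern hy w) * f z w)) / (4 * pi\<^sup>2)"
proof -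
  define rx where "rx p = exp (\<i> * Complex (fst p) a * of_real hx)" for p :: "real \<times> real"
  define ry where "ry p = exp (\<i> * Complex (snd p) a * of_real hy)" for p :: "real \<times> real"
  define Ph where "Ph p = exp (- \<i> * (Complex (fst p) a * of_real x0 + Complex (snd p) a * of_real y0)) * f (Complex (fst p) a) (Complex (snd p) a)" for p
  define lo up where "lo = (- (pi / hx), - (pi / hy))" and "up = (pi / hx, pi / hy)"
  have bx: "freq_box hx hy = cbox lo up" by (simp add: freq_box_def lo_def up_def)
  have ad: "\<bar>a\<bar> < d" using a by simp
  have crx: "continuous_on S rx" and cry: "continuous_on S ry" for S unfolding rx_def ry_def by (intro continuous_intros)+
  have cP: "continuous_on S Ph" for S unfolding Ph_def by (intro continuous_intros strip_symbol_continuous[OF f ad ad])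
  have nr: "norm (rx p) \<le> exp (- (a * hx))" "norm (ry p) \<le> exp (- (a * hy))" for p by (simp_all add: rx_def ry_def)
  have th: "0 \<le> exp (- (a * hx))" "exp (- (a * hx)) < 1" "0 \<le> exp (- (a * hy))" "exp (- (a * hy)) < 1" using a h by auto
  have r1: "rx p \<noteq> 1" "ry p \<noteq> 1" for p using nr[of p] th by auto
  define Q where "Q u = Re (integral (cbox lo up) (\<lambda>p. u p * Ph p)) / (4 * pi\<^sup>2)" for u
  have V: "gridf hx hy x0 y0 f i j = Q (\<lambda>p. rx p ^ nat i * ry p ^ nat j)" if "0 \<le> i" "0 \<le> j" for i j
    unfolding gridf_shift[OF f h x0 ad ad] Q_def fint_def bx
    by (intro arg_cong[where f = "\<lambda>x. Re x / (4 * pi\<^sup>2)"] integral_cong)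
       (simp add: wave_nonneg that rx_def ry_def Ph_def distrib_left exp_add exp_diff exp_minus field_simps)
  have sumy: "((\<lambda>j. Q (\<lambda>p. u p * ry p ^ nat j)) has_sum Q (\<lambda>p. u p * (ry p / (1 - ry p)))) {1..}"
    if u: "continuous_on (cbox lo up) u" for u
  proof -
    have "((\<lambda>j::int. integral (cbox lo up) (\<lambda>p. ry p ^ nat j * (u p * Ph p))) has_sum integral (cbox lo up) (\<lambda>p. ry p / (1 - ry p) * (u p * Ph p))) {1..}"
      by (rule integral_geometric_has_sum[OF continuous_on_mult[OF u cP] cry th(3,4) nr(2)])
    from has_sum_cmult_left[OF has_sum_Re[OF this], of "1 / (4 * pi\<^sup>2)"]
    show ?thesis unfolding Q_def by (simp add: mult_ac)
  qed
  have sumx: "((\<lambda>i. Q (\<lambda>p. rx p ^ nat i * u p)) has_sum Q (\<lambda>p. rx p / (1 - rx p) * u p)) {1..}"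
    if u: "continuous_on (cbox lo up) u" for u
  proof -
    have "((\<lambda>j::int. integral (cbox lo up) (\<lambda>p. rx p ^ nat j * (u p * Ph p))) has_sum integral (cbox lo up) (\<lambda>p. rx p / (1 - rx p) * (u p * Ph p))) {1..}"
      by (rule integral_geometric_has_sum[OF continuous_on_mult[OF u cP] crx th(1,2) nr(1)])
    from has_sum_cmult_left[OF has_sum_Re[OF this], of "1 / (4 * pi\<^sup>2)"]
    show ?thesis unfolding Q_def by (simp add: mult_ac)
  qed
  have row: "(\<Sum>\<^sub>\<infinity>j\<in>{1..}. gridf hx hy x0 y0 f i j) = Q (\<lambda>p. rx p ^ nat i * (ry p / (1 - ry p)))" if "0 \<le> i" for i
  proof -
    have "(\<Sum>\<^sub>\<infinity>j\<in>{1..}. gridf hx hy x0 y0 f i j) = (\<Sum>\<^sub>\<infinity>j\<in>{1..}. Q (\<lambda>p. rx p ^ nat i * ry p ^ nat j))"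
      using that by (intro infsum_cong V) auto
    also have "\<dots> = Q (\<lambda>p. rx p ^ nat i * (ry p / (1 - ry p)))" by (intro infsumI sumy continuous_intros crx)
    finally show ?thesis .
  qed
  have s1: "(\<Sum>\<^sub>\<infinity>i\<in>{1..}. \<Sum>\<^sub>\<infinity>j\<in>{1..}. gridf hx hy x0 y0 f i j) = Q (\<lambda>p. rx p / (1 - rx p) * (ry p / (1 - ry p)))"
  proof -
    have "(\<Sum>\<^sub>\<infinity>i\<in>{1..}. \<Sum>\<^sub>\<infinity>j\<in>{1..}. gridf hx hy x0 y0 f i j) = (\<Sum>\<^sub>\<infinity>i\<in>{1..}. Q (\<lambda>p. rx p ^ nat i * (ry p / (1 - ry p))))"
      by (intro infsum_cong row) auto
    also have "\<dots> = Q (\<lambda>p. rx p / (1 - rx p) * (ry p / (1 - ry p)))"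
      using r1 by (intro infsumI sumx continuous_intros cry) auto
    finally show ?thesis .
  qed
  have s2: "(\<Sum>\<^sub>\<infinity>j\<in>{1..}. gridf hx hy x0 y0 f 0 j) = Q (\<lambda>p. ry p / (1 - ry p))" using row[of 0] by simp
  have s3: "(\<Sum>\<^sub>\<infinity>i\<in>{1..}. gridf hx hy x0 y0 f i 0) = Q (\<lambda>p. rx p / (1 - rx p))"
  proof -
    have "(\<Sum>\<^sub>\<infinity>i\<in>{1..}. gridf hx hy x0 y0 f i 0) = (\<Sum>\<^sub>\<infinity>i\<in>{1..}. Q (\<lambda>p. rx p ^ nat i * 1))"
      by (intro infsum_cong) (simp add: V)
    also have "\<dots> = Q (\<lambda>p. rx p / (1 - rx p) * 1)" by (intro infsumI sumx continuous_intros)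
    finally show ?thesis by simp
  qed
  have s4: "gridf hx hy x0 y0 f 0 0 = Q (\<lambda>p. 1)" using V[of 0 0] by simp
  have Qadd: "Q (\<lambda>p. u p + v p) = Q u + Q v" if "continuous_on (cbox lo up) u" "continuous_on (cbox lo up) v" for u v
    unfolding Q_def distrib_right using that
    by (subst integral_add) (auto intro!: integrable_continuous continuous_intros cP simp: add_divide_distrib)
  have Qmul: "Q (\<lambda>p. of_real c * u p) = c * Q u" for c u
    unfolding Q_def mult.assoc by simp
  define sx sy where "sx p = rx p / (1 - rx p)" and "sy p = ry p / (1 - ry p)" for p
  have cs: "continuous_on S sx" "continuous_on S sy" for S
    unfolding sx_def sy_def using r1 by (auto intro!: continuous_intros crx cry)
  \<comment> \<open>The four pieces of the functional, with weights 1, 1/2, 1/2, 1/4, are the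
    expansion of hx (sx + 1/2) times hy (sy + 1/2), the product of the two trapezoidal
    kernels.\<close>
  have "quadrant_functional hx hy (gridf hx hy x0 y0 f)
     = hx * hy * Q (\<lambda>p. sx p * sy p) + hx * hy / 2 * Q sy + hx * hy / 2 * Q sx + hx * hy / 4 * Q (\<lambda>p. 1)"
    unfolding quadrant_functional_def s1 s2 s3 s4 sx_def sy_def by (simp add: algebra_simps)
  also have "\<dots> = Q (\<lambda>p. of_real (hx * hy) * (sx p * sy p) + of_real (hx * hy / 2) * sy p + of_real (hx * hy / 2) * sx p + of_real (hx * hy / 4) * 1)"
    unfolding Qmul[symmetric] by (simp only: Qadd[symmetric] cs continuous_on_add continuous_on_mult continuous_on_const)
  also have "\<dots> = Re (fint hx hy a a (\<lambda>z w. exp (- \<i> * (z * of_real x0 + w * of_real y0)) * (kern hx z * kern hy w) * f z w)) / (4 * pi\<^sup>2)"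
  proof -
    have "(of_real (hx * hy) * (sx p * sy p) + of_real (hx * hy / 2) * sy p + of_real (hx * hy / 2) * sx p + of_real (hx * hy / 4) * 1) * Ph p
      = exp (- \<i> * (Complex (fst p) a * of_real x0 + Complex (snd p) a * of_real y0)) * (kern hx (Complex (fst p) a) * kern hy (Complex (snd p) a))
         * f (Complex (fst p) a) (Complex (snd p) a)" for p
    proof -
      have k: "kern hx (Complex (fst p) a) = of_real hx * (sx p + 1 / 2)" "kern hy (Complex (snd p) a) = of_real hy * (sy p + 1 / 2)"
        using r1[of p] unfolding sx_def sy_def rx_def ry_def by (auto intro!: kern_eq)
      show ?thesis unfolding k Ph_def by (simp add: algebra_simps)
    qed
    then show ?thesis unfolding Q_def fint_def bx by simp
  qed
  finally show ?thesis .
qed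

section \<open>Second moments of oscillatory integrals\<close>

lemma nn_integral_gaussian_finite:
  assumes c: "0 < c"
  shows "(\<integral>\<^sup>+p. ennreal (exp (- c * ((fst p)\<^sup>2 + (snd p)\<^sup>2))) \<partial>(lborel :: (real \<times> real) measure)) < \<infinity>"
proof -
  \<comment> \<open>The standard deviation for which the normal density is a multiple of exp (- c
    x^2).\<close>
  define s where "s = sqrt (1 / (2 * c))"
  have s: "0 < s" "2 * s\<^sup>2 = 1 / c" using c by (simp_all add: s_def)
  have e: "exp (- c * x\<^sup>2) = sqrt (2 * pi * s\<^sup>2) * normal_density 0 s x" for x
    using s c by (simp add: normal_density_def)
  have one: "(\<integral>\<^sup>+x. ennreal (exp (- c * x\<^sup>2)) \<partial>lborel) = ennreal (sqrt (2 * pi * s\<^sup>2))"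
    unfolding e using s by (subst nn_integral_eq_integral) (auto intro!: integrable_mult_right)
  have "(\<integral>\<^sup>+p. ennreal (exp (- c * ((fst p)\<^sup>2 + (snd p)\<^sup>2))) \<partial>(lborel \<Otimes>\<^sub>M lborel))
     = (\<integral>\<^sup>+x. \<integral>\<^sup>+y. ennreal (exp (- c * x\<^sup>2)) * ennreal (exp (- c * y\<^sup>2)) \<partial>lborel \<partial>lborel)"
    by (subst lborel.nn_integral_fst[symmetric]) (auto simp: distrib_left exp_add[symmetric] ennreal_mult[symmetric])
  also have "\<dots> = ennreal (sqrt (2 * pi * s\<^sup>2)) * ennreal (sqrt (2 * pi * s\<^sup>2))"
    by (simp add: nn_integral_cmult nn_integral_multc one[unfolded mult_minus_left])
  finally show ?thesis unfolding lborel_prod by (simp add: ennreal_mult_less_top)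
qed

text \<open>Cauchy--Schwarz with a Gaussian weight, so that the size of the frequency domain does not enter.\<close>

lemma second_moment_of_integral_le:
  fixes g :: "'a \<Rightarrow> real \<times> real \<Rightarrow> complex" and X :: "'a \<Rightarrow> real"
  assumes M: "sigma_finite_measure M"
    and g: "(\<lambda>(\<omega>, p). g \<omega> p) \<in> borel_measurable (M \<Otimes>\<^sub>M lborel)"
    and X: "\<And>\<omega>. \<omega> \<in> space M \<Longrightarrow> ennreal \<bar>X \<omega>\<bar> \<le> (\<integral>\<^sup>+p. ennreal (norm (g \<omega> p)) \<partial>lborel)"
    and c: "0 < c" and A: "0 \<le> A"
    and m: "\<And>p. (\<integral>\<^sup>+\<omega>. ennreal ((norm (g \<omega> p))\<^sup>2) \<partial>M) \<le> ennreal (A * exp (- c * ((fst p)\<^sup>2 + (snd p)\<^sup>2)))"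
  shows "(\<integral>\<^sup>+\<omega>. ennreal (\<bar>X \<omega>\<bar>\<^sup>2) \<partial>M) \<le> ennreal A * (\<integral>\<^sup>+p. ennreal (exp (- (c / 2) * ((fst p)\<^sup>2 + (snd p)\<^sup>2))) \<partial>(lborel :: (real \<times> real) measure))\<^sup>2"
proof -
  interpret M: sigma_finite_measure M by (rule M)
  interpret pair_sigma_finite M "lborel :: (real \<times> real) measure" ..
  define q where "q p = (fst p)\<^sup>2 + (snd p)\<^sup>2" for p :: "real \<times> real"
  have [measurable]: "q \<in> borel_measurable borel" unfolding q_def by (intro borel_measurable_continuous_onI continuous_intros)
  define I where "I = (\<integral>\<^sup>+p. ennreal (exp (- (c / 2) * q p)) \<partial>lborel)"
  have [measurable]: "(\<lambda>x. g (fst x) (snd x)) \<in> borel_measurable (M \<Otimes>\<^sub>M lborel)" using g by (simp add: case_prod_beta')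
  have gm [measurable]: "g \<omega> \<in> borel_measurable lborel" if "\<omega> \<in> space M" for \<omega>
    using measurable_Pair2[OF g that] by simp
  have "(\<integral>\<^sup>+\<omega>. ennreal (\<bar>X \<omega>\<bar>\<^sup>2) \<partial>M) \<le> (\<integral>\<^sup>+\<omega>. (\<integral>\<^sup>+p. ennreal ((norm (g \<omega> p))\<^sup>2 * exp (c / 2 * q p)) \<partial>lborel) * I \<partial>M)"
  proof (rule nn_integral_mono)
    fix \<omega> assume w: "\<omega> \<in> space M"
    note [measurable] = gm[OF w]
    have "ennreal (\<bar>X \<omega>\<bar>\<^sup>2) = (ennreal \<bar>X \<omega>\<bar>)\<^sup>2" by (simp add: ennreal_power)
    also have "\<dots> \<le> (\<integral>\<^sup>+p. ennreal (norm (g \<omega> p)) \<partial>lborel)\<^sup>2" by (rule power_mono[OF X[OF w]]) simp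
    \<comment> \<open>The weight is split as exp (c/4 q) exp (- c/4 q). After squaring, half of the
      decay exp (- c q) of the moments compensates the growing factor and the other half stays
      integrable; both integrals over the frequency are then the same Gaussian I.\<close>
    also have "(\<integral>\<^sup>+p. ennreal (norm (g \<omega> p)) \<partial>lborel)
        = (\<integral>\<^sup>+p. ennreal (norm (g \<omega> p) * exp (c / 4 * q p)) * ennreal (exp (- (c / 4) * q p)) \<partial>lborel)"
      by (intro nn_integral_cong) (simp add: mult.assoc flip: ennreal_mult exp_add)
    also have "\<dots>\<^sup>2 \<le> (\<integral>\<^sup>+p. (ennreal (norm (g \<omega> p) * exp (c / 4 * q p)))\<^sup>2 \<partial>lborel) * (\<integral>\<^sup>+p. (ennreal (exp (- (c / 4) * q p)))\<^sup>2 \<partial>lborel)"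
      by (intro Cauchy_Schwarz_nn_integral) measurable
    also have "(\<integral>\<^sup>+p. (ennreal (norm (g \<omega> p) * exp (c / 4 * q p)))\<^sup>2 \<partial>lborel) = (\<integral>\<^sup>+p. ennreal ((norm (g \<omega> p))\<^sup>2 * exp (c / 2 * q p)) \<partial>lborel)"
      by (intro nn_integral_cong) (simp add: ennreal_power power_mult_distrib flip: exp_double)
    also have "(\<integral>\<^sup>+p. (ennreal (exp (- (c / 4) * q p)))\<^sup>2 \<partial>lborel) = I"
      unfolding I_def by (intro nn_integral_cong) (simp add: ennreal_power flip: exp_double)
    finally show "ennreal (\<bar>X \<omega>\<bar>\<^sup>2) \<le> (\<integral>\<^sup>+p. ennreal ((norm (g \<omega> p))\<^sup>2 * exp (c / 2 * q p)) \<partial>lborel) * I" .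
  qed
  also have "\<dots> = (\<integral>\<^sup>+\<omega>. (\<integral>\<^sup>+p. ennreal ((norm (g \<omega> p))\<^sup>2 * exp (c / 2 * q p)) \<partial>lborel) \<partial>M) * I"
    by (rule nn_integral_multc) measurable
  also have "(\<integral>\<^sup>+\<omega>. (\<integral>\<^sup>+p. ennreal ((norm (g \<omega> p))\<^sup>2 * exp (c / 2 * q p)) \<partial>lborel) \<partial>M)
     = (\<integral>\<^sup>+p. (\<integral>\<^sup>+\<omega>. ennreal ((norm (g \<omega> p))\<^sup>2 * exp (c / 2 * q p)) \<partial>M) \<partial>lborel)"
    by (rule Fubini'[symmetric]) (simp add: case_prod_beta')
  also have "\<dots> \<le> (\<integral>\<^sup>+p. ennreal A * ennreal (exp (- (c / 2) * q p)) \<partial>lborel)"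
  proof (rule nn_integral_mono)
    fix p :: "real \<times> real"
    have [measurable]: "(\<lambda>\<omega>. g \<omega> p) \<in> borel_measurable M" using measurable_Pair1[OF g, of p] by simp
    have "(\<integral>\<^sup>+\<omega>. ennreal ((norm (g \<omega> p))\<^sup>2 * exp (c / 2 * q p)) \<partial>M) = (\<integral>\<^sup>+\<omega>. ennreal ((norm (g \<omega> p))\<^sup>2) \<partial>M) * ennreal (exp (c / 2 * q p))"
      by (simp add: ennreal_mult nn_integral_multc)
    also have "\<dots> \<le> ennreal (A * exp (- c * q p)) * ennreal (exp (c / 2 * q p))"
      using m[of p] unfolding q_def by (intro mult_right_mono) auto
    also have "\<dots> = ennreal A * ennreal (exp (- (c / 2) * q p))"
      using A by (simp add: mult.assoc flip: ennreal_mult exp_add)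
    finally show "(\<integral>\<^sup>+\<omega>. ennreal ((norm (g \<omega> p))\<^sup>2 * exp (c / 2 * q p)) \<partial>M) \<le> ennreal A * ennreal (exp (- (c / 2) * q p))" .
  qed
  also have "\<dots> = ennreal A * I" unfolding I_def by (rule nn_integral_cmult) measurable
  finally have "(\<integral>\<^sup>+\<omega>. ennreal (\<bar>X \<omega>\<bar>\<^sup>2) \<partial>M) \<le> ennreal A * I * I" by (simp add: mult_right_mono)
  then show ?thesis unfolding I_def q_def by (simp add: power2_eq_square mult.assoc)
qed

context milstein_spde
begin

definition amp :: "real \<Rightarrow> real \<Rightarrow> real \<Rightarrow> nat \<Rightarrow> real \<Rightarrow> real \<Rightarrow> (nat \<Rightarrow> real \<times> real) \<Rightarrow> real \<times> real \<Rightarrow> complex" where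
  "amp x0 y0 k N hx hy Z p = exp (- \<i> * (Complex (fst p) (tilt / 2) * of_real x0 + Complex (snd p) (tilt / 2) * of_real y0))
     * (kern hx (Complex (fst p) (tilt / 2)) * kern hy (Complex (snd p) (tilt / 2)))
     * symb k hx hy Z N (Complex (fst p) (tilt / 2)) (Complex (snd p) (tilt / 2))"

lemma continuous_on_kern:
  assumes "continuous_on S u" "0 < h" shows "continuous_on S (\<lambda>p. kern h (Complex (u p) (tilt / 2)))"
proof -
  have "exp (\<i> * Complex x (tilt / 2) * of_real h) \<noteq> 1" for x
  proof
    assume "exp (\<i> * Complex x (tilt / 2) * of_real h) = 1"
    then have "norm (exp (\<i> * Complex x (tilt / 2) * of_real h)) = 1" by simp
    then show False using assms(2) tilt_pos by simp
  qed
  then show ?thesis unfolding kern_def using assms(1) by (intro continuous_intros) auto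
qed

lemma continuous_on_amp:
  assumes "0 < hx" "hx \<le> h0" "0 < hy" "hy \<le> h0" "0 \<le> k" "k \<le> T"
  shows "continuous_on S (amp x0 y0 k N hx hy Z)"
  unfolding amp_def using assms tilt_pos
  by (intro continuous_intros continuous_on_kern strip_symbol_continuous[OF strip_symbol_symb[OF assms]]) auto

text \<open>The gauge integral over the box becomes a Lebesgue integral over the whole plane with an
  indicator, so that meshes with different frequency boxes can be subtracted under one
  integral.\<close>

lemma quadrant_functional_milstein:
  assumes h: "0 < hx" "hx \<le> h0" "0 < hy" "hy \<le> h0" and k: "0 \<le> k" "k \<le> T" and x0: "x0 / hx \<in> \<int>" "y0 / hy \<in> \<int>"
  shows "quadrant_functional hx hy (milstein \<mu>x \<mu>y \<rho>x \<rho>y x0 y0 k hx hy zx zy N)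
    = Re (\<integral>p. indicator (freq_box hx hy) p *\<^sub>R amp x0 y0 k N hx hy (\<lambda>m. (zx m, zy m)) p \<partial>lborel) / (4 * pi\<^sup>2)"
proof -
  have t: "0 < tilt / 2" "tilt / 2 < tilt" using tilt_pos by auto
  have "set_integrable lborel (freq_box hx hy) (amp x0 y0 k N hx hy (\<lambda>m. (zx m, zy m)))"
    unfolding set_integrable_def freq_box_def by (intro borel_integrable_compact compact_cbox continuous_on_amp assms)
  from set_borel_integral_eq_integral(2)[OF this] show ?thesis
    unfolding milstein_eq_gridf[OF h k x0] quadrant_functional_gridf[OF strip_symbol_symb[OF h k] h(1,3) x0 t]
    by (simp add: set_lebesgue_integral_def fint_def amp_def[abs_def])
qed

text \<open>Joint measurability in the sample point and the frequency is required for exchanging the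
  expectation with the frequency integral. It follows because the amplitude is built from functions
  of the frequency alone and polynomials in the increments.\<close>

lemma measurable_amp:
  assumes Z: "\<And>n. (\<lambda>\<omega>. Z \<omega> n) \<in> borel_measurable M" and h: "0 < hx" "0 < hy"
  shows "(\<lambda>x. amp x0 y0 k N hx hy (Z (fst x)) (snd x)) \<in> borel_measurable (M \<Otimes>\<^sub>M lborel)"
proof -
  define zc where "zc u = Complex u (tilt / 2)" for u
  define ds where "ds h u = dsin h (zc u)" for h u
  define dc where "dc h u = dcos h (zc u)" for h u
  define kn where "kn h u = kern h (zc u)" for h u
  have czc: "continuous_on UNIV zc" unfolding zc_def by (intro continuous_intros)
  have [measurable]: "zc \<in> borel_measurable borel" using czc by (rule borel_measurable_continuous_onI)
  have [measurable]: "ds h \<in> borel_measurable borel" "dc h \<in> borel_measurable borel" for h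
    unfolding ds_def dc_def
    by (intro borel_measurable_continuous_onI continuous_on_compose2[OF holomorphic_on_imp_continuous_on[OF dsin_holomorphic[of _ UNIV]] czc]
      continuous_on_compose2[OF holomorphic_on_imp_continuous_on[OF dcos_holomorphic[of _ UNIV]] czc]; simp)+
  have [measurable]: "kn hx \<in> borel_measurable borel" "kn hy \<in> borel_measurable borel"
    unfolding kn_def zc_def using h by (intro borel_measurable_continuous_onI continuous_on_kern continuous_on_id; simp)+
  have [measurable]: "(\<lambda>\<omega>. fst (Z \<omega> n)) \<in> borel_measurable M" "(\<lambda>\<omega>. snd (Z \<omega> n)) \<in> borel_measurable M" for n
    using measurable_compose[OF Z borel_measurable_continuous_onI[OF continuous_on_fst[OF continuous_on_id]]]
      measurable_compose[OF Z borel_measurable_continuous_onI[OF continuous_on_snd[OF continuous_on_id]]] by simp_all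
  have [measurable]: "(fst :: real \<times> real \<Rightarrow> real) \<in> borel_measurable borel" "(snd :: real \<times> real \<Rightarrow> real) \<in> borel_measurable borel"
    by (intro borel_measurable_continuous_onI continuous_intros)+
  show ?thesis
    unfolding amp_def symb_def chaos_pcoef chaos_num den_def symD_def zc_def[symmetric] ds_def[symmetric] dc_def[symmetric] kn_def[symmetric]
    by measurable
qed

end

section \<open>Assembly: from the moments of the modes to the moments of the mixed
  difference\<close>

theorem theorem2p2:
  fixes M :: "'a measure" and W :: "real \<Rightarrow> 'a \<Rightarrow> real \<times> real"
    and T \<mu>x \<mu>y \<rho>x \<rho>y \<rho>xy h0 x0 y0 Lambda :: real
  assumes "T > 0"
    and "0 \<le> \<rho>x" "\<rho>x < 1" "0 \<le> \<rho>y" "\<rho>y < 1"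
    and "-1 \<le> \<rho>xy" "\<rho>xy \<le> 1"
    and "2 * \<rho>x\<^sup>2 * (1 + 2 * \<bar>\<rho>xy\<bar>) \<le> 1"
    and "2 * \<rho>y\<^sup>2 * (1 + 2 * \<bar>\<rho>xy\<bar>) \<le> 1"
    and "2 * \<rho>x * \<rho>y * (3 * \<rho>xy\<^sup>2 + 2 * \<bar>\<rho>xy\<bar> + 1) \<le> 1"
    and "h0 > 0" "x0 / h0 \<in> \<int>" "y0 / h0 \<in> \<int>"
    and "Lambda > 0"
    and "correlated_BM M \<rho>xy W"
  shows "\<exists>C. \<forall>l1\<ge>1. \<forall>l2\<ge>1. \<forall>k>0. \<forall>N\<ge>1.
           real N = T / k \<and> k / min ((mesh h0 l1)\<^sup>2) ((mesh h0 l2)\<^sup>2) \<le> Lambda \<longrightarrow>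
             integrable M (DeltaP \<mu>x \<mu>y \<rho>x \<rho>y x0 y0 h0 W k N l1 l2) \<and>
             \<bar>prob_space.expectation M (DeltaP \<mu>x \<mu>y \<rho>x \<rho>y x0 y0 h0 W k N l1 l2)\<bar>
               \<le> C * (mesh h0 l1)\<^sup>2 * (mesh h0 l2)\<^sup>2 \<and>
             integrable M (\<lambda>\<omega>. \<bar>DeltaP \<mu>x \<mu>y \<rho>x \<rho>y x0 y0 h0 W k N l1 l2 \<omega>\<bar>\<^sup>2) \<and>
             prob_space.expectation M (\<lambda>\<omega>. \<bar>DeltaP \<mu>x \<mu>y \<rho>x \<rho>y x0 y0 h0 W k N l1 l2 \<omega>\<bar>\<^sup>2)
               \<le> C * (mesh h0 l1) ^ 4 * (mesh h0 l2) ^ 4"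
proof -
  interpret S: milstein_spde T \<mu>x \<mu>y \<rho>x \<rho>y \<rho>xy h0 Lambda
    using assms by unfold_locales auto
  interpret prob_space M using assms(15) unfolding correlated_BM_def by simp
  note BM = assms(15)
  obtain C c where C: "0 \<le> C" and c: "0 < c" and moment:
    "\<And>hx hy k N \<xi> \<eta>. S.resolved k N hx hy \<xi> \<eta> \<Longrightarrow>
       (\<integral>\<^sup>+\<omega>. ennreal ((norm (S.mixed x0 y0 k hx hy N (incr W k \<omega>) (Complex \<xi> (S.tilt / 2)) (Complex \<eta> (S.tilt / 2))))\<^sup>2) \<partial>M)
       \<le> ennreal (C * hx^4 * hy^4 * exp (- c * (\<xi>\<^sup>2 + \<eta>\<^sup>2)))"
    using S.mixed_second_moment[OF BM, of x0 y0] by blast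
  define I where "I = enn2real (\<integral>\<^sup>+p. ennreal (exp (- (c / 2) * ((fst p)\<^sup>2 + (snd p)\<^sup>2))) \<partial>(lborel :: (real \<times> real) measure))"
  have I: "(\<integral>\<^sup>+p. ennreal (exp (- (c / 2) * ((fst p)\<^sup>2 + (snd p)\<^sup>2))) \<partial>(lborel :: (real \<times> real) measure)) = ennreal I"
    unfolding I_def using nn_integral_gaussian_finite[of "c / 2"] c by simp
  have I0: "0 \<le> I" by (simp add: I_def)
  \<comment> \<open>The summand 1 ensures D >= 1, so that one constant serves both estimates: the
    bound for the expectation uses D <= D^2.\<close>
  define D where "D = C * I\<^sup>2 + 1"
  have D: "1 \<le> D" using C by (simp add: D_def)
  show ?thesis
  proof (rule exI[of _ D], intro allI impI, elim conjE)
    fix l1 l2 N :: nat and k :: real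
    assume l: "1 \<le> l1" "1 \<le> l2" and k: "0 < k" and N: "1 \<le> N" "real N = T / k"
      and kL: "k / min ((mesh h0 l1)\<^sup>2) ((mesh h0 l2)\<^sup>2) \<le> Lambda"
    define hx hy where "hx = mesh h0 l1" and "hy = mesh h0 l2"
    have mesh: "0 < mesh h0 l" "mesh h0 l \<le> h0" for l
      using S.h0 by (auto simp: mesh_def divide_le_eq mult_le_cancel_left1)
    have mesh2: "mesh h0 (l - 1) = 2 * mesh h0 l" if "1 \<le> l" for l
      using that by (cases l) (auto simp: mesh_def)
    have h: "0 < hx" "2 * hx \<le> h0" "0 < hy" "2 * hy \<le> h0"
      using mesh l mesh2[of l1] mesh2[of l2] unfolding hx_def hy_def by metis+
    have Nk: "real N * k = T" "0 < N" using N k by auto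
    have "1 * k \<le> real N * k" using N(1) k by (intro mult_right_mono) auto
    then have kT: "k \<le> T" by (simp only: Nk mult_1)
    have mn: "0 < min (hx\<^sup>2) (hy\<^sup>2)" using h by simp
    have kh: "k \<le> Lambda * hx\<^sup>2" "k \<le> Lambda * hy\<^sup>2"
    proof -
      have "k \<le> Lambda * min (hx\<^sup>2) (hy\<^sup>2)" using kL mn unfolding hx_def hy_def by (simp add: pos_divide_le_eq)
      moreover have "Lambda * min (hx\<^sup>2) (hy\<^sup>2) \<le> Lambda * hx\<^sup>2" "Lambda * min (hx\<^sup>2) (hy\<^sup>2) \<le> Lambda * hy\<^sup>2"
        using S.Lam by (auto intro!: mult_left_mono)
      ultimately show "k \<le> Lambda * hx\<^sup>2" "k \<le> Lambda * hy\<^sup>2" by linarith+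
    qed
    have ints: "x / mesh h0 l \<in> \<int>" if "x / h0 \<in> \<int>" for x l
    proof -
      have "x / mesh h0 l = x / h0 * 2 ^ l" by (simp add: mesh_def)
      moreover have "x / h0 * 2 ^ l \<in> \<int>" using that by (intro Ints_mult Ints_power) auto
      ultimately show ?thesis by (simp only:)
    qed
    define Z where "Z \<omega> = incr W k \<omega>" for \<omega>
    define a where "a = S.tilt / 2"
    define G where "G g1 g2 \<omega> p = indicator (freq_box g1 g2) p *\<^sub>R S.amp x0 y0 k N g1 g2 (Z \<omega>) p" for g1 g2 \<omega> p
    define g where "g \<omega> p = indicator (freq_box hx hy) p *\<^sub>R S.mixed x0 y0 k hx hy N (Z \<omega>) (Complex (fst p) a) (Complex (snd p) a)" for \<omega> p
    let ?X = "DeltaP \<mu>x \<mu>y \<rho>x \<rho>y x0 y0 h0 W k N l1 l2"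
    have Pint: "P \<mu>x \<mu>y \<rho>x \<rho>y x0 y0 h0 W k N i j \<omega> = Re (\<integral>p. G (mesh h0 i) (mesh h0 j) \<omega> p \<partial>lborel) / (4 * pi\<^sup>2)" for i j \<omega>
      unfolding P_def G_def Z_def incr_def[abs_def] using mesh k kT ints assms by (intro S.quadrant_functional_milstein) auto
    have Gint: "integrable lborel (G g1 g2 \<omega>)" if "0 < g1" "g1 \<le> h0" "0 < g2" "g2 \<le> h0" for g1 g2 \<omega>
      unfolding G_def freq_box_def using that k kT by (intro borel_integrable_compact compact_cbox S.continuous_on_amp) auto
    have bx: "p \<in> freq_box g1 g2 \<longleftrightarrow> \<bar>fst p\<bar> * g1 \<le> pi \<and> \<bar>snd p\<bar> * g2 \<le> pi" if "0 < g1" "0 < g2" for p g1 g2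
    proof -
      have 1: "\<bar>x\<bar> * g \<le> pi \<longleftrightarrow> - (pi / g) \<le> x \<and> x \<le> pi / g" if "0 < g" for x g
        unfolding pos_le_divide_eq[OF that, symmetric] abs_le_iff by auto
      show ?thesis unfolding 1[OF that(1)] 1[OF that(2)] by (cases p) (auto simp: freq_box_def)
    qed
    \<comment> \<open>The four terms live on different frequency boxes. Inside a coarse box
      \<open>msh\<close> is the true coarse mesh; on the excess frequencies the value 0 in
      \<open>start\<close> matches the vanishing indicator; outside the fine box all four terms are
      0.\<close>
    have geq: "g \<omega> p = G (2 * hx) (2 * hy) \<omega> p - G (2 * hx) hy \<omega> p - G hx (2 * hy) \<omega> p + G hx hy \<omega> p" for \<omega> p
    proof -
      have "indicator (freq_box hx hy) p *\<^sub>R S.corner x0 y0 k hx hy N (Z \<omega>) (Complex (fst p) a) (Complex (snd p) a) b1 b2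
         = G (if b1 then 2 * hx else hx) (if b2 then 2 * hy else hy) \<omega> p" for b1 b2
      proof (cases "p \<in> freq_box hx hy")
        case True
        then have in1: "\<bar>fst p\<bar> * hx \<le> pi" "\<bar>snd p\<bar> * hy \<le> pi" using bx h by auto
        show ?thesis
          using True in1 h unfolding G_def S.corner_def S.amp_def S.start_def S.symb_def a_def
          by (cases b1; cases b2) (auto simp: bx msh_def coarse_def indicator_def)
      next
        case False
        have half: "\<bar>x\<bar> * g \<le> pi" if "\<bar>x\<bar> * (2 * g) \<le> pi" "0 < g" for x g :: real
        proof -
          have "0 \<le> \<bar>x\<bar> * g" using that(2) by simp
          then show ?thesis using that(1) by linarith
        qed
        have "p \<notin> freq_box (if b1 then 2 * hx else hx) (if b2 then 2 * hy else hy)"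
          using False h half by (auto simp: bx split: if_splits)
        then show ?thesis using False by (simp add: G_def)
      qed
      note cor = this
      show ?thesis
        unfolding g_def S.mixed_def scaleR_diff_right scaleR_add_right cor by simp
    qed
    have Gi: "integrable lborel (G (2 * hx) (2 * hy) \<omega>)" "integrable lborel (G (2 * hx) hy \<omega>)" "integrable lborel (G hx (2 * hy) \<omega>)" "integrable lborel (G hx hy \<omega>)" for \<omega>
      using h by (intro Gint; simp)+
    have gi: "integrable lborel (g \<omega>)" for \<omega>
      unfolding geq[abs_def] by (intro Bochner_Integration.integrable_add Bochner_Integration.integrable_diff Gi)
    have Xint: "?X \<omega> = Re (\<integral>p. g \<omega> p \<partial>lborel) / (4 * pi\<^sup>2)" for \<omega>
    proof -
      have "(\<integral>p. g \<omega> p \<partial>lborel) = (\<integral>p. G (2 * hx) (2 * hy) \<omega> p \<partial>lborel) - (\<integral>p. G (2 * hx) hy \<omega> p \<partial>lborel)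
         - (\<integral>p. G hx (2 * hy) \<omega> p \<partial>lborel) + (\<integral>p. G hx hy \<omega> p \<partial>lborel)"
        unfolding geq using Gi by (simp add: Bochner_Integration.integral_add Bochner_Integration.integral_diff)
      then show ?thesis
        unfolding DeltaP_def Pint mesh2[OF l(1)] mesh2[OF l(2)] hx_def[symmetric] hy_def[symmetric]
        by (simp add: add_divide_distrib diff_divide_distrib)
    qed
    have Zm: "(\<lambda>\<omega>. Z \<omega> n) \<in> borel_measurable M" for n unfolding Z_def by (rule measurable_increment[OF BM k])
    have Gm: "(\<lambda>x. G g1 g2 (fst x) (snd x)) \<in> borel_measurable (M \<Otimes>\<^sub>M lborel)" if "0 < g1" "0 < g2" for g1 g2
    proof -
      have [measurable]: "(\<lambda>x. S.amp x0 y0 k N g1 g2 (Z (fst x)) (snd x)) \<in> borel_measurable (M \<Otimes>\<^sub>M lborel)"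
        by (rule S.measurable_amp[OF Zm that])
      have [measurable]: "freq_box g1 g2 \<in> sets borel" by (simp add: freq_box_def)
      show ?thesis unfolding G_def by measurable
    qed
    have gm: "(\<lambda>(\<omega>, p). g \<omega> p) \<in> borel_measurable (M \<Otimes>\<^sub>M lborel)"
      unfolding case_prod_beta' geq using h by (intro borel_measurable_add borel_measurable_diff Gm) auto
    have Xm: "?X \<in> borel_measurable M"
    proof -
      have "(\<lambda>\<omega>. \<integral>p. g \<omega> p \<partial>lborel) \<in> borel_measurable M" by (rule lborel.borel_measurable_lebesgue_integral[OF gm])
      then show ?thesis unfolding Xint[abs_def] by measurable
    qed
    have Xle: "ennreal \<bar>?X \<omega>\<bar> \<le> (\<integral>\<^sup>+p. ennreal (norm (g \<omega> p)) \<partial>lborel)" for \<omega>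
    proof -
      have "1 * 1 \<le> 4 * pi\<^sup>2" using pi_gt3 by (intro mult_mono one_le_power) auto
      then have "\<bar>?X \<omega>\<bar> \<le> \<bar>Re (\<integral>p. g \<omega> p \<partial>lborel)\<bar> / 1" unfolding Xint abs_divide by (intro frac_le) auto
      also have "\<dots> \<le> norm (\<integral>p. g \<omega> p \<partial>lborel)" using abs_Re_le_cmod by simp
      finally show ?thesis using integral_norm_bound_ennreal[OF gi[of \<omega>]] by (meson ennreal_leI order_trans)
    qed
    \<comment> \<open>The moment bound is pointwise in the frequency and Gaussian, so the growing
      frequency boxes do not enter the constant.\<close>
    have sq: "(\<integral>\<^sup>+\<omega>. ennreal (\<bar>?X \<omega>\<bar>\<^sup>2) \<partial>M) \<le> ennreal (C * hx^4 * hy^4 * I\<^sup>2)"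
    proof -
      have "(\<integral>\<^sup>+\<omega>. ennreal (\<bar>?X \<omega>\<bar>\<^sup>2) \<partial>M) \<le> ennreal (C * hx^4 * hy^4) * (ennreal I)\<^sup>2"
        unfolding I[symmetric]
      proof (rule second_moment_of_integral_le[OF _ gm Xle c])
        show "(\<integral>\<^sup>+\<omega>. ennreal ((norm (g \<omega> p))\<^sup>2) \<partial>M) \<le> ennreal (C * hx^4 * hy^4 * exp (- c * ((fst p)\<^sup>2 + (snd p)\<^sup>2)))" for p
        proof (cases "p \<in> freq_box hx hy")
          case True
          then have "S.resolved k N hx hy (fst p) (snd p)"
            using h k Nk kh by (simp add: bx S.resolved_def)
          from moment[OF this] True show ?thesis unfolding g_def a_def Z_def by simp
        qed (simp add: g_def)
      qed (use C h in \<open>auto intro: sigma_finite_measure_axioms\<close>)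
      also have "\<dots> = ennreal (C * hx^4 * hy^4 * I\<^sup>2)" using C I0 by (simp add: ennreal_mult ennreal_power)
      finally show ?thesis .
    qed
    have i2: "integrable M (\<lambda>\<omega>. \<bar>?X \<omega>\<bar>\<^sup>2)"
      using Xm sq by (intro integrableI_bounded) (auto intro: le_less_trans)
    then have i2': "integrable M (\<lambda>\<omega>. (?X \<omega>)\<^sup>2)" by simp
    have i1: "integrable M ?X"
    proof (rule Bochner_Integration.integrable_bound)
      show "integrable M (\<lambda>\<omega>. 1 + (?X \<omega>)\<^sup>2)" using i2' by simp
      have "\<bar>x\<bar> \<le> 1 + x\<^sup>2" for x :: real using sum_squares_bound[of 1 "\<bar>x\<bar>"] by simp
      then show "AE \<omega> in M. norm (?X \<omega>) \<le> norm (1 + (?X \<omega>)\<^sup>2)" by (simp add: abs_of_nonneg)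
    qed (rule Xm)
    have e2: "expectation (\<lambda>\<omega>. \<bar>?X \<omega>\<bar>\<^sup>2) \<le> C * hx^4 * hy^4 * I\<^sup>2"
    proof -
      have "ennreal (expectation (\<lambda>\<omega>. \<bar>?X \<omega>\<bar>\<^sup>2)) \<le> ennreal (C * hx^4 * hy^4 * I\<^sup>2)"
        using sq nn_integral_eq_integral[OF i2] by simp
      then show ?thesis using C by (simp add: ennreal_le_iff)
    qed
    have hp: "0 \<le> hx^4 * hy^4" "0 \<le> hx\<^sup>2 * hy\<^sup>2" by auto
    have e2D: "expectation (\<lambda>\<omega>. \<bar>?X \<omega>\<bar>\<^sup>2) \<le> D * hx^4 * hy^4"
    proof -
      have "D * hx^4 * hy^4 = C * hx^4 * hy^4 * I\<^sup>2 + hx^4 * hy^4" by (simp add: D_def algebra_simps)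
      then show ?thesis using e2 hp(1) by linarith
    qed
    \<comment> \<open>Nonnegativity of the variance reduces the first moment to the second, whose
      fourth powers of the meshes are the squares of the required orders.\<close>
    have "(expectation ?X)\<^sup>2 \<le> expectation (\<lambda>\<omega>. (?X \<omega>)\<^sup>2)"
      using variance_eq[OF i1 i2'] variance_positive[of ?X] by simp
    also have "\<dots> \<le> D * hx^4 * hy^4" using e2D by simp
    also have "\<dots> \<le> (D * D) * hx^4 * hy^4" using D hp by (intro mult_right_mono) (auto simp: mult_le_cancel_left1)
    also have "\<dots> = (D * hx\<^sup>2 * hy\<^sup>2)\<^sup>2" by (simp add: power_mult_distrib power2_eq_square power4_eq_xxxx)
    finally have "\<bar>expectation ?X\<bar> \<le> \<bar>D * hx\<^sup>2 * hy\<^sup>2\<bar>" by (simp add: abs_le_square_iff)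
    also have "\<dots> = D * hx\<^sup>2 * hy\<^sup>2" using D by simp
    finally have e1: "\<bar>expectation ?X\<bar> \<le> D * hx\<^sup>2 * hy\<^sup>2" .
    show "integrable M ?X \<and> \<bar>expectation ?X\<bar> \<le> D * (mesh h0 l1)\<^sup>2 * (mesh h0 l2)\<^sup>2 \<and>
      integrable M (\<lambda>\<omega>. \<bar>?X \<omega>\<bar>\<^sup>2) \<and> expectation (\<lambda>\<omega>. \<bar>?X \<omega>\<bar>\<^sup>2) \<le> D * (mesh h0 l1) ^ 4 * (mesh h0 l2) ^ 4"
      using i1 i2 e1 e2D unfolding hx_def hy_def by blast
  qed
qed

end
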